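(* There exists a constant $0<\alpha<1$ such that for all $\epsilon>0$, \[ \limsup_{\|x\|_1 \to \infty} \frac{1}{\|x\|_1^{\alpha}} \log \bar{P}\bigl(T(0,x) \geq (1+\epsilon)\mu(x)\bigr)<0, \] where the limit superior is over $x\in\mathbb{Z}^d$.
   Context: Let $d \geq 2$. Let $\omega=(\omega(x))_{x \in \mathbb{Z}^d}$ be independent random variables with a common law on $\mathbb{N}_0=\{0,1,2,\dots\}$, not concentrated at $0$. Independently of $\omega$, let $(S_k(x,\ell))_{k \geq 0}$, $x \in \mathbb{Z}^d$, $\ell \in \mathbb{N}$, be independent simple random walks on $\mathbb{Z}^d$ with $S_0(x,\ell)=x$. For $x,y \in \mathbb{Z}^d$ let $\tau(x,y):=\inf\{k \geq 0: S_k(x,\ell)=y \text{ for some } 1 \leq \ell \leq \omega(x)\}$, with $\tau(x,y):=\infty$ if $\omega(x)=0$, and define the first passage time $T(x,y):=\inf\{\sum_{i=0}^{m-1}\tau(x_i,x_{i+1}): m \geq 1,\ x=x_0,x_1,\dots,x_m=y \in \mathbb{Z}^d\}$. Write $\bar{P}:=P(\cdot \mid \omega(0) \geq 1)$ and $\|\cdot\|_1$ for the $\ell^1$-norm. The time constant $\mu(\cdot)$ is the (deterministic) norm on $\mathbb{R}^d$ such that almost surely on $\{\omega(0)\ge 1\}$, $\lim_{\|x\|_1\to\infty}(T(0,x)-\mu(x))/\|x\|_1=0$ (its existence is known). *)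

theory Defs
  imports "HOL-Probability.Probability" "HOL-Library.Extended_Nat"
begin

text \<open>Frog-model first passage percolation on the lattice with dimension CARD('d).
  A sample is a pair (om, xi): om x is the number of frogs at x, and
  xi (x, l, k) is the (k+1)-th increment of the l-th random walk started at x.\<close>

type_synonym 'd sample = "((int^'d) \<Rightarrow> nat) \<times> ((int^'d) \<times> nat \<times> nat \<Rightarrow> (int^'d))"

definition norm1 :: "int^'d \<Rightarrow> int" where
  "norm1 x = (\<Sum>i\<in>UNIV. \<bar>x $ i\<bar>)"

definition unit_steps :: "(int^'d) set" where
  "unit_steps = {e. norm1 e = 1}"

definition frog_space :: "nat pmf \<Rightarrow> ('d::finite) sample measure" where
  "frog_space nu =
     (PiM UNIV (\<lambda>_. measure_pmf nu)) \<Otimes>\<^sub>M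
     (PiM UNIV (\<lambda>_. measure_pmf (pmf_of_set (unit_steps :: (int^'d) set))))"

definition walk :: "'d sample \<Rightarrow> int^'d \<Rightarrow> nat \<Rightarrow> nat \<Rightarrow> int^'d" where
  "walk s x l k = x + (\<Sum>j<k. snd s (x, l, j))"

definition tau :: "'d sample \<Rightarrow> int^'d \<Rightarrow> int^'d \<Rightarrow> enat" where
  "tau s x y = (if \<exists>k. \<exists>l\<in>{1..fst s x}. walk s x l k = y
               then enat (LEAST k. \<exists>l\<in>{1..fst s x}. walk s x l k = y) else \<infinity>)"

definition fpt :: "'d sample \<Rightarrow> int^'d \<Rightarrow> int^'d \<Rightarrow> enat" where
  "fpt s x y = (INF mp \<in> {(m, p). m \<ge> 1 \<and> p 0 = x \<and> p m = y}.
                  (\<Sum>i<fst mp. tau s (snd mp i) (snd mp (Suc i))))"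

definition real_vec :: "int^'d \<Rightarrow> real^'d" where
  "real_vec x = (\<chi> i. real_of_int (x $ i))"

definition is_norm :: "(real^'d \<Rightarrow> real) \<Rightarrow> bool" where
  "is_norm f \<longleftrightarrow> (\<forall>x. f x \<ge> 0 \<and> (f x = 0 \<longleftrightarrow> x = 0))
                 \<and> (\<forall>c x. f (c *\<^sub>R x) = \<bar>c\<bar> * f x)
                 \<and> (\<forall>x y. f (x + y) \<le> f x + f y)"

definition norm1_infty :: "(int^'d) filter" where
  "norm1_infty = filtercomap (\<lambda>x. real_of_int (norm1 x)) at_top"

definition cond_prob :: "'a measure \<Rightarrow> 'a set \<Rightarrow> 'a set \<Rightarrow> real" where
  "cond_prob M A B = measure M (A \<inter> B) / measure M B"

definition ereal_ln :: "real \<Rightarrow> ereal" where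
  "ereal_ln p = (if p > 0 then ereal (ln p) else -\<infinity>)"

end

(*
  Hitting probabilities of simple random walk are bounded below by c / r^(d-1) without any local
  limit theorem: reflection shows that they decrease in each coordinate (up to parity), Tanaka's
  formula bounds the occupation time of hyperplanes, hence the Green function, by the square root
  of the time, and a pigeonhole argument over a shell of radius of order r does the rest.

  Consequently, if every site of a cube of radius r is reached, then the frogs in its outer half
  reach the whole cube of radius 2r in time O(r^2), except with probability exponentially small in
  r. This event involves only the frogs of one annulus, so the events at dyadic scales around a
  site are independent of an initial local event, and all of them occur together with positive
  probability. A frog that is awake meets many well separated sites where this may happen, each an
  independent attempt. This yields P(T(x,y) > C l^5) <= A exp(-c l) for occupied x and |x-y| <= l.

  For the theorem, cut the segment from 0 to x into pieces of a large fixed length and replace the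
  end points by nearby occupied sites. The mean of each passage time is close to mu of the piece by
  the shape theorem and uniform integrability, which follows from the tail bound. Truncated at
  level M = C l^5 the passage times depend on bounded regions, so Hoeffding's inequality applies to
  residue classes of pieces. With l of order |x|^(1/22) all errors are at most exp(-c l).
*)

theory Submission
  imports Defs "HOL-Probability.Hoeffding" "HOL-Real_Asymp.Real_Asymp"
begin

section \<open>Hitting probabilities of simple random walk\<close>

text \<open>Exponent 5: for about l independent attempts at spacing l, a frog has to leave a cube of
  radius of order l^2. A period of order l^4 confines it there with probability at most 1/2, and l
  such periods make failure exponentially unlikely. Exponent 22: truncated hops are bounded by M of
  order l^5 and depend on regions of radius of order M, so the pieces split into order M classes of
  independent hops. A total deviation of order n = |x| allots n / M to each class, and the Hoeffding
  exponent is at least of order (n / M)^2 / (n M^2) = n / l^20. Taking n >= l^22 makes it exceed l.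
  Two obstacles shape the proof. A passage time from an empty site is infinite, so passage times
  between fixed points need not be integrable; hence the random occupied end points. And the shape
  theorem yields only convergence in probability, while the truncation level grows with x and the
  piece length stays fixed; hence means are controlled uniformly in the truncation level.\<close>

lemma unit_steps_eq:
  "(unit_steps :: (int^'d::finite) set) = range (\<lambda>i. axis i 1) \<union> range (\<lambda>i. axis i (-1))"
proof (intro equalityI subsetI)
  fix e :: "int^'d" assume "e \<in> unit_steps"
  then have s: "(\<Sum>i\<in>UNIV. \<bar>e $ i\<bar>) = 1" by (simp add: unit_steps_def norm1_def)
  then obtain i where i: "e $ i \<noteq> 0" by (metis abs_zero sum.neutral zero_neq_one)
  have "(\<Sum>j\<in>UNIV. \<bar>e $ j\<bar>) = \<bar>e $ i\<bar> + (\<Sum>j\<in>UNIV-{i}. \<bar>e $ j\<bar>)"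
    by (simp add: sum.remove)
  moreover have "(\<Sum>j\<in>UNIV-{i}. \<bar>e $ j\<bar>) \<ge> 0" by (simp add: sum_nonneg)
  ultimately have "\<bar>e $ i\<bar> = 1" and z: "(\<Sum>j\<in>UNIV-{i}. \<bar>e $ j\<bar>) = 0" using s i by linarith+
  have "e $ j = 0" if "j \<noteq> i" for j using z that by (subst (asm) sum_nonneg_eq_0_iff) auto
  then have "e = axis i (e $ i)" by (auto simp: vec_eq_iff axis_def)
  with \<open>\<bar>e $ i\<bar> = 1\<close> show "e \<in> range (\<lambda>i. axis i 1) \<union> range (\<lambda>i. axis i (-1))"
    by (metis UnCI abs_eq_iff' rangeI)
next
  fix e :: "int^'d" assume "e \<in> range (\<lambda>i. axis i 1) \<union> range (\<lambda>i. axis i (-1))"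
  then show "e \<in> unit_steps" by (auto simp: unit_steps_def norm1_def axis_def if_distrib cong: if_cong)
qed

lemma axis_int_inject [simp]: "axis i (a::int) = axis j a \<longleftrightarrow> i = j \<or> a = 0"
  by (auto simp: axis_eq_axis)

lemma sum_unit_steps:
  "(\<Sum>e\<in>unit_steps. g e) = (\<Sum>i\<in>UNIV. g (axis i 1) + g (axis i (-1) :: int^'d::finite))"
proof -
  have "range (\<lambda>i::'d. axis i (1::int)) \<inter> range (\<lambda>i. axis i (-1)) = {}"
    by (auto simp: axis_eq_axis)
  moreover have "inj (\<lambda>i::'d. axis i (1::int))" "inj (\<lambda>i::'d. axis i (-1::int))"
    by (auto simp: inj_on_def)
  ultimately show ?thesis
    unfolding unit_steps_eq by (subst sum.union_disjoint) (auto simp: sum.reindex sum.distrib)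
qed

lemma finite_unit_steps [simp]: "finite (unit_steps :: (int^'d::finite) set)"
  by (simp add: unit_steps_eq)

lemma card_unit_steps: "card (unit_steps :: (int^'d::finite) set) = 2 * CARD('d)"
  using sum_unit_steps[of "\<lambda>_::int^'d. 1::nat"] by simp

lemma unit_steps_nonempty [simp]: "(unit_steps :: (int^'d::finite) set) \<noteq> {}"
  by (simp add: unit_steps_eq)

lemma minus_unit_steps: "- e \<in> unit_steps \<longleftrightarrow> e \<in> unit_steps"
  by (simp add: unit_steps_def norm1_def)

definition avg :: "(int^'d::finite \<Rightarrow> real) \<Rightarrow> int^'d \<Rightarrow> real" where
  "avg f z = (\<Sum>e\<in>unit_steps. f (z + e)) / card (unit_steps :: (int^'d) set)"

lemma avg_mono: "(\<And>x. f x \<le> g x) \<Longrightarrow> avg f z \<le> avg g z"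
  by (auto simp: avg_def intro!: divide_right_mono sum_mono)

lemma avg_const [simp]: "avg (\<lambda>_. c) z = c"
  by (simp add: avg_def card_gt_0_iff)

lemma avg_add: "avg (\<lambda>x. f x + g x) z = avg f z + avg g z"
  by (simp add: avg_def sum.distrib add_divide_distrib)

lemma avg_cmult: "avg (\<lambda>x. c * f x) z = c * avg f z"
  by (simp add: avg_def sum_distrib_left)

text \<open>Here \<sigma> acts as an affine symmetry of the lattice and \<rho> as its linear part,
  which merely permutes the summands. It serves reflections at hyperplanes and, through
  \<open>U_symm\<close>, at points.\<close>

lemma avg_symm:
  assumes "bij_betw \<rho> unit_steps unit_steps" "\<And>e. e \<in> unit_steps \<Longrightarrow> \<sigma> (z + e) = \<sigma> z + \<rho> e"
  shows "avg (\<lambda>x. f (\<sigma> x)) z = avg f (\<sigma> z)"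
proof -
  have "(\<Sum>e\<in>unit_steps. f (\<sigma> (z + e))) = (\<Sum>e\<in>unit_steps. f (\<sigma> z + \<rho> e))"
    using assms(2) by simp
  also have "\<dots> = (\<Sum>e\<in>unit_steps. f (\<sigma> z + e))"
    using sum.reindex_bij_betw[OF assms(1), of "\<lambda>e. f (\<sigma> z + e)"] by simp
  finally have "avg (\<lambda>x. f (\<sigma> x)) z = (\<Sum>e\<in>unit_steps. f (\<sigma> z + e)) / card (unit_steps :: (int^'a) set)"
    by (simp add: avg_def)
  then show ?thesis using bij_betw_same_card[OF assms(1)] by (simp add: avg_def)
qed

text \<open>\<open>hp T z\<close> is the probability that the walk from \<open>z\<close> hits \<open>0\<close> within \<open>T\<close> steps, see \<open>prob_hit_0\<close> below.\<close>

primrec hp :: "nat \<Rightarrow> (int^'d::finite) \<Rightarrow> real" where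
  "hp 0 z = of_bool (z = 0)"
| "hp (Suc T) z = (if z = 0 then 1 else avg (hp T) z)"

lemma hp_nonneg: "0 \<le> hp T z"
proof (induction T arbitrary: z)
  case (Suc T) then show ?case using avg_mono[of "\<lambda>_. 0" "hp T" z] by simp
qed simp

lemma hp_le_1: "hp T z \<le> 1"
proof (induction T arbitrary: z)
  case (Suc T) then show ?case using avg_mono[of "hp T" "\<lambda>_. 1" z] by simp
qed simp

lemma hp_0 [simp]: "hp T 0 = 1"
  by (cases T) auto

lemma hp_Suc_mono: "hp T z \<le> hp (Suc T) z"
proof (induction T arbitrary: z)
  case 0 then show ?case using avg_mono[of "\<lambda>_. 0" "hp 0" z] by simp
next
  case (Suc T) then show ?case using avg_mono[of "hp T" "hp (Suc T)" z] by (simp del: hp.simps(1))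
qed

lemma hp_mono: "T \<le> T' \<Longrightarrow> hp T z \<le> hp T' z"
  by (rule lift_Suc_mono_le[of "\<lambda>T. hp T z"]) (rule hp_Suc_mono)

text \<open>Prescribing the first step costs a factor 2d and one unit of time. This repairs parity:
  reflections compare only points whose coordinates differ by an even number.\<close>

lemma hp_step:
  assumes "e \<in> unit_steps"
  shows "hp T (z + e) / card (unit_steps :: (int^'d::finite) set) \<le> hp (Suc T) (z :: int^'d)"
proof (cases "z = 0")
  case True
  have "hp T (z + e) / card (unit_steps :: (int^'d) set) \<le> 1 / 1"
    using hp_le_1[of T "z + e"] card_gt_0_iff[of "unit_steps :: (int^'d) set"]
    by (intro frac_le) (auto simp: Suc_leI simp del: card_gt_0_iff)
  then show ?thesis using True by simp
next
  case False
  have "hp T (z + e) \<le> (\<Sum>e\<in>unit_steps. hp T (z + e))"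
    using assms by (intro member_le_sum) (auto simp: hp_nonneg)
  then show ?thesis using False by (simp add: avg_def divide_right_mono)
qed

section \<open>Reflections and monotonicity of the hitting probability\<close>

definition refl_at :: "'d \<Rightarrow> int \<Rightarrow> int^'d \<Rightarrow> int^'d" where
  "refl_at i a z = (\<chi> j. if j = i then 2 * a - z $ i else z $ j)"

lemma refl_at_refl_at [simp]: "refl_at i a (refl_at i a z) = z"
  by (simp add: refl_at_def vec_eq_iff)

lemma refl_at_add: "refl_at i a (z + e) = refl_at i a z + refl_at i 0 e"
  by (simp add: refl_at_def vec_eq_iff)

lemma bij_refl_at_unit_steps: "bij_betw (refl_at i 0) unit_steps (unit_steps :: (int^'d::finite) set)"
proof (rule bij_betw_byWitness[where f'="refl_at i 0"])
  have "norm1 (refl_at i 0 e) = norm1 e" for e :: "int^'d"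
    by (auto simp: norm1_def refl_at_def intro!: sum.cong)
  then show "refl_at i 0 ` unit_steps \<subseteq> (unit_steps :: (int^'d) set)"
    "refl_at i 0 ` unit_steps \<subseteq> (unit_steps :: (int^'d) set)"
    by (auto simp: unit_steps_def)
qed auto

text \<open>A walk started at the mirror image of \<open>z\<close> must cross the mirror before it reaches \<open>0\<close>.\<close>

lemma hp_refl_le:
  assumes "0 \<le> a" "z $ i \<le> a"
  shows "hp T (refl_at i a z) \<le> hp T (z :: int^'d::finite)"
  using assms(2)
proof (induction T arbitrary: z)
  case (0 z)
  have "z = 0" if "refl_at i a z = 0"
  proof -
    have "2 * a - z $ i = 0" "\<And>j. j \<noteq> i \<Longrightarrow> z $ j = 0"
      using that by (auto simp: refl_at_def vec_eq_iff split: if_splits)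
    moreover from this have "z $ i = 0" using assms(1) 0 by linarith
    ultimately show ?thesis by (metis vec_eq_iff zero_index)
  qed
  then show ?case by auto
next
  case (Suc T z)
  have *: "z = 0" if "refl_at i a z = 0"
  proof -
    have "2 * a - z $ i = 0" "\<And>j. j \<noteq> i \<Longrightarrow> z $ j = 0"
      using that by (auto simp: refl_at_def vec_eq_iff split: if_splits)
    moreover from this have "z $ i = 0" using assms(1) Suc.prems by linarith
    ultimately show ?thesis by (metis vec_eq_iff zero_index)
  qed
  show ?case
  \<comment> \<open>On the mirror both points coincide. Strictly before it, one step cannot pass the
    mirror, so the induction hypothesis applies to every neighbour.\<close>
  proof (cases "z $ i = a")
    case True
    then have "refl_at i a z = z" by (auto simp: refl_at_def vec_eq_iff)
    then show ?thesis by simp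
  next
    case False
    show ?thesis
    proof (cases "z = 0")
      case True then show ?thesis using hp_le_1[of "Suc T" "refl_at i a z"] by (simp only: hp_0)
    next
      case zn: False
      then have n: "refl_at i a z \<noteq> 0" using * by blast
      have "avg (hp T) (refl_at i a z) = avg (\<lambda>x. hp T (refl_at i a x)) z"
        by (subst avg_symm[where \<rho>="refl_at i 0"]) (auto simp: bij_refl_at_unit_steps refl_at_add)
      also have "\<dots> \<le> avg (hp T) z"
      proof -
        have "hp T (refl_at i a (z + e)) \<le> hp T (z + e)" if "e \<in> unit_steps" for e
        proof (rule Suc.IH)
          have "e $ i \<le> 1" using that by (auto simp: unit_steps_eq axis_def)
          then show "(z + e) $ i \<le> a" using False Suc.prems by simp
        qed
        then show ?thesis unfolding avg_def by (intro divide_right_mono sum_mono) auto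
      qed
      finally show ?thesis using zn n by simp
    qed
  qed
qed

lemma refl_at_eq_0_iff [simp]: "refl_at i 0 z = 0 \<longleftrightarrow> z = 0"
  by (auto simp: refl_at_def vec_eq_iff split: if_splits)

lemma hp_flip: "hp T (refl_at i 0 z) = hp T z"
proof (induction T arbitrary: z)
  case (Suc T)
  have "avg (hp T) (refl_at i 0 z) = avg (\<lambda>x. hp T (refl_at i 0 x)) z"
    by (subst avg_symm[where \<rho>="refl_at i 0"]) (auto simp: bij_refl_at_unit_steps refl_at_add)
  then show ?case by (simp add: Suc)
qed simp

text \<open>If \<open>w $ i\<close> is nonnegative, \<open>w\<close> is the mirror image of
  \<open>z\<close> at the level halfway between \<open>z $ i\<close> and \<open>w $ i\<close>, an
  integer by parity and nonnegative by the comparison of absolute values. A negative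
  \<open>w $ i\<close> is flipped first.\<close>

lemma hp_coordinate_mono:
  fixes z w :: "int^'d::finite"
  assumes eq: "\<And>j. j \<noteq> i \<Longrightarrow> z $ j = w $ j" and le: "\<bar>z $ i\<bar> \<le> \<bar>w $ i\<bar>" and par: "even (z $ i - w $ i)"
  shows "hp T w \<le> hp T z"
proof -
  have pos: "hp T w \<le> hp T z"
    if "\<And>j. j \<noteq> i \<Longrightarrow> z $ j = w $ j" "\<bar>z $ i\<bar> \<le> w $ i" "even (z $ i - w $ i)" for z w :: "int^'d"
  proof -
    define a where "a = (z $ i + w $ i) div 2"
    have a: "2 * a = z $ i + w $ i" using that(3) unfolding a_def by simp
    have "refl_at i a z = w" using that(1) a by (auto simp: refl_at_def vec_eq_iff)
    moreover have "0 \<le> a" "z $ i \<le> a" using a that(2) by linarith+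
    ultimately show ?thesis using hp_refl_le[of a z i T] by simp
  qed
  show ?thesis
  proof (cases "w $ i \<ge> 0")
    case True then show ?thesis using pos[of z w] assms by auto
  next
    case False
    have "hp T (refl_at i 0 w) \<le> hp T z"
      using False assms by (intro pos) (auto simp: refl_at_def)
    then show ?thesis by (simp add: hp_flip)
  qed
qed

text \<open>Coordinates are replaced one at a time. Each replacement costs at most a factor 2d and
  one extra step, whatever its parity.\<close>

lemma hp_coordinates_mono:
  fixes z w :: "int^'d::finite"
  assumes "finite F" "\<And>j. j \<notin> F \<Longrightarrow> z $ j = w $ j" "\<And>j. j \<in> F \<Longrightarrow> \<bar>z $ j\<bar> < \<bar>w $ j\<bar>"
  shows "hp T w \<le> (2 * real CARD('d)) ^ card F * hp (T + card F) z"
  using assms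
proof (induction F arbitrary: z rule: finite_induct)
  case empty
  then have "z = w" by (simp add: vec_eq_iff)
  then show ?case by simp
next
  case (insert i F)
  let ?D = "2 * real CARD('d)"
  define z1 where "z1 = (\<chi> j. if j = i then w $ i else z $ j)"
  have IH: "hp T w \<le> ?D ^ card F * hp (T + card F) z1"
    using insert.hyps insert.prems by (intro insert.IH) (auto simp: z1_def)
  have st: "hp (T + card F) z1 \<le> ?D * hp (Suc (T + card F)) z"
  proof (cases "even (z $ i - w $ i)")
    case True
    have "hp (T + card F) z1 \<le> hp (T + card F) z"
      using True insert.prems(2)[of i] by (intro hp_coordinate_mono[of i]) (auto simp: z1_def)
    also have "\<dots> \<le> 1 * hp (Suc (T + card F)) z" using hp_Suc_mono[of "T + card F" z] by (simp only: mult_1)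
    also have "\<dots> \<le> ?D * hp (Suc (T + card F)) z"
      by (intro mult_right_mono hp_nonneg) (use Suc_leI[OF zero_less_card_finite[where 'a='d]] in linarith)
    finally show ?thesis .
  next
    case False
    \<comment> \<open>One step corrects the parity. Since \<open>z $ i\<close> is strictly smaller
      in absolute value than \<open>w $ i\<close>, the comparison survives the addition of
      1.\<close>
    define e where "e = (axis i 1 :: int^'d)"
    have e: "e \<in> unit_steps" by (auto simp: unit_steps_eq e_def)
    have "hp (T + card F) z1 \<le> hp (T + card F) (z + e)"
      using False insert.prems(2)[of i]
      by (intro hp_coordinate_mono[of i]) (auto simp: z1_def e_def axis_def)
    also have "\<dots> \<le> ?D * hp (Suc (T + card F)) z"
      using hp_step[OF e, of "T + card F" z] by (simp add: card_unit_steps field_simps)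
    finally show ?thesis .
  qed
  have "?D ^ card F * hp (T + card F) z1 \<le> ?D ^ card F * (?D * hp (Suc (T + card F)) z)"
    by (intro mult_left_mono st) auto
  with IH have "hp T w \<le> ?D ^ card F * (?D * hp (Suc (T + card F)) z)" by (rule order_trans)
  then show ?case using insert.hyps by (simp add: mult_ac del: hp.simps)
qed

section \<open>Moments and occupation times\<close>

text \<open>The transition semigroup: \<open>U t g z\<close> is the mean of \<open>g\<close> at time
  \<open>t\<close> for the walk from \<open>z\<close>. Working with this operator keeps the
  estimates free of measure theory.\<close>

definition U :: "nat \<Rightarrow> (int^'d::finite \<Rightarrow> real) \<Rightarrow> int^'d \<Rightarrow> real" where
  "U t = avg ^^ t"

lemma U_0 [simp]: "U 0 g = g"
  and U_Suc: "U (Suc t) g = U t (avg g)"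
  and U_Suc': "U (Suc t) g = avg (U t g)"
  by (auto simp: U_def funpow_swap1)

lemma U_const [simp]: "U t (\<lambda>_. c) = (\<lambda>_. c)"
proof (induction t)
  case (Suc t)
  show ?case unfolding U_Suc' Suc by (simp add: fun_eq_iff)
qed simp

lemma U_add: "U t (\<lambda>x. f x + g x) z = U t f z + U t g z"
proof (induction t arbitrary: z)
  case (Suc t)
  then have "U t (\<lambda>x. f x + g x) = (\<lambda>z. U t f z + U t g z)" by auto
  then show ?case by (simp add: U_Suc' avg_add)
qed simp

lemma U_cmult: "U t (\<lambda>x. c * f x) z = c * U t f z"
proof (induction t arbitrary: z)
  case (Suc t)
  then have "U t (\<lambda>x. c * f x) = (\<lambda>z. c * U t f z)" by auto
  then show ?case by (simp add: U_Suc' avg_cmult)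
qed simp

lemma U_mono: "(\<And>x. f x \<le> g x) \<Longrightarrow> U t f z \<le> U t g z"
  by (induction t arbitrary: z) (auto simp: U_Suc' intro: avg_mono)

lemma U_sum: "finite A \<Longrightarrow> U t (\<lambda>x. \<Sum>a\<in>A. f a x) z = (\<Sum>a\<in>A. U t (f a) z)"
  by (induction A rule: finite_induct) (auto simp: U_add)

lemma U_symm:
  assumes "bij_betw \<rho> unit_steps unit_steps" "\<And>z e. e \<in> unit_steps \<Longrightarrow> \<sigma> (z + e) = \<sigma> z + \<rho> e"
  shows "U t (\<lambda>x. f (\<sigma> x)) z = U t f (\<sigma> z)"
proof (induction t arbitrary: z)
  case (Suc t)
  then have "U t (\<lambda>x. f (\<sigma> x)) = (\<lambda>z. U t f (\<sigma> z))" by auto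
  then show ?case using assms by (simp add: U_Suc' avg_symm[where \<rho>=\<rho>])
qed simp

lemma avg_sq:
  "avg (\<lambda>x. (real_of_int (x $ i - j))\<^sup>2) z = (real_of_int (z $ i - j))\<^sup>2 + 1 / CARD('d::finite)"
  for z :: "int^'d"
proof -
  let ?g = "\<lambda>e::int^'d. (real_of_int ((z + e) $ i - j))\<^sup>2"
  have "(\<Sum>e\<in>unit_steps. ?g e) = (\<Sum>k\<in>UNIV. 2 * (real_of_int (z $ i - j))\<^sup>2 + (if k = i then 2 else 0))"
    unfolding sum_unit_steps
    by (intro sum.cong refl) (auto simp: axis_def power2_eq_square algebra_simps)
  also have "\<dots> = 2 * CARD('d) * (real_of_int (z $ i - j))\<^sup>2 + 2"
    by (simp add: sum.distrib)
  finally show ?thesis by (simp add: avg_def card_unit_steps field_simps)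
qed

text \<open>The function is harmonic off the hyperplane. On it, the distance grows from 0 to 1
  exactly when coordinate \<open>i\<close> moves, which has probability 1/d.\<close>

lemma avg_abs:
  "avg (\<lambda>x. \<bar>real_of_int (x $ i - j)\<bar>) z =
     \<bar>real_of_int (z $ i - j)\<bar> + of_bool (z $ i = j) / CARD('d::finite)"
  for z :: "int^'d"
proof -
  let ?g = "\<lambda>e::int^'d. \<bar>real_of_int ((z + e) $ i - j)\<bar>"
  have "\<bar>real_of_int (a + 1)\<bar> + \<bar>real_of_int (a - 1)\<bar> = 2 * \<bar>real_of_int a\<bar> + 2 * of_bool (a = 0)" for a :: int
    by (cases "a = 0"; cases "a > 0") auto
  from this[of "z $ i - j"]
  have "(\<Sum>e\<in>unit_steps. ?g e) = (\<Sum>k\<in>UNIV. 2 * \<bar>real_of_int (z $ i - j)\<bar> + (if k = i then 2 * of_bool (z $ i = j) else 0))"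
    unfolding sum_unit_steps
    by (intro sum.cong refl) (auto simp: axis_def algebra_simps)
  also have "\<dots> = 2 * CARD('d) * \<bar>real_of_int (z $ i - j)\<bar> + 2 * of_bool (z $ i = j)"
    by (simp add: sum.distrib)
  finally show ?thesis by (simp add: avg_def card_unit_steps field_simps)
qed

lemma U_sq:
  "U t (\<lambda>x. (real_of_int (x $ i - j))\<^sup>2) z = (real_of_int (z $ i - j))\<^sup>2 + t / CARD('d::finite)"
  for z :: "int^'d"
proof (induction t)
  case (Suc t)
  have "U (Suc t) (\<lambda>x::int^'d. (real_of_int (x $ i - j))\<^sup>2) z
      = U t (\<lambda>x. (real_of_int (x $ i - j))\<^sup>2 + 1 / CARD('d)) z"
    unfolding U_Suc avg_sq ..
  then show ?case unfolding U_add Suc by (simp add: add_divide_distrib)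
qed simp

text \<open>Tanaka's formula: the occupation time of the hyperplane \<open>x\<^sub>i = j\<close> is the growth of the mean of \<open>\<bar>x\<^sub>i - j\<bar>\<close>.\<close>

lemma U_abs:
  "U t (\<lambda>x. \<bar>real_of_int (x $ i - j)\<bar>) z =
     \<bar>real_of_int (z $ i - j)\<bar> + (\<Sum>s<t. U s (\<lambda>x. of_bool (x $ i = j)) z) / CARD('d::finite)"
  for z :: "int^'d"
proof (induction t)
  case (Suc t)
  have "U (Suc t) (\<lambda>x::int^'d. \<bar>real_of_int (x $ i - j)\<bar>) z
      = U t (\<lambda>x. \<bar>real_of_int (x $ i - j)\<bar> + (1 / CARD('d)) * of_bool (x $ i = j)) z"
    unfolding U_Suc avg_abs by simp
  then show ?case unfolding U_add U_cmult Suc by (simp add: add_divide_distrib)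
qed simp

text \<open>By \<open>U_abs\<close> it suffices to bound the mean growth of the distance to the
  hyperplane by sqrt t. The second moment \<open>U_sq\<close> does this, with 2|y| <= y^2 / a + a
  for a = sqrt t in the role of the Cauchy-Schwarz inequality.\<close>

lemma occupation_hyperplane:
  "(\<Sum>s<t. U s (\<lambda>x. of_bool (x $ i = j)) z) \<le> CARD('d) * sqrt t"
  for z :: "int^'d::finite"
proof (cases "t = 0")
  case False
  define a where "a = sqrt t"
  have a: "a > 0" "a * a = t" using False by (auto simp: a_def)
  have am: "2 * \<bar>y\<bar> \<le> y\<^sup>2 / a + a" for y :: real
  proof -
    have "0 \<le> (\<bar>y\<bar> - a)\<^sup>2 / a" using a by simp
    also have "\<dots> = y\<^sup>2 / a + a - 2 * \<bar>y\<bar>" using a by (simp add: power2_eq_square field_simps)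
    finally show ?thesis by simp
  qed
  have "U t (\<lambda>x. \<bar>real_of_int (x $ i - j)\<bar>) z
      \<le> U t (\<lambda>x. \<bar>real_of_int (z $ i - j)\<bar> + (1 / (2 * a) * (real_of_int (x $ i - z $ i))\<^sup>2 + a / 2)) z"
  proof (rule U_mono)
    fix x :: "int^'d"
    have "\<bar>real_of_int (x $ i - j)\<bar> \<le> \<bar>real_of_int (z $ i - j)\<bar> + \<bar>real_of_int (x $ i - z $ i)\<bar>" by simp
    then show "\<bar>real_of_int (x $ i - j)\<bar> \<le> \<bar>real_of_int (z $ i - j)\<bar> + (1 / (2 * a) * (real_of_int (x $ i - z $ i))\<^sup>2 + a / 2)"
      using am[of "real_of_int (x $ i - z $ i)"] by (simp add: field_simps)
  qed
  also have "\<dots> = \<bar>real_of_int (z $ i - j)\<bar> + (1 / (2 * a) * (t / CARD('d)) + a / 2)"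
    unfolding U_add U_cmult U_sq by simp
  also have "1 / (2 * a) * (t / CARD('d)) \<le> 1 / (2 * a) * t"
    using a Suc_leI[OF zero_less_card_finite[where 'a='d]]
    by (intro mult_left_mono) (auto simp: divide_le_eq mult_le_cancel_left1)
  also have "1 / (2 * a) * t = a / 2" using a by (simp add: field_simps)
  finally have "(\<Sum>s<t. U s (\<lambda>x. of_bool (x $ i = j)) z) / CARD('d) \<le> a"
    unfolding U_abs by simp
  then show ?thesis by (simp add: a_def field_simps)
qed simp

section \<open>Expected visits to 0 (the truncated Green function) and hitting probabilities\<close>

definition visits :: "nat \<Rightarrow> int^'d::finite \<Rightarrow> real" where
  "visits t z = (\<Sum>s<t. U s (\<lambda>x. of_bool (x = 0)) z)"

lemma visits_Suc: "visits (Suc t) z = of_bool (z = 0) + avg (visits t) z"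
proof -
  have "visits (Suc t) z = of_bool (z = 0) + (\<Sum>s<t. U (Suc s) (\<lambda>x. of_bool (x = 0)) z)"
    unfolding visits_def by (subst sum.lessThan_Suc_shift) simp
  also have "(\<Sum>s<t. U (Suc s) (\<lambda>x. of_bool (x = 0)) z) = avg (visits t) z"
    unfolding U_Suc' avg_def visits_def
    by (subst sum_divide_distrib[symmetric], subst sum.swap) simp
  finally show ?thesis .
qed

text \<open>Visits are counted from the first hit of 0 on, and then their mean is at most that for
  the walk from 0. The induction on the first step replaces the strong Markov property.\<close>

lemma visits_le_hp:
  fixes z :: "int^'d::finite"
  shows "visits (Suc T) z \<le> hp T z * visits (Suc T) (0 :: int^'d)"
proof (induction T arbitrary: z)
  case 0 then show ?case by (simp add: visits_def)
next
  case (Suc T)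
  show ?case
  proof (cases "z = 0")
    case False
    have "visits (Suc (Suc T)) z = avg (visits (Suc T)) z" using False by (simp add: visits_Suc[of "Suc T"])
    also have "\<dots> \<le> avg (\<lambda>x. visits (Suc T) (0::int^'d) * hp T x) z" by (intro avg_mono) (subst mult.commute, rule Suc.IH)
    also have "\<dots> = hp (Suc T) z * visits (Suc T) (0::int^'d)" using False by (simp add: avg_cmult)
    also have "\<dots> \<le> hp (Suc T) z * visits (Suc (Suc T)) (0::int^'d)"
    proof (intro mult_left_mono hp_nonneg)
      show "visits (Suc T) (0::int^'d) \<le> visits (Suc (Suc T)) (0::int^'d)"
        unfolding visits_def sum.lessThan_Suc[of _ "Suc T"]
        using U_mono[of "\<lambda>_. 0" "\<lambda>x. of_bool (x = 0)" "Suc T" "0::int^'d"] by (simp del: sum.lessThan_Suc)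
    qed
    finally show ?thesis .
  qed simp
qed

text \<open>A visit to 0 is a visit to a coordinate hyperplane; \<open>undefined\<close> stands for
  an arbitrary coordinate.\<close>

lemma visits_0_le: "visits t (0::int^'d::finite) \<le> CARD('d) * sqrt t"
proof -
  have "visits t (0::int^'d) \<le> (\<Sum>s<t. U s (\<lambda>x. of_bool (x $ undefined = 0)) (0::int^'d))"
    unfolding visits_def
  proof (rule sum_mono)
    fix s
    show "U s (\<lambda>x. of_bool (x = 0)) (0::int^'d) \<le> U s (\<lambda>x. of_bool (x $ undefined = 0)) (0::int^'d)"
    proof (rule U_mono)
      fix x :: "int^'d"
      show "of_bool (x = 0) \<le> (of_bool (x $ undefined = 0) :: real)" by (cases "x = 0") auto
    qed
  qed
  also have "\<dots> \<le> CARD('d) * sqrt t" by (rule occupation_hyperplane)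
  finally show ?thesis .
qed

text \<open>Reversibility: the point reflection x -> w - x exchanges the start \<open>w\<close> and
  the target 0.\<close>

lemma sum_U_point:
  assumes "finite V"
  shows "(\<Sum>w\<in>V. U s (\<lambda>x. of_bool (x = 0)) w) = U s (\<lambda>x. of_bool (x \<in> V)) (0 :: int^'d::finite)"
proof -
  have b: "bij_betw uminus unit_steps (unit_steps :: (int^'d) set)"
    by (rule bij_betw_byWitness[where f'=uminus]) (auto simp: minus_unit_steps)
  have "U s (\<lambda>x. of_bool (x = 0)) w = U s (\<lambda>x. of_bool (x = w)) 0" for w :: "int^'d"
    using U_symm[OF b, of "\<lambda>x. w - x" s "\<lambda>x. of_bool (x = 0)" 0]
    by (simp add: algebra_simps eq_commute[of w])
  then have "(\<Sum>w\<in>V. U s (\<lambda>x. of_bool (x = 0)) w) = U s (\<lambda>x. \<Sum>w\<in>V. of_bool (x = w)) 0"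
    using assms by (simp only: U_sum)
  also have "(\<lambda>x. \<Sum>w\<in>V. of_bool (x = w)) = (\<lambda>x. of_bool (x \<in> V) :: real)"
    using assms by (auto simp: fun_eq_iff of_bool_def)
  finally show ?thesis .
qed

definition cube :: "int^'d \<Rightarrow> nat \<Rightarrow> (int^'d::finite) set" where
  "cube z r = {w. \<forall>i. \<bar>w $ i - z $ i\<bar> \<le> int r}"

lemma cube_eq_image: "cube z r = (\<lambda>f. \<chi> i. z $ i + f i) ` (UNIV \<rightarrow> {- int r..int r})"
proof (intro equalityI subsetI)
  fix w assume w: "w \<in> cube z r"
  have "(\<lambda>i. w $ i - z $ i) \<in> UNIV \<rightarrow> {- int r..int r}"
  proof
    fix i
    have "\<bar>w $ i - z $ i\<bar> \<le> int r" using w by (simp add: cube_def)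
    then show "w $ i - z $ i \<in> {- int r..int r}" by (auto simp: abs_le_iff)
  qed
  then show "w \<in> (\<lambda>f. \<chi> i. z $ i + f i) ` (UNIV \<rightarrow> {- int r..int r})"
    by (intro image_eqI[where x="\<lambda>i. w $ i - z $ i"]) (auto simp: vec_eq_iff)
next
  fix w assume "w \<in> (\<lambda>f. \<chi> i. z $ i + f i) ` (UNIV \<rightarrow> {- int r..int r})"
  then show "w \<in> cube z r" by (auto simp: cube_def Pi_iff abs_le_iff minus_le_iff)
qed

lemma finite_cube [simp]: "finite (cube (z::int^'d::finite) r)"
  and card_cube: "card (cube (z::int^'d::finite) r) = (2 * r + 1) ^ CARD('d)"
proof -
  let ?F = "UNIV \<rightarrow>\<^sub>E {- int r..int r} :: ('d \<Rightarrow> int) set"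
  have e: "?F = UNIV \<rightarrow> {- int r..int r}" by (simp add: PiE_UNIV_domain)
  have f: "finite ?F" by (rule finite_PiE) auto
  have c: "card ?F = (2 * r + 1) ^ CARD('d)" by (subst card_PiE) (auto simp: nat_add_distrib nat_mult_distrib)
  have i: "inj_on (\<lambda>f. \<chi> i. z $ i + f i) ?F" by (auto simp: inj_on_def vec_eq_iff fun_eq_iff)
  show "finite (cube z r)" unfolding cube_eq_image using f e by auto
  show "card (cube z r) = (2 * r + 1) ^ CARD('d)"
    unfolding cube_eq_image using card_image[OF i] e c by simp
qed

text \<open>During q^2 steps the walk from 0 spends on average at least half of its time in the
  shell \<open>V\<close>, which has order q^d points; a point \<open>w\<close> receives at most
  \<open>hp T w\<close> times d q visits. So the hitting probabilities of the points of
  \<open>V\<close> sum to order q at least, while each of them is at most a constant times that of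
  any \<open>z\<close> in \<open>cube 0 r\<close>. Hence the latter is at least of order q /
  q^d.\<close>

lemma hp_lower_bound:
  "\<exists>c>0. \<exists>K\<ge>1. \<forall>r\<ge>1. \<forall>z::int^'d::finite. z \<in> cube 0 r \<longrightarrow> c / real r ^ (CARD('d) - 1) \<le> hp (K * r\<^sup>2) z"
proof -
  define d where "d = CARD('d)"
  have d1: "d \<ge> 1" by (simp add: d_def Suc_leI)
  define K where "K = (12 * d\<^sup>2)\<^sup>2 + d"
  define c where "c = inverse ((2 * real d) ^ d) / (2 * real d * 5 ^ d * (12 * real d ^ 2) ^ (d - 1))"
  have "c > 0" using d1 by (simp add: c_def)
  have "K \<ge> 1" using d1 by (simp add: K_def)
  have main: "c / real r ^ (d - 1) \<le> hp (K * r\<^sup>2) z" if r: "r \<ge> 1" and z: "z \<in> cube 0 r" for r and z :: "int^'d"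
  proof -
    \<comment> \<open>With the factor 4 d^2, the slabs |x_i| <= r take at most a quarter of the q^2
      steps: d (2r + 1) hyperplanes, each occupied for at most d q steps.\<close>
    define q where "q = 4 * d\<^sup>2 * (2 * r + 1)"
    have "0 < q" using d1 by (simp add: q_def)
    then have q1: "q \<ge> 1" by simp
    have qr: "q \<le> 12 * d\<^sup>2 * r" using r by (simp add: q_def algebra_simps)
    define T where "T = q\<^sup>2 - 1"
    have T: "Suc T = q\<^sup>2" using q1 by (simp add: T_def)
    \<comment> \<open>All coordinates exceed r, so \<open>hp_coordinates_mono\<close> compares each
      point of \<open>V\<close> with every \<open>z\<close> of the cube. The outer radius 2q is
      large enough for Chebyshev's inequality to take at most another quarter of the time.\<close>
    define V where "V = {w::int^'d. \<forall>i. int r < \<bar>w $ i\<bar> \<and> \<bar>w $ i\<bar> \<le> int (2 * q)}"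
    have Vb: "V \<subseteq> cube 0 (2 * q)" by (auto simp: V_def cube_def)
    have fV: "finite V" by (rule finite_subset[OF Vb]) simp
    have "card V \<le> (2 * (2 * q) + 1) ^ d"
      using card_mono[OF finite_cube Vb] by (simp add: card_cube d_def)
    also have "\<dots> \<le> (5 * q) ^ d" using q1 by (intro power_mono) auto
    finally have cV: "real (card V) \<le> (5 * real q) ^ d"
      by (metis of_nat_le_iff of_nat_mult of_nat_numeral of_nat_power)
    \<comment> \<open>A union bound in the form of a pointwise inequality, to which the positive
      linear operator \<open>U s\<close> applies. The last sum is Chebyshev's bound for |x_i| >
      2q.\<close>
    have Vind: "1 \<le> of_bool (x \<in> V) + ((\<Sum>i\<in>UNIV. \<Sum>j\<in>{-int r..int r}. of_bool (x $ i = j))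
        + (\<Sum>i\<in>UNIV. 1 / (2 * real q)\<^sup>2 * (real_of_int (x $ i - 0))\<^sup>2))" for x :: "int^'d"
    proof (cases "x \<in> V")
      case False
      then obtain i where "\<bar>x $ i\<bar> \<le> int r \<or> \<bar>x $ i\<bar> > int (2 * q)"
        unfolding V_def mem_Collect_eq by (metis not_le)
      then show ?thesis
      proof
        assume "\<bar>x $ i\<bar> \<le> int r"
        then have "(1::real) \<le> (\<Sum>j\<in>{-int r..int r}. of_bool (x $ i = j))"
          by (subst sum.remove[of _ "x $ i"]) (auto simp: sum_nonneg)
        also have "\<dots> \<le> (\<Sum>i\<in>UNIV. \<Sum>j\<in>{-int r..int r}. of_bool (x $ i = j))"
          by (rule member_le_sum) (auto simp: sum_nonneg)
        finally have "(1::real) \<le> (\<Sum>i\<in>UNIV. \<Sum>j\<in>{-int r..int r}. of_bool (x $ i = j))" .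
        moreover have "0 \<le> (\<Sum>i\<in>UNIV. 1 / (2 * real q)\<^sup>2 * (real_of_int (x $ i - 0))\<^sup>2)"
          by (intro sum_nonneg) auto
        moreover have "(0::real) \<le> of_bool (x \<in> V)" by simp
        ultimately show ?thesis by linarith
      next
        assume "\<bar>x $ i\<bar> > int (2 * q)"
        then have "real_of_int (int (2 * q)) \<le> \<bar>real_of_int (x $ i)\<bar>" by linarith
        then have "(2 * real q)\<^sup>2 \<le> \<bar>real_of_int (x $ i)\<bar>\<^sup>2" by (intro power_mono) auto
        then have "1 \<le> 1 / (2 * real q)\<^sup>2 * (real_of_int (x $ i - 0))\<^sup>2" using q1 by (simp add: field_simps)
        also have "\<dots> \<le> (\<Sum>i\<in>UNIV. 1 / (2 * real q)\<^sup>2 * (real_of_int (x $ i - 0))\<^sup>2)"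
          by (rule member_le_sum) auto
        finally have "1 \<le> (\<Sum>i\<in>UNIV. 1 / (2 * real q)\<^sup>2 * (real_of_int (x $ i - 0))\<^sup>2)" .
        moreover have "(0::real) \<le> (\<Sum>i\<in>UNIV. \<Sum>j\<in>{-int r..int r}. of_bool (x $ i = j))"
          by (intro sum_nonneg) auto
        moreover have "(0::real) \<le> of_bool (x \<in> V)" by simp
        ultimately show ?thesis by linarith
      qed
    qed (simp add: sum_nonneg)
    have step: "1 \<le> U s (\<lambda>x. of_bool (x \<in> V)) (0::int^'d)
        + ((\<Sum>i\<in>UNIV. \<Sum>j\<in>{-int r..int r}. U s (\<lambda>x. of_bool (x $ i = j)) (0::int^'d)) + s / (2 * real q)\<^sup>2)" for s
    proof -
      have "1 = U s (\<lambda>_. 1) (0::int^'d)" by simp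
      also have "\<dots> \<le> U s (\<lambda>x. of_bool (x \<in> V) + ((\<Sum>i\<in>UNIV. \<Sum>j\<in>{-int r..int r}. of_bool (x $ i = j))
        + (\<Sum>i\<in>UNIV. 1 / (2 * real q)\<^sup>2 * (real_of_int (x $ i - 0))\<^sup>2))) (0::int^'d)"
        by (rule U_mono) (rule Vind)
      also have "\<dots> = U s (\<lambda>x. of_bool (x \<in> V)) 0 + ((\<Sum>i\<in>UNIV. \<Sum>j\<in>{-int r..int r}. U s (\<lambda>x. of_bool (x $ i = j)) (0::int^'d))
        + (\<Sum>i::'d\<in>UNIV. 1 / (2 * real q)\<^sup>2 * (s / CARD('d))))"
        by (simp only: U_add U_sum finite finite_atLeastAtMost_int U_cmult U_sq) simp
      finally show ?thesis by simp
    qed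
    have tot: "real (Suc T) / 2 \<le> (\<Sum>s<Suc T. U s (\<lambda>x. of_bool (x \<in> V)) (0::int^'d))"
    proof -
      let ?t = "real q ^ 2"
      have B: "(\<Sum>i\<in>UNIV. \<Sum>j\<in>{-int r..int r}. \<Sum>s<Suc T. U s (\<lambda>x. of_bool (x $ i = j)) (0::int^'d)) \<le> ?t / 4"
      proof -
        have "(\<Sum>i\<in>UNIV. \<Sum>j\<in>{-int r..int r}. \<Sum>s<Suc T. U s (\<lambda>x. of_bool (x $ i = j)) (0::int^'d))
           \<le> (\<Sum>i::'d\<in>UNIV. \<Sum>j\<in>{-int r..int r}. real d * sqrt (Suc T))"
          unfolding d_def by (intro sum_mono occupation_hyperplane)
        also have "\<dots> = real d * ((2 * real r + 1) * (real d * real q))"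
          unfolding T by (simp add: d_def[symmetric] nat_add_distrib nat_mult_distrib)
        also have "\<dots> = ((2 * real r + 1) * (real d * real d)) * real q"
          by (simp only: mult_ac)
        also have "(2 * real r + 1) * (real d * real d) = real q / 4"
          by (simp add: q_def power2_eq_square algebra_simps)
        also have "real q / 4 * real q = ?t / 4"
          by (simp add: power2_eq_square)
        finally show ?thesis .
      qed
      have "(\<Sum>s<Suc T. real s / (2 * real q)\<^sup>2) \<le> (\<Sum>s<Suc T. real q ^ 2 / (2 * real q)\<^sup>2)"
      proof (intro sum_mono divide_right_mono)
        fix s assume "s \<in> {..<Suc T}"
        then have "s \<le> q\<^sup>2" using T by simp
        then show "real s \<le> (real q)\<^sup>2" by (metis of_nat_le_iff of_nat_power)
      qed auto
      also have "\<dots> = ?t / 4" unfolding T using q1 by (simp add: power2_eq_square)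
      finally have C: "(\<Sum>s<Suc T. real s / (2 * real q)\<^sup>2) \<le> ?t / 4" .
      have "(\<Sum>s<Suc T. (1::real)) \<le> (\<Sum>s<Suc T. U s (\<lambda>x. of_bool (x \<in> V)) (0::int^'d)
        + ((\<Sum>i\<in>UNIV. \<Sum>j\<in>{-int r..int r}. U s (\<lambda>x. of_bool (x $ i = j)) (0::int^'d)) + s / (2 * real q)\<^sup>2))"
        by (intro sum_mono step)
      also have "\<dots> = (\<Sum>s<Suc T. U s (\<lambda>x. of_bool (x \<in> V)) (0::int^'d))
        + ((\<Sum>i\<in>UNIV. \<Sum>j\<in>{-int r..int r}. \<Sum>s<Suc T. U s (\<lambda>x. of_bool (x $ i = j)) (0::int^'d)) + (\<Sum>s<Suc T. s / (2 * real q)\<^sup>2))"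
      proof -
        have "(\<Sum>s<Suc T. \<Sum>i\<in>UNIV. \<Sum>j\<in>{-int r..int r}. U s (\<lambda>x. of_bool (x $ i = j)) (0::int^'d))
          = (\<Sum>i\<in>UNIV. \<Sum>s<Suc T. \<Sum>j\<in>{-int r..int r}. U s (\<lambda>x. of_bool (x $ i = j)) (0::int^'d))"
          by (rule sum.swap)
        also have "\<dots> = (\<Sum>i\<in>UNIV. \<Sum>j\<in>{-int r..int r}. \<Sum>s<Suc T. U s (\<lambda>x. of_bool (x $ i = j)) (0::int^'d))"
          by (rule sum.cong[OF refl]) (rule sum.swap)
        finally show ?thesis unfolding sum.distrib by (simp only:)
      qed
      finally show ?thesis using B C unfolding T by (simp del: sum.lessThan_Suc)
    qed
    have "real (Suc T) / 2 \<le> (\<Sum>w\<in>V. visits (Suc T) w)"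
      unfolding visits_def using tot by (subst sum.swap) (simp add: sum_U_point fV)
    also have "\<dots> \<le> (\<Sum>w\<in>V. hp T w * (d * q))"
    proof (intro sum_mono)
      fix w :: "int^'d"
      have "visits (Suc T) w \<le> hp T w * visits (Suc T) (0::int^'d)" by (rule visits_le_hp)
      also have "\<dots> \<le> hp T w * (d * sqrt (Suc T))"
        unfolding d_def by (intro mult_left_mono visits_0_le hp_nonneg)
      finally show "visits (Suc T) w \<le> hp T w * (d * q)" unfolding T by simp
    qed
    also have "\<dots> \<le> (\<Sum>w\<in>V. ((2 * real d) ^ d * hp (T + d) z) * (d * q))"
    proof (intro sum_mono mult_right_mono)
      fix w assume w: "w \<in> V"
      have "\<bar>z $ j\<bar> < \<bar>w $ j\<bar>" for j
        using w z by (auto simp: V_def cube_def intro: le_less_trans)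
      then show "hp T w \<le> (2 * real d) ^ d * hp (T + d) z"
        using hp_coordinates_mono[of UNIV z w T] by (simp add: d_def)
    qed auto
    also have "\<dots> = card V * (((2 * real d) ^ d * hp (T + d) z) * (d * q))" by (simp only: sum_constant)
    also have "\<dots> \<le> (5 * real q) ^ d * (((2 * real d) ^ d * hp (T + d) z) * (d * q))"
      using cV hp_nonneg[of "T + d" z] by (intro mult_right_mono mult_nonneg_nonneg) auto
    finally have "real (Suc T) / 2 \<le> (5 * real q) ^ d * (((2 * real d) ^ d * hp (T + d) z) * (d * q))" .
    moreover have "real (Suc T) = real q * real q" unfolding T by (simp add: power2_eq_square)
    ultimately have "real q * real q \<le> 2 * ((5 * real q) ^ d * (((2 * real d) ^ d * hp (T + d) z) * (real d * real q)))"
      by simp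
    then have "real q * real q \<le> real q * (2 * ((5 * real q) ^ d * (((2 * real d) ^ d * hp (T + d) z) * real d)))"
      by (simp only: mult_ac)
    then have a1: "real q \<le> 2 * ((5 * real q) ^ d * (((2 * real d) ^ d * hp (T + d) z) * real d))"
      by (rule mult_left_le_imp_le) (use q1 in simp)
    \<comment> \<open>One power of q is split off the volume; cancelling it leaves the exponent d -
      1.\<close>
    have "(5 * real q) ^ d = real q * (5 ^ d * real q ^ (d - 1))"
      using d1 power_Suc[of "real q" "d - 1"] by (simp add: power_mult_distrib del: power_Suc)
    with a1 have "real q \<le> 2 * ((real q * (5 ^ d * real q ^ (d - 1))) * (((2 * real d) ^ d * hp (T + d) z) * real d))"
      by (simp only:)
    also have "\<dots> = real q * (2 * (5 ^ d * real q ^ (d - 1) * (((2 * real d) ^ d * hp (T + d) z) * real d)))"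
      by (simp only: mult_ac)
    finally have "real q * 1 \<le> real q * (2 * (5 ^ d * real q ^ (d - 1) * (((2 * real d) ^ d * hp (T + d) z) * real d)))"
      by (simp only: mult_1_right)
    then have "1 \<le> 2 * (5 ^ d * real q ^ (d - 1) * (((2 * real d) ^ d * hp (T + d) z) * real d))"
      by (rule mult_left_le_imp_le) (use q1 in simp)
    also have "\<dots> \<le> 2 * (5 ^ d * (12 * real d ^ 2 * real r) ^ (d - 1) * (((2 * real d) ^ d * hp (T + d) z) * real d))"
    proof -
      have "real q \<le> real (12 * d\<^sup>2 * r)" using qr by (simp only: of_nat_le_iff)
      then show ?thesis using hp_nonneg[of "T + d" z]
        by (intro mult_left_mono mult_right_mono power_mono) auto
    qed
    finally have a2: "1 \<le> 2 * (5 ^ d * (12 * real d ^ 2 * real r) ^ (d - 1) * (((2 * real d) ^ d * hp (T + d) z) * real d))" .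
    have c1: "c * (2 * (5 ^ d * (12 * real d ^ 2) ^ (d - 1) * ((2 * real d) ^ d * real d))) = 1"
    proof -
      have g: "inverse A / (2 * x * e * B) * (2 * (e * B * (A * x))) = 1"
        if "A \<noteq> 0" "B \<noteq> 0" "x \<noteq> 0" "e \<noteq> 0" for A B x e :: real
        using that by (simp add: field_simps)
      show ?thesis unfolding c_def by (rule g) (use d1 in auto)
    qed
    have "c * 1 \<le> c * (2 * (5 ^ d * (12 * real d ^ 2 * real r) ^ (d - 1) * (((2 * real d) ^ d * hp (T + d) z) * real d)))"
      by (rule mult_left_mono[OF a2]) (use \<open>c > 0\<close> in simp)
    also have "\<dots> = (c * (2 * (5 ^ d * (12 * real d ^ 2) ^ (d - 1) * ((2 * real d) ^ d * real d)))) * (real r ^ (d - 1) * hp (T + d) z)"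
    proof -
      have e: "(12 * real d ^ 2 * real r) ^ (d - 1) = (12 * real d ^ 2) ^ (d - 1) * real r ^ (d - 1)"
        by (rule power_mult_distrib)
      show ?thesis unfolding e by (simp only: mult_ac)
    qed
    finally have "c \<le> real r ^ (d - 1) * hp (T + d) z" unfolding c1 by (simp only: mult_1_right mult_1_left)
    then have "c / real r ^ (d - 1) \<le> hp (T + d) z"
      using r by (subst pos_divide_le_eq) (simp_all add: mult.commute)
    also have "\<dots> \<le> hp (K * r\<^sup>2) z"
    proof (rule hp_mono)
      have "q\<^sup>2 \<le> (12 * d\<^sup>2 * r)\<^sup>2" using qr by (rule power_mono) simp
      then have "T + d \<le> (12 * d\<^sup>2)\<^sup>2 * r\<^sup>2 + d * 1" unfolding T_def power_mult_distrib[of "12 * d\<^sup>2" r] by linarith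
      also have "\<dots> \<le> (12 * d\<^sup>2)\<^sup>2 * r\<^sup>2 + d * r\<^sup>2" using r by (intro add_left_mono mult_left_mono) auto
      finally show "T + d \<le> K * r\<^sup>2" by (simp only: K_def distrib_right)
    qed
    finally show ?thesis .
  qed
  show ?thesis
    by (rule exI[of _ c], rule conjI[OF \<open>c > 0\<close>], rule exI[of _ K], rule conjI[OF \<open>K \<ge> 1\<close>])
       (use main in \<open>auto simp: d_def\<close>)
qed

section \<open>Staying in a cube: the probabilities \<open>confine\<close>, interpreted in
  \<open>prob_confine\<close>\<close>

primrec confine :: "nat \<Rightarrow> nat \<Rightarrow> int^'d::finite \<Rightarrow> real" where
  "confine m 0 z = of_bool (z \<in> cube 0 m)"
| "confine m (Suc T) z = of_bool (z \<in> cube 0 m) * avg (confine m T) z"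

lemma confine_nonneg: "0 \<le> confine m T z"
proof (induction T arbitrary: z)
  case (Suc T)
  have "0 \<le> avg (confine m T) z" using avg_mono[of "\<lambda>_. 0" "confine m T" z] Suc by simp
  then show ?case by simp
qed simp

lemma confine_le_indicator: "confine m T z \<le> of_bool (z \<in> cube 0 m)"
proof (induction T arbitrary: z)
  case (Suc T)
  have "avg (confine m T) z \<le> avg (\<lambda>_. 1) z"
    by (intro avg_mono order_trans[OF Suc]) simp
  then show ?case by simp
qed simp

lemma confine_outside: "z \<notin> cube 0 m \<Longrightarrow> confine m T z = 0"
  using confine_le_indicator[of m T z] confine_nonneg[of m T z] by simp

lemma confine_antimono: "s \<le> T \<Longrightarrow> confine m T z \<le> confine m s z"
proof (rule lift_Suc_antimono_le[of "\<lambda>T. confine m T z"])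
  show "confine m (Suc T) z \<le> confine m T z" for T
  proof (induction T arbitrary: z)
    case 0
    show ?case using confine_le_indicator[of m "Suc 0" z] by (simp only: confine.simps(1))
  next
    case (Suc T)
    have "avg (confine m (Suc T)) z \<le> avg (confine m T) z" by (intro avg_mono Suc)
    then show ?case by simp
  qed
qed

lemma confine_le_U: "confine m T z \<le> U T (\<lambda>x. of_bool (x \<in> cube 0 m)) z"
proof (induction T arbitrary: z)
  case (Suc T)
  have "0 \<le> avg (confine m T) z"
    using avg_mono[of "\<lambda>_. 0" "confine m T" z, OF confine_nonneg] by simp
  then have "confine m (Suc T) z \<le> avg (confine m T) z" by simp
  also have "\<dots> \<le> avg (U T (\<lambda>x. of_bool (x \<in> cube 0 m))) z" by (intro avg_mono Suc)
  finally show ?case by (simp add: U_Suc')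
qed simp

text \<open>A confined walk always sits in one of the 2m + 1 hyperplanes x_i = j. With t = q^2 for q
  = 2d(2m + 1), their total expected occupation is at most (2m + 1) d q = t / 2. As the confinement
  probability decreases in time, t times its last value is at most this occupation.\<close>

lemma confine_half:
  "confine m ((2 * CARD('d) * (2 * m + 1))\<^sup>2) (z::int^'d::finite) \<le> 1 / 2"
proof -
  define q where "q = 2 * CARD('d) * (2 * m + 1)"
  define t where "t = q\<^sup>2"
  define i where "i = (undefined :: 'd)"
  have q: "q > 0" by (simp add: q_def)
  have "t * confine m t z = (\<Sum>s<t. confine m t z)" by simp
  also have "\<dots> \<le> (\<Sum>s<t. U s (\<lambda>x. \<Sum>j\<in>{-int m..int m}. of_bool (x $ i = j)) z)"
  proof (rule sum_mono)
    fix s assume "s \<in> {..<t}"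
    then have "confine m t z \<le> confine m s z" by (intro confine_antimono) simp
    also have "\<dots> \<le> U s (\<lambda>x. of_bool (x \<in> cube 0 m)) z" by (rule confine_le_U)
    also have "\<dots> \<le> U s (\<lambda>x. \<Sum>j\<in>{-int m..int m}. of_bool (x $ i = j)) z"
    proof (rule U_mono)
      fix x :: "int^'d"
      show "of_bool (x \<in> cube 0 m) \<le> (\<Sum>j\<in>{-int m..int m}. of_bool (x $ i = j) :: real)"
      proof (cases "x \<in> cube 0 m")
        case True
        then have "\<bar>x $ i\<bar> \<le> int m" by (auto simp: cube_def)
        then show ?thesis by (subst sum.remove[of _ "x $ i"]) (auto simp: sum_nonneg)
      qed (auto simp: sum_nonneg)
    qed
    finally show "confine m t z \<le> U s (\<lambda>x. \<Sum>j\<in>{-int m..int m}. of_bool (x $ i = j)) z" .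
  qed
  also have "\<dots> = (\<Sum>j\<in>{-int m..int m}. \<Sum>s<t. U s (\<lambda>x. of_bool (x $ i = j)) z)"
    by (subst sum.swap) (simp only: U_sum finite_atLeastAtMost_int)
  also have "\<dots> \<le> (\<Sum>j\<in>{-int m..int m}. CARD('d) * sqrt t)"
    by (intro sum_mono occupation_hyperplane)
  also have "\<dots> = real q * real q / 2"
    by (simp add: t_def) (simp add: q_def algebra_simps nat_add_distrib)
  finally have "real t * confine m t z \<le> real t * (1 / 2)" by (simp add: t_def power2_eq_square)
  then show ?thesis unfolding q_def[symmetric] t_def[symmetric]
    using q by (subst (asm) mult_le_cancel_left_pos) (auto simp: t_def)
qed

text \<open>The Markov property at time \<open>a\<close>, by induction on the first step; the
  uniform bound \<open>M\<close> spares the law of the position at that time.\<close>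

lemma confine_add:
  fixes z :: "int^'d::finite"
  assumes "\<And>y::int^'d. confine m b y \<le> M"
  shows "confine m (a + b) z \<le> confine m a z * M"
proof (induction a arbitrary: z)
  case 0
  then show ?case using assms[of z] confine_outside[of z m b] by (cases "z \<in> cube 0 m") auto
next
  case (Suc a)
  have "avg (confine m (a + b)) z \<le> avg (\<lambda>x. M * confine m a x) z"
    using Suc by (intro avg_mono) (simp add: mult.commute)
  then show ?case by (simp add: avg_cmult mult_ac)
qed

lemma confine_exponential:
  "confine m (k * (2 * CARD('d) * (2 * m + 1))\<^sup>2) (z::int^'d::finite) \<le> (1 / 2) ^ k"
proof (induction k arbitrary: z)
  case 0 then show ?case using confine_le_indicator[of m 0 z] by simp
next
  case (Suc k)
  let ?t = "(2 * CARD('d) * (2 * m + 1))\<^sup>2"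
  have "confine m (?t + k * ?t) z \<le> confine m ?t z * (1 / 2) ^ k"
    by (rule confine_add) (rule Suc)
  also have "\<dots> \<le> 1 / 2 * (1 / 2) ^ k" by (intro mult_right_mono confine_half) auto
  finally show ?case by (simp add: add.commute)
qed

section \<open>The probability space: measurability of coordinates and walks\<close>

abbreviation count_site :: "(int^'d::finite) measure" where
  "count_site \<equiv> count_space UNIV"

definition step_pmf :: "(int^'d::finite) pmf" where
  "step_pmf = pmf_of_set unit_steps"

definition step_seq :: "(nat \<Rightarrow> int^'d::finite) measure" where
  "step_seq = PiM UNIV (\<lambda>_. measure_pmf step_pmf)"

lemma frog_space_eq:
  "frog_space nu = PiM UNIV (\<lambda>_. measure_pmf nu) \<Otimes>\<^sub>M PiM UNIV (\<lambda>_. measure_pmf step_pmf)"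
  by (simp add: frog_space_def step_pmf_def)

lemma space_frog_space [simp]: "space (frog_space nu) = UNIV"
  by (simp add: frog_space_def space_pair_measure space_PiM)

lemma space_step_seq [simp]: "space step_seq = UNIV"
  by (simp add: step_seq_def space_PiM)

lemma prob_space_frog_space: "prob_space (frog_space nu)"
proof -
  interpret A: prob_space "PiM UNIV (\<lambda>_::int^'a. measure_pmf nu)"
    by (intro prob_space_PiM prob_space_measure_pmf)
  interpret B: prob_space "PiM UNIV (\<lambda>_::(int^'a) \<times> nat \<times> nat. measure_pmf (step_pmf :: (int^'a) pmf))"
    by (intro prob_space_PiM prob_space_measure_pmf)
  interpret pair_prob_space "PiM UNIV (\<lambda>_::int^'a. measure_pmf nu)"
    "PiM UNIV (\<lambda>_::(int^'a) \<times> nat \<times> nat. measure_pmf (step_pmf :: (int^'a) pmf))" ..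
  show ?thesis unfolding frog_space_eq by (rule prob_space_axioms)
qed

lemma prob_space_step_seq: "prob_space step_seq"
  unfolding step_seq_def by (intro prob_space_PiM prob_space_measure_pmf)

lemma measurable_frogs [measurable]: "(\<lambda>s. fst s x) \<in> frog_space nu \<rightarrow>\<^sub>M count_space UNIV"
  and measurable_steps [measurable]: "(\<lambda>s. snd s j) \<in> frog_space nu \<rightarrow>\<^sub>M count_space UNIV"
  unfolding frog_space_eq by (auto simp: measurable_cong_sets[OF refl sets_measure_pmf_count_space, symmetric]
     intro!: measurable_compose[OF measurable_fst measurable_component_singleton]
       measurable_compose[OF measurable_snd measurable_component_singleton])

lemma measurable_step_seq [measurable]: "(\<lambda>s. s j) \<in> step_seq \<rightarrow>\<^sub>M count_space UNIV"
  unfolding step_seq_def by (auto simp: measurable_cong_sets[OF refl sets_measure_pmf_count_space, symmetric]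
     intro!: measurable_component_singleton)

lemma sets_frog_space:
  "sets (frog_space nu) = sets (PiM UNIV (\<lambda>_. count_space UNIV) \<Otimes>\<^sub>M PiM UNIV (\<lambda>_. count_space UNIV))"
  unfolding frog_space_eq by (intro sets_pair_measure_cong sets_PiM_cong) auto

lemma measurable_into_frog_space:
  assumes "\<And>x. (\<lambda>a. fst (f a) x) \<in> M \<rightarrow>\<^sub>M count_space UNIV"
    and "\<And>j. (\<lambda>a. snd (f a) j) \<in> M \<rightarrow>\<^sub>M count_space UNIV"
  shows "f \<in> M \<rightarrow>\<^sub>M frog_space nu"
proof -
  have "(\<lambda>a. fst (f a)) \<in> M \<rightarrow>\<^sub>M PiM UNIV (\<lambda>_. count_space UNIV)"
    using assms(1) by (intro measurable_PiM_single') (auto simp: space_PiM)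
  moreover have "(\<lambda>a. snd (f a)) \<in> M \<rightarrow>\<^sub>M PiM UNIV (\<lambda>_. count_space UNIV)"
    using assms(2) by (intro measurable_PiM_single') (auto simp: space_PiM)
  ultimately have "(\<lambda>a. (fst (f a), snd (f a))) \<in> M \<rightarrow>\<^sub>M
      (PiM UNIV (\<lambda>_. count_space UNIV) \<Otimes>\<^sub>M PiM UNIV (\<lambda>_. count_space UNIV))"
    by (rule measurable_Pair)
  then show ?thesis unfolding measurable_cong_sets[OF refl sets_frog_space] by simp
qed

lemma measurable_count_space_binop:
  fixes f :: "'a \<Rightarrow> 'b::countable" and g :: "'a \<Rightarrow> 'c::countable"
  assumes "f \<in> M \<rightarrow>\<^sub>M count_space UNIV" "g \<in> M \<rightarrow>\<^sub>M count_space UNIV"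
  shows "(\<lambda>x. h (f x) (g x)) \<in> M \<rightarrow>\<^sub>M count_space UNIV"
proof (rule measurable_compose_countable[OF _ assms(1)])
  show "(\<lambda>x. h i (g x)) \<in> M \<rightarrow>\<^sub>M count_space UNIV" for i
    by (rule measurable_compose[OF assms(2)]) simp
qed

lemma measurable_count_space_sum:
  fixes f :: "nat \<Rightarrow> 'a \<Rightarrow> 'b::{countable, comm_monoid_add}"
  assumes "\<And>j. f j \<in> M \<rightarrow>\<^sub>M count_space UNIV"
  shows "(\<lambda>x. \<Sum>j<k. f j x) \<in> M \<rightarrow>\<^sub>M count_space UNIV"
proof (induction k)
  case (Suc k)
  show ?case unfolding sum.lessThan_Suc by (rule measurable_count_space_binop[OF Suc assms])
qed simp

lemma measurable_walk [measurable]: "(\<lambda>s. walk s x l k) \<in> frog_space nu \<rightarrow>\<^sub>M count_site"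
proof -
  have "(\<lambda>s. \<Sum>j<k. snd s (x, l, j)) \<in> frog_space nu \<rightarrow>\<^sub>M count_site"
    by (intro measurable_count_space_sum measurable_steps)
  then show ?thesis unfolding walk_def by (rule measurable_compose) simp
qed

lemma measurable_step_sum [measurable]:
  "(\<lambda>s. z + (\<Sum>j<k. s j)) \<in> step_seq \<rightarrow>\<^sub>M count_site"
proof -
  have "(\<lambda>s. \<Sum>j<k. s j) \<in> step_seq \<rightarrow>\<^sub>M count_site"
    by (intro measurable_count_space_sum measurable_step_seq)
  then show ?thesis by (rule measurable_compose) simp
qed

section \<open>The law of a single frog\<close>

lemma measure_frog_space_Times:
  assumes "A \<in> sets (PiM UNIV (\<lambda>_. measure_pmf nu))" "B \<in> sets (PiM UNIV (\<lambda>_. measure_pmf step_pmf))"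
  shows "measure (frog_space nu) (A \<times> B) =
    measure (PiM UNIV (\<lambda>_. measure_pmf nu)) A * measure (PiM UNIV (\<lambda>_. measure_pmf (step_pmf :: (int^'d::finite) pmf))) B"
proof -
  interpret A: prob_space "PiM UNIV (\<lambda>_::int^'d. measure_pmf nu)"
    by (intro prob_space_PiM prob_space_measure_pmf)
  interpret B: prob_space "PiM UNIV (\<lambda>_::(int^'d) \<times> nat \<times> nat. measure_pmf (step_pmf :: (int^'d) pmf))"
    by (intro prob_space_PiM prob_space_measure_pmf)
  interpret F: prob_space "frog_space nu :: 'd sample measure" by (rule prob_space_frog_space)
  show ?thesis using B.emeasure_pair_measure_Times[OF assms]
    unfolding frog_space_eq[symmetric] A.emeasure_eq_measure B.emeasure_eq_measure F.emeasure_eq_measure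
    by (simp add: ennreal_mult[symmetric])
qed

lemma distr_frog_steps:
  "distr (PiM UNIV (\<lambda>_. measure_pmf step_pmf)) step_seq (\<lambda>w k. w (x, l, k)) = step_seq"
  using distr_PiM_reindex[of UNIV "\<lambda>_. measure_pmf step_pmf" "\<lambda>k. (x, l, k)" UNIV]
  by (simp add: step_seq_def prob_space_measure_pmf inj_on_def restrict_UNIV)

text \<open>A sample holds increments for every label \<open>l\<close>, whether or not a frog with
  that label is present. Hence the number of frogs and the steps of one frog are independent, and
  events of one frog reduce to \<open>step_seq\<close>.\<close>

lemma prob_frog:
  fixes x :: "int^'d::finite"
  assumes "E \<in> sets step_seq"
  shows "measure (frog_space nu) {s. fst s x \<in> N \<and> (\<lambda>k. snd s (x, l, k)) \<in> E}
    = measure (measure_pmf nu) N * measure step_seq E"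
proof -
  let ?B = "PiM UNIV (\<lambda>_::(int^'d) \<times> nat \<times> nat. measure_pmf (step_pmf :: (int^'d) pmf))"
  let ?A = "PiM UNIV (\<lambda>_::int^'d. measure_pmf nu)"
  let ?f = "\<lambda>w k. w (x, l, k :: nat) :: int^'d"
  have m: "?f \<in> ?B \<rightarrow>\<^sub>M step_seq"
    unfolding step_seq_def by (intro measurable_PiM_single' measurable_component_singleton) (auto simp: space_PiM)
  have B: "?f -` E \<inter> space ?B \<in> sets ?B" by (rule measurable_sets[OF m assms])
  have A: "{w. w x \<in> N} \<in> sets ?A"
  proof -
    have "(\<lambda>w. w x) -` N \<inter> space ?A \<in> sets ?A"
      by (rule measurable_sets[OF measurable_component_singleton]) auto
    then show ?thesis by (simp add: space_PiM vimage_def)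
  qed
  have "{s. fst s x \<in> N \<and> (\<lambda>k. snd s (x, l, k)) \<in> E} = {w. w x \<in> N} \<times> (?f -` E \<inter> space ?B)"
    by (auto simp: space_PiM)
  then have "measure (frog_space nu) {s. fst s x \<in> N \<and> (\<lambda>k. snd s (x, l, k)) \<in> E}
    = measure ?A {w. w x \<in> N} * measure ?B (?f -` E \<inter> space ?B)"
    using measure_frog_space_Times[OF A B] by simp
  also have "measure ?B (?f -` E \<inter> space ?B) = measure step_seq E"
    using measure_distr[OF m assms] by (simp add: distr_frog_steps)
  also have "measure ?A {w. w x \<in> N} = measure (measure_pmf nu) N"
  proof -
    have "measure (distr ?A (measure_pmf nu) (\<lambda>w. w x)) N = measure ?A {w. w x \<in> N}"
      by (subst measure_distr) (auto simp: space_PiM vimage_def)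
    then show ?thesis by (subst (asm) distr_PiM_component) (auto simp: prob_space_measure_pmf)
  qed
  finally show ?thesis .
qed

text \<open>The Markov property at time 1. It gives events of a step sequence the recursions that
  define \<open>hp\<close> and \<open>confine\<close>.\<close>

lemma prob_first_step:
  assumes "E \<in> sets (step_seq :: (nat \<Rightarrow> int^'d::finite) measure)"
  shows "measure step_seq E = (\<Sum>e\<in>unit_steps. measure step_seq {s. case_nat e s \<in> E}) / card (unit_steps :: (int^'d) set)"
proof -
  let ?U = "measure_pmf (step_pmf :: (int^'d) pmf)"
  interpret sequence_space ?U
    by unfold_locales
  interpret S: prob_space "step_seq :: (nat \<Rightarrow> int^'d) measure" by (rule prob_space_step_seq)
  have SS: "step_seq = PiM (UNIV :: nat set) (\<lambda>_. ?U)" by (simp add: step_seq_def)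
  have m: "(\<lambda>(s, \<omega>). case_nat s \<omega>) \<in> ?U \<Otimes>\<^sub>M step_seq \<rightarrow>\<^sub>M step_seq"
    unfolding SS by measurable
  have "emeasure step_seq E = emeasure (distr (?U \<Otimes>\<^sub>M step_seq) step_seq (\<lambda>(s, \<omega>). case_nat s \<omega>)) E"
    using PiM_iter unfolding SS by simp
  also have "\<dots> = emeasure (?U \<Otimes>\<^sub>M step_seq) ((\<lambda>(s, \<omega>). case_nat s \<omega>) -` E \<inter> space (?U \<Otimes>\<^sub>M step_seq))"
    by (rule emeasure_distr[OF m assms])
  also have "\<dots> = (\<integral>\<^sup>+ e. emeasure step_seq (Pair e -` ((\<lambda>(s, \<omega>). case_nat s \<omega>) -` E \<inter> space (?U \<Otimes>\<^sub>M step_seq))) \<partial>?U)"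
    by (rule S.emeasure_pair_measure_alt[OF measurable_sets[OF m assms]])
  also have "\<dots> = (\<integral>\<^sup>+ e. ennreal (measure step_seq {s. case_nat e s \<in> E}) \<partial>?U)"
    by (intro nn_integral_cong) (auto simp: S.emeasure_eq_measure space_pair_measure vimage_def)
  also have "\<dots> = (\<Sum>e\<in>unit_steps. ennreal (measure step_seq {s. case_nat e s \<in> E})) / card (unit_steps :: (int^'d) set)"
    unfolding step_pmf_def by (rule nn_integral_pmf_of_set) auto
  also have "\<dots> = ennreal ((\<Sum>e\<in>unit_steps. measure step_seq {s. case_nat e s \<in> E}) / card (unit_steps :: (int^'d) set))"
    by (simp add: sum_ennreal sum_nonneg divide_ennreal card_gt_0_iff ennreal_of_nat_eq_real_of_nat)
  finally show ?thesis
    by (simp add: S.emeasure_eq_measure sum_nonneg)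
qed

lemma walk_case_nat: "z + (\<Sum>j<Suc k. case_nat e s j) = (z + e) + (\<Sum>j<k. s j)"
  for z :: "int^'d::finite"
  unfolding sum.lessThan_Suc_shift by (simp add: add.assoc)

lemma prob_hit_0: "measure step_seq {s. \<exists>k\<le>T. z + (\<Sum>j<k. s j) = 0} = hp T z"
  for z :: "int^'d::finite"
proof (induction T arbitrary: z)
  case 0
  interpret S: prob_space "step_seq :: (nat \<Rightarrow> int^'d) measure" by (rule prob_space_step_seq)
  show ?case using S.prob_space by auto
next
  case (Suc T)
  interpret S: prob_space "step_seq :: (nat \<Rightarrow> int^'d) measure" by (rule prob_space_step_seq)
  show ?case
  proof (cases "z = 0")
    case True
    then have "{s::nat \<Rightarrow> int^'d. \<exists>k\<le>Suc T. z + (\<Sum>j<k. s j) = 0} = UNIV" by auto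
    then show ?thesis using True S.prob_space by simp
  next
    case False
    have m: "{s. \<exists>k\<le>Suc T. z + (\<Sum>j<k. s j) = 0} \<in> sets step_seq"
    proof -
      have "{s \<in> space step_seq. \<exists>k\<le>Suc T. z + (\<Sum>j<k. s j) = 0} \<in> sets step_seq" by measurable
      then show ?thesis by simp
    qed
    have e: "(\<exists>k\<le>Suc T. z + (\<Sum>j<k. case_nat e s j) = 0) \<longleftrightarrow> (\<exists>k\<le>T. (z + e) + (\<Sum>j<k. s j) = 0)" for e s
    proof -
      have "(\<exists>k\<le>Suc T. z + (\<Sum>j<k. case_nat e s j) = 0) \<longleftrightarrow> (\<exists>k\<le>T. z + (\<Sum>j<Suc k. case_nat e s j) = 0)"
      proof
        assume "\<exists>k\<le>Suc T. z + (\<Sum>j<k. case_nat e s j) = 0"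
        then obtain k where k: "k \<le> Suc T" "z + (\<Sum>j<k. case_nat e s j) = 0" by blast
        with False have "k \<noteq> 0" by (cases k) auto
        with k show "\<exists>k\<le>T. z + (\<Sum>j<Suc k. case_nat e s j) = 0" by (cases k) auto
      qed (metis Suc_le_mono)
      then show ?thesis unfolding walk_case_nat .
    qed
    show ?thesis
      using False by (subst prob_first_step[OF m]) (simp add: e Suc avg_def del: sum.lessThan_Suc)
  qed
qed

lemma prob_confine: "measure step_seq {s. \<forall>k\<le>T. z + (\<Sum>j<k. s j) \<in> cube 0 m} = confine m T z"
  for z :: "int^'d::finite"
proof (induction T arbitrary: z)
  case 0
  interpret S: prob_space "step_seq :: (nat \<Rightarrow> int^'d) measure" by (rule prob_space_step_seq)
  show ?case using S.prob_space by auto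
next
  case (Suc T)
  show ?case
  proof (cases "z \<in> cube 0 m")
    case False
    then have *: "{s::nat \<Rightarrow> int^'d. \<forall>k\<le>Suc T. z + (\<Sum>j<k. s j) \<in> cube 0 m} = {}"
      by (auto intro!: exI[of _ "0::nat"])
    show ?thesis using False unfolding * by simp
  next
    case True
    have m: "{s. \<forall>k\<le>Suc T. z + (\<Sum>j<k. s j) \<in> cube 0 m} \<in> sets step_seq"
    proof -
      have "{s \<in> space step_seq. \<forall>k\<le>Suc T. z + (\<Sum>j<k. s j) \<in> cube 0 m} \<in> sets step_seq" by measurable
      then show ?thesis by simp
    qed
    have e: "(\<forall>k\<le>Suc T. z + (\<Sum>j<k. case_nat e s j) \<in> cube 0 m) \<longleftrightarrow> (\<forall>k\<le>T. (z + e) + (\<Sum>j<k. s j) \<in> cube 0 m)" for e s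
    proof -
      have "(\<forall>k\<le>Suc T. z + (\<Sum>j<k. case_nat e s j) \<in> cube 0 m) \<longleftrightarrow> (\<forall>k\<le>T. z + (\<Sum>j<Suc k. case_nat e s j) \<in> cube 0 m)"
      proof
        assume h: "\<forall>k\<le>T. z + (\<Sum>j<Suc k. case_nat e s j) \<in> cube 0 m"
        show "\<forall>k\<le>Suc T. z + (\<Sum>j<k. case_nat e s j) \<in> cube 0 m"
        proof (intro allI impI)
          fix k assume "k \<le> Suc T"
          then show "z + (\<Sum>j<k. case_nat e s j) \<in> cube 0 m" using h True by (cases k) auto
        qed
      qed (metis Suc_le_mono)
      then show ?thesis unfolding walk_case_nat .
    qed
    show ?thesis
      using True by (subst prob_first_step[OF m]) (simp add: e Suc avg_def del: sum.lessThan_Suc)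
  qed
qed

section \<open>Independence and translation invariance\<close>

text \<open>Forgets everything outside \<open>K\<close>. An event that cannot tell
  \<open>rst K s\<close> from \<open>s\<close> is one determined by the frogs starting in
  \<open>K\<close>; this replaces generated sigma-algebras. The filler 0 is not a unit step, so
  \<open>unit_sample\<close> is to be required of \<open>s\<close> and not of
  \<open>rst K s\<close>.\<close>

definition rst :: "(int^'d) set \<Rightarrow> 'd sample \<Rightarrow> 'd sample" where
  "rst K s = (\<lambda>x. if x \<in> K then fst s x else 0, \<lambda>(x, j). if x \<in> K then snd s (x, j) else 0)"

lemma fst_rst [simp]: "fst (rst K s) x = (if x \<in> K then fst s x else 0)"
  and snd_rst [simp]: "snd (rst K s) (x, j) = (if x \<in> K then snd s (x, j) else 0)"
  by (auto simp: rst_def)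

lemma measurable_rst [measurable]: "rst K \<in> frog_space nu \<rightarrow>\<^sub>M (frog_space nu :: 'd::finite sample measure)"
proof (rule measurable_into_frog_space)
  show "(\<lambda>a. fst (rst K a) x) \<in> frog_space nu \<rightarrow>\<^sub>M count_space UNIV" for x :: "int^'d"
    by (cases "x \<in> K") auto
  show "(\<lambda>a. snd (rst K a) j) \<in> frog_space nu \<rightarrow>\<^sub>M count_site" for j
    by (cases j; cases "fst j \<in> K") auto
qed

text \<open>Both kinds of coordinates are padded with 0 to a common type, so that they form a single
  family over a sum type and \<open>indep_vars\<close> covers them jointly.\<close>

fun coordinate :: "int^'d + (int^'d) \<times> nat \<times> nat \<Rightarrow> 'd sample \<Rightarrow> nat \<times> (int^'d)" where
  "coordinate (Inl x) s = (fst s x, 0)"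
| "coordinate (Inr j) s = (0, snd s j)"

lemma indep_vars_coordinates:
  "prob_space.indep_vars (frog_space nu) (\<lambda>_. count_space UNIV)
     (coordinate :: int^'d + (int^'d) \<times> nat \<times> nat \<Rightarrow> 'd::finite sample \<Rightarrow> _) UNIV"
proof -
  let ?A = "PiM UNIV (\<lambda>_::int^'d. measure_pmf nu)"
  let ?B = "PiM UNIV (\<lambda>_::(int^'d) \<times> nat \<times> nat. measure_pmf (step_pmf :: (int^'d) pmf))"
  interpret F: prob_space "frog_space nu :: 'd sample measure" by (rule prob_space_frog_space)
  interpret A: product_prob_space "\<lambda>_::int^'d. measure_pmf nu" UNIV by unfold_locales
  interpret B: product_prob_space "\<lambda>_::(int^'d) \<times> nat \<times> nat. measure_pmf (step_pmf :: (int^'d) pmf)" UNIV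
    by unfold_locales
  have meas: "F.random_variable (count_space UNIV) (coordinate i)" for i :: "int^'d + (int^'d) \<times> nat \<times> nat"
  proof (cases i)
    case (Inl x)
    have "coordinate i = (\<lambda>s. (fst s x, 0))" by (auto simp: Inl fun_eq_iff)
    moreover have "(\<lambda>s. (fst s x, 0 :: int^'d)) \<in> frog_space nu \<rightarrow>\<^sub>M count_space UNIV"
      by (rule measurable_compose[OF measurable_frogs]) simp
    ultimately show ?thesis by simp
  next
    case (Inr j)
    have "coordinate i = (\<lambda>s. (0, snd s j))" by (auto simp: Inr fun_eq_iff)
    moreover have "(\<lambda>s. (0::nat, snd s j)) \<in> frog_space nu \<rightarrow>\<^sub>M count_space UNIV"
      by (rule measurable_compose[OF measurable_steps]) simp
    ultimately show ?thesis by simp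
  qed
  \<comment> \<open>Finite rectangles decide independence. Split by the two kinds of index, such a
    rectangle is a product of two cylinder sets, whose measures factorise.\<close>
  have rect: "F.prob (\<Inter>i\<in>J. coordinate i -` D i) = (\<Prod>i\<in>J. F.prob (coordinate i -` D i))"
    if J: "finite J" for J and D :: "int^'d + (int^'d) \<times> nat \<times> nat \<Rightarrow> (nat \<times> (int^'d)) set"
  proof -
    define J1 where "J1 = Inl -` J"
    define J2 where "J2 = Inr -` J"
    have fJ: "finite J1" "finite J2" using J by (auto simp: J1_def J2_def intro: finite_vimageI)
    have JJ: "J = Inl ` J1 \<union> Inr ` J2"
    proof (intro set_eqI iffI)
      fix i assume "i \<in> J" then show "i \<in> Inl ` J1 \<union> Inr ` J2" by (cases i) (auto simp: J1_def J2_def)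
    qed (auto simp: J1_def J2_def)
    define D1 where "D1 x = {n. (n, 0) \<in> D (Inl x)}" for x
    define D2 where "D2 j = {e. (0, e) \<in> D (Inr j)}" for j
    have prodform: "F.prob ({w. \<forall>x\<in>I1. w x \<in> D1 x} \<times> {w. \<forall>j\<in>I2. w j \<in> D2 j})
       = (\<Prod>x\<in>I1. measure (measure_pmf nu) (D1 x)) * (\<Prod>j\<in>I2. measure (measure_pmf step_pmf) (D2 j))"
      if I: "finite I1" "finite I2" for I1 I2
    proof -
      have 1: "{w. \<forall>x\<in>I1. w x \<in> D1 x} = prod_emb UNIV (\<lambda>_. measure_pmf nu) I1 (Pi\<^sub>E I1 D1)"
        by (auto simp: prod_emb_def space_PiM PiE_def Pi_def)
      have 2: "{w. \<forall>j\<in>I2. w j \<in> D2 j} = prod_emb UNIV (\<lambda>_. measure_pmf step_pmf) I2 (Pi\<^sub>E I2 D2)"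
        by (auto simp: prod_emb_def space_PiM PiE_def Pi_def)
      have "F.prob ({w. \<forall>x\<in>I1. w x \<in> D1 x} \<times> {w. \<forall>j\<in>I2. w j \<in> D2 j})
        = measure ?A {w. \<forall>x\<in>I1. w x \<in> D1 x} * measure ?B {w. \<forall>j\<in>I2. w j \<in> D2 j}"
        by (rule measure_frog_space_Times) (unfold 1 2, (rule sets_PiM_I; use I in auto)+)
      also have "measure ?A {w. \<forall>x\<in>I1. w x \<in> D1 x} = (\<Prod>x\<in>I1. measure (measure_pmf nu) (D1 x))"
        unfolding 1 using I by (intro A.measure_PiM_emb) auto
      also have "measure ?B {w. \<forall>j\<in>I2. w j \<in> D2 j} = (\<Prod>j\<in>I2. measure (measure_pmf step_pmf) (D2 j))"
        unfolding 2 using I by (intro B.measure_PiM_emb) auto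
      finally show ?thesis .
    qed
    have s1: "F.prob (coordinate (Inl x) -` D (Inl x)) = measure (measure_pmf nu) (D1 x)" for x
    proof -
      have "coordinate (Inl x) -` D (Inl x) = {w. \<forall>x\<in>{x}. w x \<in> D1 x} \<times> {w. \<forall>j\<in>{}. w j \<in> D2 j}"
        by (auto simp: D1_def)
      then show ?thesis using prodform[of "{x}" "{}"] by simp
    qed
    have s2: "F.prob (coordinate (Inr j) -` D (Inr j)) = measure (measure_pmf step_pmf) (D2 j)" for j
    proof -
      have "coordinate (Inr j) -` D (Inr j) = {w. \<forall>x\<in>{}. w x \<in> D1 x} \<times> {w. \<forall>j\<in>{j}. w j \<in> D2 j}"
        by (auto simp: D2_def)
      then show ?thesis using prodform[of "{}" "{j}"] by simp
    qed
    have "(\<Inter>i\<in>J. coordinate i -` D i) = {w. \<forall>x\<in>J1. w x \<in> D1 x} \<times> {w. \<forall>j\<in>J2. w j \<in> D2 j}"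
      unfolding JJ INT_Un by (auto simp: D1_def D2_def image_iff ball_Un)
    then have "F.prob (\<Inter>i\<in>J. coordinate i -` D i) =
        (\<Prod>x\<in>J1. F.prob (coordinate (Inl x) -` D (Inl x))) * (\<Prod>j\<in>J2. F.prob (coordinate (Inr j) -` D (Inr j)))"
      using prodform[OF fJ] by (simp add: s1 s2)
    also have "\<dots> = (\<Prod>i\<in>J. F.prob (coordinate i -` D i))"
      unfolding JJ using fJ by (subst prod.union_disjoint) (auto simp: prod.reindex)
    finally show ?thesis .
  qed
  show ?thesis
    unfolding F.indep_vars_def2
  proof (intro conjI ballI meas)
    show "F.indep_sets (\<lambda>i. {coordinate i -` A \<inter> space (frog_space nu) |A. A \<in> sets (count_space UNIV)})
       (UNIV :: (int^'d + (int^'d) \<times> nat \<times> nat) set)"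
    proof (rule F.indep_setsI)
      show "{coordinate i -` A \<inter> space (frog_space nu) |A. A \<in> sets (count_space UNIV)} \<subseteq> F.events" for i
        using measurable_sets[OF meas[of i]] by auto
    next
      fix A and J :: "(int^'d + (int^'d) \<times> nat \<times> nat) set"
      assume J: "J \<noteq> {}" "finite J" "\<forall>j\<in>J. A j \<in> {coordinate j -` A \<inter> space (frog_space nu) |A. A \<in> sets (count_space UNIV)}"
      then have "\<forall>j\<in>J. \<exists>D. A j = coordinate j -` D" by auto
      then obtain D where D: "\<And>j. j \<in> J \<Longrightarrow> A j = coordinate j -` D j" by metis
      then have "\<Inter> (A ` J) = (\<Inter>j\<in>J. coordinate j -` D j)" by auto
      then show "F.prob (\<Inter> (A ` J)) = (\<Prod>j\<in>J. F.prob (A j))"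
        using rect[OF J(2), of D] D by simp
    qed
  qed
qed

text \<open>Each restricted sample is a measurable function \<open>g i\<close> of the block of
  coordinates over \<open>K i\<close>, and the blocks are disjoint.\<close>

lemma indep_vars_rst:
  fixes K :: "'i \<Rightarrow> (int^'d::finite) set"
  assumes "disjoint_family_on K I"
  shows "prob_space.indep_vars (frog_space nu) (\<lambda>_. frog_space nu) (\<lambda>i. rst (K i)) I"
proof -
  interpret F: prob_space "frog_space nu :: 'd sample measure" by (rule prob_space_frog_space)
  define K' where "K' i = Inl ` K i \<union> Inr ` (K i \<times> (UNIV :: (nat \<times> nat) set))" for i
  define g :: "'i \<Rightarrow> (int^'d + (int^'d) \<times> nat \<times> nat \<Rightarrow> nat \<times> (int^'d)) \<Rightarrow> 'd sample"
    where "g i f = (\<lambda>x. if x \<in> K i then fst (f (Inl x)) else 0, \<lambda>(x, j). if x \<in> K i then snd (f (Inr (x, j))) else 0)" for i f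
  have "F.indep_vars (\<lambda>i. PiM (K' i) (\<lambda>_. count_space UNIV)) (\<lambda>i s. restrict (\<lambda>j. coordinate j s) (K' i)) I"
    by (rule F.indep_vars_restrict[OF indep_vars_coordinates])
       (use assms in \<open>fastforce simp: disjoint_family_on_def K'_def\<close>)+
  then have "F.indep_vars (\<lambda>_. frog_space nu) (\<lambda>i s. g i (restrict (\<lambda>j. coordinate j s) (K' i))) I"
  proof (rule F.indep_vars_compose2)
    fix i
    show "g i \<in> PiM (K' i) (\<lambda>_. count_space UNIV) \<rightarrow>\<^sub>M frog_space nu"
    proof (rule measurable_into_frog_space)
      fix x :: "int^'d"
      show "(\<lambda>f. fst (g i f) x) \<in> PiM (K' i) (\<lambda>_. count_space UNIV) \<rightarrow>\<^sub>M count_space UNIV"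
      proof (cases "x \<in> K i")
        case True
        then have "(\<lambda>f. f (Inl x)) \<in> PiM (K' i) (\<lambda>_. count_space UNIV) \<rightarrow>\<^sub>M (count_space UNIV :: (nat \<times> (int^'d)) measure)"
          by (intro measurable_component_singleton) (auto simp: K'_def)
        then show ?thesis using True by (simp add: g_def) (rule measurable_compose, auto)
      qed (simp add: g_def)
    next
      fix j :: "(int^'d) \<times> nat \<times> nat"
      show "(\<lambda>f. snd (g i f) j) \<in> PiM (K' i) (\<lambda>_. count_space UNIV) \<rightarrow>\<^sub>M count_space UNIV"
      proof (cases "fst j \<in> K i")
        case True
        then have "(\<lambda>f. f (Inr j)) \<in> PiM (K' i) (\<lambda>_. count_space UNIV) \<rightarrow>\<^sub>M (count_space UNIV :: (nat \<times> (int^'d)) measure)"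
          by (intro measurable_component_singleton) (cases j, auto simp: K'_def)
        then have "(\<lambda>f. snd (f (Inr j) :: nat \<times> (int^'d))) \<in> PiM (K' i) (\<lambda>_. count_space UNIV) \<rightarrow>\<^sub>M count_site"
          by (rule measurable_compose) simp
        then show ?thesis using True by (cases j) (simp add: g_def)
      qed (cases j, simp add: g_def)
    qed
  qed
  moreover have "g i (restrict (\<lambda>j. coordinate j s) (K' i)) = rst (K i) s" for i s
    by (auto simp: g_def rst_def K'_def fun_eq_iff)
  ultimately show ?thesis by simp
qed

text \<open>The form in which independence is used for finite families: the last hypothesis says
  that \<open>E i\<close> is determined by the frogs starting in \<open>K i\<close>.\<close>

lemma prob_Int_rst:
  fixes K :: "'i \<Rightarrow> (int^'d::finite) set"
  assumes "disjoint_family_on K I" "finite I"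
    and "\<And>i. i \<in> I \<Longrightarrow> E i \<in> sets (frog_space nu)"
    and "\<And>i s. i \<in> I \<Longrightarrow> rst (K i) s \<in> E i \<longleftrightarrow> s \<in> E i"
  shows "measure (frog_space nu) (\<Inter>i\<in>I. E i) = (\<Prod>i\<in>I. measure (frog_space nu) (E i))"
proof (cases "I = {}")
  case True
  interpret F: prob_space "frog_space nu :: 'd sample measure" by (rule prob_space_frog_space)
  show ?thesis using True F.prob_space by simp
next
  case False
  interpret F: prob_space "frog_space nu :: 'd sample measure" by (rule prob_space_frog_space)
  have "F.prob (\<Inter>i\<in>I. rst (K i) -` E i \<inter> space (frog_space nu)) = (\<Prod>i\<in>I. F.prob (rst (K i) -` E i \<inter> space (frog_space nu)))"
    using False assms by (intro F.indep_varsD_finite[OF indep_vars_rst]) auto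
  moreover have "rst (K i) -` E i \<inter> space (frog_space nu) = E i" if "i \<in> I" for i
    by (simp add: set_eq_iff assms(4)[OF that] del: split_paired_All)
  ultimately show ?thesis by simp
qed

lemma prob_Int2_rst:
  fixes K L :: "(int^'d::finite) set"
  assumes "K \<inter> L = {}" "A \<in> sets (frog_space nu)" "B \<in> sets (frog_space nu)"
    and "\<And>s. rst K s \<in> A \<longleftrightarrow> s \<in> A" "\<And>s. rst L s \<in> B \<longleftrightarrow> s \<in> B"
  shows "measure (frog_space nu) (A \<inter> B) = measure (frog_space nu) A * measure (frog_space nu) B"
proof -
  have "measure (frog_space nu) (\<Inter>b\<in>UNIV. case_bool A B b)
    = (\<Prod>b\<in>UNIV. measure (frog_space nu) (case_bool A B b))"
  proof (rule prob_Int_rst[of "case_bool K L"])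
    show "disjoint_family_on (case_bool K L) UNIV"
      using assms(1) by (auto simp: disjoint_family_on_def split: bool.splits)
    show "case_bool A B i \<in> sets (frog_space nu)" for i
      using assms(2,3) by (cases i) auto
    show "rst (case_bool K L i) s \<in> case_bool A B i \<longleftrightarrow> s \<in> case_bool A B i" for i s
      using assms(4,5)[of s] by (cases i) (simp_all only: bool.case)
  qed simp
  then show ?thesis by (simp add: UNIV_bool Int_commute mult.commute)
qed

section \<open>Translation invariance\<close>

definition shift :: "int^'d \<Rightarrow> 'd sample \<Rightarrow> 'd sample" where
  "shift a s = (\<lambda>x. fst s (x + a), \<lambda>(x, j). snd s (x + a, j))"

lemma measurable_shift [measurable]: "shift a \<in> frog_space nu \<rightarrow>\<^sub>M (frog_space nu :: 'd::finite sample measure)"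
proof (rule measurable_into_frog_space)
  show "(\<lambda>s. fst (shift a s) x) \<in> frog_space nu \<rightarrow>\<^sub>M count_space UNIV" for x :: "int^'d"
    by (simp add: shift_def)
  show "(\<lambda>s. snd (shift a s) j) \<in> frog_space nu \<rightarrow>\<^sub>M count_site" for j
    by (cases j) (simp add: shift_def)
qed

lemma distr_shift: "distr (frog_space nu) (frog_space nu) (shift a) = (frog_space nu :: 'd::finite sample measure)"
proof -
  let ?A = "PiM UNIV (\<lambda>_::int^'d. measure_pmf nu)"
  let ?B = "PiM UNIV (\<lambda>_::(int^'d) \<times> nat \<times> nat. measure_pmf (step_pmf :: (int^'d) pmf))"
  have A: "distr ?A ?A (\<lambda>w x. w (x + a)) = ?A"
    using distr_PiM_reindex[of UNIV "\<lambda>_. measure_pmf nu" "\<lambda>x. x + a" UNIV]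
    by (simp add: prob_space_measure_pmf inj_on_def restrict_UNIV)
  have B: "distr ?B ?B (\<lambda>w j. w (fst j + a, snd j)) = ?B"
    using distr_PiM_reindex[of UNIV "\<lambda>_. measure_pmf step_pmf" "\<lambda>j. (fst j + a, snd j)" UNIV]
    by (simp add: prob_space_measure_pmf inj_on_def prod_eq_iff restrict_UNIV)
  interpret B: prob_space ?B by (intro prob_space_PiM prob_space_measure_pmf)
  have "distr ?A ?A (\<lambda>w x. w (x + a)) \<Otimes>\<^sub>M distr ?B ?B (\<lambda>w j. w (fst j + a, snd j)) =
     distr (?A \<Otimes>\<^sub>M ?B) (?A \<Otimes>\<^sub>M ?B) (\<lambda>(w, v). (\<lambda>x. w (x + a), \<lambda>j. v (fst j + a, snd j)))"
  proof (rule pair_measure_distr)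
    show "(\<lambda>w x. w (x + a)) \<in> ?A \<rightarrow>\<^sub>M ?A"
      by (intro measurable_PiM_single') (auto simp: space_PiM)
    show "(\<lambda>w j. w (fst j + a, snd j)) \<in> ?B \<rightarrow>\<^sub>M ?B"
      by (intro measurable_PiM_single' measurable_component_singleton) (auto simp: space_PiM)
    show "sigma_finite_measure (distr ?B ?B (\<lambda>w j. w (fst j + a, snd j)))"
      unfolding B by unfold_locales
  qed
  moreover have "(\<lambda>(w, v). (\<lambda>x. w (x + a), \<lambda>j. v (fst j + a, snd j))) = (shift a :: 'd sample \<Rightarrow> _)"
    by (auto simp: shift_def fun_eq_iff)
  ultimately show ?thesis unfolding A B frog_space_eq by simp
qed

section \<open>First passage times\<close>

lemma cube_trans: "w \<in> cube z a \<Longrightarrow> v \<in> cube w b \<Longrightarrow> v \<in> cube z (a + b)"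
  unfolding cube_def
proof clarify
  fix i assume "\<forall>i. \<bar>w $ i - z $ i\<bar> \<le> int a" "\<forall>i. \<bar>v $ i - w $ i\<bar> \<le> int b"
  then have "\<bar>w $ i - z $ i\<bar> \<le> int a" "\<bar>v $ i - w $ i\<bar> \<le> int b" by auto
  then show "\<bar>v $ i - z $ i\<bar> \<le> int (a + b)" by linarith
qed

lemma cube_mono: "a \<le> b \<Longrightarrow> cube z a \<subseteq> cube z b"
  unfolding cube_def by (auto intro: order_trans)

lemma cube_self [simp]: "z \<in> cube z a"
  by (simp add: cube_def)

lemma cube_sym: "w \<in> cube z a \<longleftrightarrow> z \<in> cube w a"
  by (simp add: cube_def abs_minus_commute)

lemma cube_diff: "w \<in> cube z a \<longleftrightarrow> w - z \<in> cube 0 a"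
  by (simp add: cube_def)

lemma tau_le_iff: "tau s x y \<le> enat t \<longleftrightarrow> (\<exists>k\<le>t. \<exists>l\<in>{1..fst s x}. walk s x l k = y)"
proof (cases "\<exists>k. \<exists>l\<in>{1..fst s x}. walk s x l k = y")
  case True
  then have "tau s x y \<le> enat t \<longleftrightarrow> (LEAST k. \<exists>l\<in>{1..fst s x}. walk s x l k = y) \<le> t"
    by (simp add: tau_def)
  also have "\<dots> \<longleftrightarrow> (\<exists>k\<le>t. \<exists>l\<in>{1..fst s x}. walk s x l k = y)"
    using LeastI_ex[OF True] by (auto intro: Least_le order_trans)
  finally show ?thesis .
qed (auto simp: tau_def)

lemma fpt_le_path:
  "m \<ge> 1 \<Longrightarrow> p 0 = x \<Longrightarrow> p m = y \<Longrightarrow> fpt s x y \<le> (\<Sum>i<m. tau s (p i) (p (Suc i)))"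
  unfolding fpt_def by (rule INF_lower2[of "(m, p)"]) auto

text \<open>\<open>enat\<close> is well ordered, so the infimum is a minimum. Arguments about
  \<open>fpt\<close> thereby become arguments about a single optimal path.\<close>

lemma fpt_attained:
  obtains m p where "m \<ge> 1" "p 0 = x" "p m = y" "fpt s x y = (\<Sum>i<m. tau s (p i) (p (Suc i)))"
proof -
  let ?S = "(\<lambda>mp. \<Sum>i<fst mp. tau s (snd mp i) (snd mp (Suc i))) ` {(m, p). m \<ge> (1::nat) \<and> p 0 = x \<and> p m = y}"
  have "(1, \<lambda>i. if i = 0 then x else y) \<in> {(m, p). m \<ge> (1::nat) \<and> p 0 = x \<and> p m = y}" by simp
  then obtain a where a: "a \<in> ?S" by blast
  then have "(LEAST b. b \<in> ?S) \<in> ?S" by (rule LeastI)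
  moreover have "Inf ?S = (LEAST b. b \<in> ?S)" using a unfolding Inf_enat_def by (intro if_not_P) blast
  ultimately have "Inf ?S \<in> ?S" by simp
  then show ?thesis using that unfolding fpt_def by auto
qed

lemma fpt_le_tau: "fpt s x y \<le> tau s x y"
  using fpt_le_path[of 1 "\<lambda>i. if i = 0 then x else y" x y s] by simp

lemma fpt_triangle: "fpt s x z \<le> fpt s x y + fpt s y z"
proof -
  obtain m p where p: "m \<ge> 1" "p 0 = x" "p m = y" "fpt s x y = (\<Sum>i<m. tau s (p i) (p (Suc i)))"
    by (rule fpt_attained)
  obtain n q where q: "n \<ge> 1" "q 0 = y" "q n = z" "fpt s y z = (\<Sum>i<n. tau s (q i) (q (Suc i)))"
    by (rule fpt_attained)
  define r where "r i = (if i \<le> m then p i else q (i - m))" for i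
  have "fpt s x z \<le> (\<Sum>i<m + n. tau s (r i) (r (Suc i)))"
    using p q by (intro fpt_le_path) (auto simp: r_def)
  also have "\<dots> = (\<Sum>i<m. tau s (r i) (r (Suc i))) + (\<Sum>i<n. tau s (r (m + i)) (r (Suc (m + i))))"
    by (induction n) (auto simp: add.assoc)
  also have "(\<Sum>i<m. tau s (r i) (r (Suc i))) = fpt s x y"
    unfolding p(4) by (intro sum.cong) (auto simp: r_def)
  also have "(\<Sum>i<n. tau s (r (m + i)) (r (Suc (m + i)))) = fpt s y z"
    unfolding q(4) using p(3) q(2) by (intro sum.cong) (auto simp: r_def Suc_diff_le)
  finally show ?thesis .
qed

lemma fpt_trans_le: "fpt s x y \<le> enat a \<Longrightarrow> fpt s y z \<le> enat b \<Longrightarrow> fpt s x z \<le> enat (a + b)"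
  using fpt_triangle[of s x z y] add_mono[of "fpt s x y" "enat a" "fpt s y z" "enat b"] by simp

lemma fpt_path_le:
  assumes "1 \<le> m"
  shows "fpt s (p 0) (p m) \<le> (\<Sum>i<m. fpt s (p i) (p (Suc i)))"
  using assms
proof (induction m rule: dec_induct)
  case base
  show ?case by simp
next
  case (step m)
  have "fpt s (p 0) (p (Suc m)) \<le> fpt s (p 0) (p m) + fpt s (p m) (p (Suc m))" by (rule fpt_triangle)
  also have "\<dots> \<le> (\<Sum>i<m. fpt s (p i) (p (Suc i))) + fpt s (p m) (p (Suc m))"
    by (intro add_right_mono step.IH)
  finally show ?case by simp
qed

text \<open>The sample space admits arbitrary increments; this event of full measure
  (\<open>AE_unit_sample\<close>) gives all frogs speed at most one.\<close>

definition unit_sample :: "('d::finite) sample \<Rightarrow> bool" where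
  "unit_sample s \<longleftrightarrow> (\<forall>j. snd s j \<in> unit_steps)"

lemma AE_unit_sample: "AE s in (frog_space nu :: 'd::finite sample measure). unit_sample s"
  unfolding unit_sample_def AE_all_countable
proof
  fix j :: "(int^'d) \<times> nat \<times> nat"
  obtain x l k where j: "j = (x, l, k)" by (metis prod_cases3)
  interpret F: prob_space "frog_space nu :: 'd sample measure" by (rule prob_space_frog_space)
  interpret S: prob_space "step_seq :: (nat \<Rightarrow> int^'d) measure" by (rule prob_space_step_seq)
  let ?E = "{s::nat \<Rightarrow> int^'d. s k \<in> unit_steps}"
  have m: "?E \<in> sets step_seq"
  proof -
    have "{s \<in> space step_seq. (s k :: int^'d) \<in> unit_steps} \<in> sets step_seq" by measurable
    then show ?thesis by simp
  qed
  have "AE s in step_seq. (s k :: int^'d) \<in> unit_steps"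
    unfolding step_seq_def
    by (rule AE_PiM_component) (auto simp: prob_space_measure_pmf AE_measure_pmf_iff step_pmf_def)
  then have "S.prob ?E = 1" using S.prob_eq_1[OF m] by simp
  then have "F.prob {s. fst s x \<in> UNIV \<and> (\<lambda>k. snd s (x, l, k)) \<in> ?E} = 1"
    by (subst prob_frog[OF m]) simp
  then have "F.prob {s. snd s j \<in> unit_steps} = 1" by (simp add: j)
  moreover have "{s. snd s j \<in> unit_steps} \<in> F.events"
  proof -
    have "{s \<in> space (frog_space nu). snd s j \<in> unit_steps} \<in> F.events" by measurable
    then show ?thesis by simp
  qed
  ultimately show "AE s in frog_space nu. snd s j \<in> unit_steps"
    using F.prob_eq_1[of "{s. snd s j \<in> unit_steps}"] by simp
qed

lemma unit_step_cube: "e \<in> unit_steps \<Longrightarrow> z + e \<in> cube z 1"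
  by (auto simp: cube_def unit_steps_eq axis_def)

lemma walk_0 [simp]: "walk s x l 0 = x"
  by (simp add: walk_def)

lemma walk_Suc: "walk s x l (Suc k) = walk s x l k + snd s (x, l, k)"
  by (simp add: walk_def add.assoc)

lemma walk_in_cube: "unit_sample s \<Longrightarrow> walk s x l k \<in> cube x k"
proof (induction k)
  case (Suc k)
  have "walk s x l (Suc k) \<in> cube (walk s x l k) 1"
    using Suc.prems unfolding walk_Suc unit_sample_def by (intro unit_step_cube) blast
  with Suc show ?case using cube_trans[of "walk s x l k" x k "walk s x l (Suc k)" 1] by simp
qed simp

lemma tau_cube: "unit_sample s \<Longrightarrow> tau s x y \<le> enat t \<Longrightarrow> y \<in> cube x t"
  unfolding tau_le_iff using walk_in_cube cube_mono by blast

section \<open>Dependence of passage times on bounded regions\<close>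

lemma walk_rst: "x \<in> K \<Longrightarrow> walk (rst K s) x l k = walk s x l k"
  by (simp add: walk_def)

lemma tau_rst: "tau (rst K s) x y = (if x \<in> K then tau s x y else \<infinity>)"
  by (auto simp: tau_def walk_rst)

lemma fpt_rst_ge: "fpt s x y \<le> fpt (rst K s) x y"
proof -
  obtain m p where p: "m \<ge> 1" "p 0 = x" "p m = y" "fpt (rst K s) x y = (\<Sum>i<m. tau (rst K s) (p i) (p (Suc i)))"
    by (rule fpt_attained)
  have "fpt s x y \<le> (\<Sum>i<m. tau s (p i) (p (Suc i)))" using p by (intro fpt_le_path)
  also have "\<dots> \<le> fpt (rst K s) x y" unfolding p(4) by (intro sum_mono) (simp add: tau_rst)
  finally show ?thesis .
qed

lemma path_in_cube:
  assumes "unit_sample s" "(\<Sum>i<m. tau s (p i) (p (Suc i))) \<le> enat t"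
  shows "p m \<in> cube (p 0) t"
  using assms(2)
proof (induction m arbitrary: t)
  case (Suc m)
  let ?a = "\<Sum>i<m. tau s (p i) (p (Suc i))"
  have "?a + tau s (p m) (p (Suc m)) \<le> enat t" using Suc.prems by simp
  then obtain a b where ab: "?a = enat a" "tau s (p m) (p (Suc m)) = enat b" "a + b \<le> t"
    by (cases ?a; cases "tau s (p m) (p (Suc m))") auto
  have "p m \<in> cube (p 0) a" using Suc.IH[of a] ab by simp
  moreover have "p (Suc m) \<in> cube (p m) b" using tau_cube[OF assms(1)] ab by simp
  ultimately show ?case using cube_trans cube_mono[OF ab(3)] by blast
qed simp

text \<open>An optimal path of duration at most \<open>t\<close> uses only frogs that start in
  \<open>cube x t\<close>, and removing other frogs cannot speed up the passage.\<close>

lemma fpt_rst_eq: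
  assumes "unit_sample s" "fpt s x y \<le> enat t" "cube x t \<subseteq> K"
  shows "fpt (rst K s) x y = fpt s x y"
proof (rule antisym[OF _ fpt_rst_ge])
  obtain m p where p: "m \<ge> 1" "p 0 = x" "p m = y" "fpt s x y = (\<Sum>i<m. tau s (p i) (p (Suc i)))"
    by (rule fpt_attained)
  have "p i \<in> K" if "i < m" for i
  proof -
    have "(\<Sum>i<i. tau s (p i) (p (Suc i))) \<le> (\<Sum>i<m. tau s (p i) (p (Suc i)))"
      using that by (intro sum_mono2) auto
    then have "p i \<in> cube x t"
      using path_in_cube[OF assms(1), where m=i and p=p and t=t] p assms(2) by auto
    then show ?thesis using assms(3) by blast
  qed
  then have "(\<Sum>i<m. tau (rst K s) (p i) (p (Suc i))) = fpt s x y"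
    unfolding p(4) by (intro sum.cong) (auto simp: tau_rst)
  then show "fpt (rst K s) x y \<le> fpt s x y" using fpt_le_path[OF p(1-3), of "rst K s"] by simp
qed

section \<open>Measurability of passage times\<close>

lemma measurable_tau [measurable]: "(\<lambda>s. tau s x y) \<in> frog_space nu \<rightarrow>\<^sub>M count_space UNIV"
proof -
  have *: "(tau s x y \<le> enat t) = (\<exists>k\<le>t. \<exists>l. 1 \<le> l \<and> l \<le> fst s x \<and> walk s x l k = y)" for s t
    by (simp add: tau_le_iff Bex_def conj_assoc)
  have m: "{s \<in> space (frog_space nu). tau s x y \<le> enat t} \<in> sets (frog_space nu)" for t
    unfolding * by measurable
  have "{s \<in> space (frog_space nu). tau s x y = a} \<in> sets (frog_space nu)" for a
  proof (cases a)
    case (enat t)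
    have "{s \<in> space (frog_space nu). tau s x y = a} =
      (if t = 0 then {s \<in> space (frog_space nu). tau s x y \<le> enat 0}
       else {s \<in> space (frog_space nu). tau s x y \<le> enat t} - {s \<in> space (frog_space nu). tau s x y \<le> enat (t - 1)})"
    proof -
      have "(e = enat t) = (if t = 0 then e \<le> enat 0 else e \<le> enat t \<and> \<not> e \<le> enat (t - 1))" for e
        by (cases e) auto
      then show ?thesis unfolding enat by auto
    qed
    then show ?thesis using m by simp
  next
    case infinity
    have "(e = \<infinity>) = (\<forall>t. \<not> e \<le> enat t)" for e by (cases e) auto
    then have "{s \<in> space (frog_space nu). tau s x y = a} =
       space (frog_space nu) - (\<Union>t. {s \<in> space (frog_space nu). tau s x y \<le> enat t})"
      unfolding infinity by auto
    moreover have "\<dots> \<in> sets (frog_space nu)"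
      by (intro sets.Diff sets.top sets.countable_UN) (use m in auto)
    ultimately show ?thesis by simp
  qed
  then show ?thesis
    by (subst measurable_count_space_eq2_countable) (auto simp: vimage_def Int_def conj_commute)
qed

text \<open>There are countably many lists of sites but uncountably many functions \<open>p\<close>;
  with lists the event becomes a countable union.\<close>

lemma fpt_le_iff_list:
  "fpt s x y \<le> t \<longleftrightarrow> (\<exists>xs. length xs \<ge> 2 \<and> xs ! 0 = x \<and> xs ! (length xs - 1) = y \<and>
      (\<Sum>i<length xs - 1. tau s (xs ! i) (xs ! Suc i)) \<le> t)"
proof
  assume t: "fpt s x y \<le> t"
  obtain m p where p: "m \<ge> 1" "p 0 = x" "p m = y" "fpt s x y = (\<Sum>i<m. tau s (p i) (p (Suc i)))"
    by (rule fpt_attained)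
  have "(\<Sum>i<m. tau s (map p [0..<Suc m] ! i) (map p [0..<Suc m] ! Suc i)) = fpt s x y"
    unfolding p(4) by (intro sum.cong) (auto simp del: upt_Suc)
  then show "\<exists>xs. length xs \<ge> 2 \<and> xs ! 0 = x \<and> xs ! (length xs - 1) = y \<and>
      (\<Sum>i<length xs - 1. tau s (xs ! i) (xs ! Suc i)) \<le> t"
    using p(1-3) t by (intro exI[of _ "map p [0..<Suc m]"]) (auto simp del: upt_Suc)
next
  assume "\<exists>xs. length xs \<ge> 2 \<and> xs ! 0 = x \<and> xs ! (length xs - 1) = y \<and>
      (\<Sum>i<length xs - 1. tau s (xs ! i) (xs ! Suc i)) \<le> t"
  then obtain xs where xs: "length xs \<ge> 2" "xs ! 0 = x" "xs ! (length xs - 1) = y"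
    "(\<Sum>i<length xs - 1. tau s (xs ! i) (xs ! Suc i)) \<le> t" by blast
  have "fpt s x y \<le> (\<Sum>i<length xs - 1. tau s (xs ! i) (xs ! Suc i))"
    using xs(1-3) by (intro fpt_le_path) auto
  then show "fpt s x y \<le> t" using xs(4) by (rule order_trans)
qed

lemma measurable_fpt [measurable]: "(\<lambda>s. fpt s x y) \<in> frog_space nu \<rightarrow>\<^sub>M count_space UNIV"
proof -
  have m: "{s \<in> space (frog_space nu). fpt s x y \<le> t} \<in> sets (frog_space nu)" for t
  proof -
    have [measurable]: "(\<lambda>s. \<Sum>i<length xs - 1. tau s (xs ! i) (xs ! Suc i)) \<in> frog_space nu \<rightarrow>\<^sub>M count_space UNIV" for xs
      by (intro measurable_count_space_sum measurable_tau)
    show ?thesis unfolding fpt_le_iff_list by measurable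
  qed
  have "{s \<in> space (frog_space nu). fpt s x y = a} \<in> sets (frog_space nu)" for a
  proof -
    have "(e = a) = (e \<le> a \<and> (\<forall>t. t < a \<longrightarrow> \<not> e \<le> t))" for e
      by (metis leD order_le_less order_refl)
    then have "{s \<in> space (frog_space nu). fpt s x y = a} =
       {s \<in> space (frog_space nu). fpt s x y \<le> a} - (\<Union>t\<in>{..<a}. {s \<in> space (frog_space nu). fpt s x y \<le> t})"
      by auto
    then show ?thesis using m by (auto intro!: sets.Diff sets.countable_UN')
  qed
  then show ?thesis
    by (subst measurable_count_space_eq2_countable) (auto simp: vimage_def Int_def conj_commute)
qed

lemma fpt_shift: "fpt (shift a s) x y = fpt s (x + a) (y + a)"
proof -
  have w: "walk (shift a s) x l k = y \<longleftrightarrow> walk s (x + a) l k = y + a" for x y l k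
    by (auto simp: walk_def shift_def algebra_simps)
  have "tau (shift a s) x y = tau s (x + a) (y + a)" for x y
    unfolding tau_def w by (simp add: shift_def)
  note t = this
  show ?thesis
  proof (rule antisym)
    obtain m p where p: "m \<ge> 1" "p 0 = x + a" "p m = y + a" "fpt s (x + a) (y + a) = (\<Sum>i<m. tau s (p i) (p (Suc i)))"
      by (rule fpt_attained)
    have "fpt (shift a s) x y \<le> (\<Sum>i<m. tau (shift a s) (p i - a) (p (Suc i) - a))"
      using p by (intro fpt_le_path[of m "\<lambda>i. p i - a"]) auto
    then show "fpt (shift a s) x y \<le> fpt s (x + a) (y + a)" by (simp add: t p(4))
  next
    obtain m p where p: "m \<ge> 1" "p 0 = x" "p m = y" "fpt (shift a s) x y = (\<Sum>i<m. tau (shift a s) (p i) (p (Suc i)))"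
      by (rule fpt_attained)
    have "fpt s (x + a) (y + a) \<le> (\<Sum>i<m. tau s (p i + a) (p (Suc i) + a))"
      using p by (intro fpt_le_path[of m "\<lambda>i. p i + a"]) auto
    then show "fpt s (x + a) (y + a) \<le> fpt (shift a s) x y" by (simp add: t p(4))
  qed
qed

section \<open>Filling cubes\<close>

text \<open>For y = c x / 2 the k-th term of the exponential series gives y^k / k! <= exp y.
  Polynomial prefactors are thus absorbed by halving the rate.\<close>

lemma poly_exp_bound:
  assumes "c > 0"
  shows "\<exists>C>0. \<forall>x\<ge>0. x ^ k * exp (- c * x) \<le> C * exp (- (c / 2) * (x::real))"
proof -
  define C where "C = fact k * (2 / c) ^ k"
  have "C > 0" using assms by (simp add: C_def)
  have "x ^ k * exp (- c * x) \<le> C * exp (- (c / 2) * x)" if x: "x \<ge> 0" for x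
  proof -
    define y where "y = c / 2 * x"
    have y: "y \<ge> 0" using assms x by (simp add: y_def)
    have "(\<Sum>i\<in>{k}. y ^ i /\<^sub>R fact i) \<le> (\<Sum>i. y ^ i /\<^sub>R fact i)"
      using y by (intro sum_le_suminf sums_summable[OF exp_converges]) auto
    also have "\<dots> = exp y" using sums_unique[OF exp_converges[of y]] by (rule sym)
    finally have "y ^ k / fact k \<le> exp y" by (simp add: divide_inverse mult.commute)
    then have "y ^ k \<le> fact k * exp y" by (simp add: field_simps)
    then have "(2 / c) ^ k * y ^ k \<le> (2 / c) ^ k * (fact k * exp y)"
      using assms by (intro mult_left_mono) auto
    moreover have "(2 / c) ^ k * y ^ k = x ^ k" using assms by (simp add: y_def power_mult_distrib[symmetric])
    ultimately have "x ^ k \<le> C * exp y" by (simp add: C_def mult_ac)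
    then have "x ^ k * exp (- c * x) \<le> C * exp y * exp (- c * x)" by (intro mult_right_mono) auto
    also have "\<dots> = C * exp (y + - c * x)" by (simp add: exp_add[symmetric] mult.assoc)
    also have "y + - c * x = - (c / 2) * x" by (simp add: y_def)
    finally show ?thesis .
  qed
  with \<open>C > 0\<close> show ?thesis by blast
qed

lemma occupied_positive:
  fixes nu :: "nat pmf"
  assumes "pmf nu 0 < 1"
  shows "measure (measure_pmf nu) {1..} > 0"
proof -
  have e: "{1..} = UNIV - {0::nat}" by auto
  have "measure (measure_pmf nu) (UNIV - {0}) = 1 - pmf nu 0"
    using measure_pmf.prob_compl[of "{0}" nu] by (simp add: measure_pmf_single)
  then show ?thesis unfolding e using assms by simp
qed

text \<open>Only the frog with label 1 is followed, so the law \<open>nu\<close> enters through the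
  probability of being occupied alone.\<close>

definition occ_hits :: "'d::finite sample \<Rightarrow> int^'d \<Rightarrow> nat \<Rightarrow> int^'d \<Rightarrow> bool" where
  "occ_hits s v T w \<longleftrightarrow> 1 \<le> fst s v \<and> (\<exists>k\<le>T. walk s v 1 k = w)"

lemma occ_hits_fpt: "occ_hits s v T w \<Longrightarrow> fpt s v w \<le> enat T"
proof -
  assume "occ_hits s v T w"
  then have "tau s v w \<le> enat T" unfolding occ_hits_def tau_le_iff by (metis atLeastAtMost_iff order_refl)
  then show ?thesis using fpt_le_tau order_trans by blast
qed

lemma occ_hits_rst: "v \<in> K \<Longrightarrow> occ_hits (rst K s) v T w \<longleftrightarrow> occ_hits s v T w"
  by (simp add: occ_hits_def walk_rst)

lemma measurable_occ_hits [measurable]: "Measurable.pred (frog_space nu) (\<lambda>s. occ_hits s v T w)"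
  unfolding occ_hits_def by measurable

lemma sets_frogI:
  "Measurable.pred (frog_space nu) P \<Longrightarrow> {s. P s} \<in> sets (frog_space nu)"
  by (simp add: pred_def)

lemma prob_occ_hits:
  "measure (frog_space nu) {s. occ_hits s v T w} = measure (measure_pmf nu) {1..} * hp T (v - w)"
  for v w :: "int^'d::finite"
proof -
  let ?E = "{s. \<exists>k\<le>T. (v - w) + (\<Sum>j<k. s j) = 0}"
  have m: "?E \<in> sets step_seq"
  proof -
    have "{s \<in> space step_seq. \<exists>k\<le>T. (v - w) + (\<Sum>j<k. s j) = 0} \<in> sets step_seq" by measurable
    then show ?thesis by simp
  qed
  have "occ_hits s v T w \<longleftrightarrow> fst s v \<in> {1..} \<and> (\<lambda>k. snd s (v, 1, k)) \<in> ?E" for s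
    by (auto simp: occ_hits_def walk_def algebra_simps)
  then have "{s. occ_hits s v T w} = {s. fst s v \<in> {1..} \<and> (\<lambda>k. snd s (v, 1, k)) \<in> ?E}" by (simp only:)
  then show ?thesis using prob_frog[OF m, of nu v "{1..}" 1] by (simp only: prob_hit_0)
qed

text \<open>Frogs from distinct sites are independent, and 1 - u <= exp (-u) turns the product into
  an exponential in the number of sites.\<close>

lemma prob_no_hit:
  fixes w :: "int^'d::finite"
  assumes A: "finite A" and h: "\<And>v. v \<in> A \<Longrightarrow> h \<le> hp T (v - w)"
  shows "measure (frog_space nu) {s. \<forall>v\<in>A. \<not> occ_hits s v T w} \<le> exp (- (measure (measure_pmf nu) {1..} * h * card A))"
proof -
  interpret F: prob_space "frog_space nu :: 'd sample measure" by (rule prob_space_frog_space)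
  let ?p = "measure (measure_pmf nu) {1..}"
  have e: "{s. \<forall>v\<in>A. \<not> occ_hits s v T w} = (\<Inter>v\<in>A. {s. \<not> occ_hits s v T w})" by auto
  have "F.prob {s. \<forall>v\<in>A. \<not> occ_hits s v T w} = (\<Prod>v\<in>A. F.prob {s. \<not> occ_hits s v T w})"
    unfolding e
  proof (rule prob_Int_rst[where K="\<lambda>v. {v}"])
    show "{s. \<not> occ_hits s i T w} \<in> F.events" for i by (rule sets_frogI) measurable
  qed (auto simp: A disjoint_family_on_def occ_hits_rst)
  also have "\<dots> \<le> (\<Prod>v\<in>A. exp (- (?p * h)))"
  proof (intro prod_mono conjI)
    fix v assume v: "v \<in> A"
    have "{s. occ_hits s v T w} \<in> F.events" by (rule sets_frogI) measurable
    then have "F.prob {s. \<not> occ_hits s v T w} = 1 - F.prob {s. occ_hits s v T w}"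
      using F.prob_compl[of "{s. occ_hits s v T w}"] by (simp add: Collect_neg_eq Compl_eq_Diff_UNIV)
    also have "\<dots> \<le> 1 - ?p * h" using h[OF v] unfolding prob_occ_hits by (simp add: mult_left_mono)
    also have "\<dots> \<le> exp (- (?p * h))" using exp_ge_add_one_self[of "- (?p * h)"] by simp
    finally show "F.prob {s. \<not> occ_hits s v T w} \<le> exp (- (?p * h))" .
  qed simp
  also have "\<dots> = exp (- (?p * h * card A))" by (simp add: exp_of_nat_mult[symmetric] mult_ac)
  finally show ?thesis .
qed

lemma power_superadditive: "d \<ge> 1 \<Longrightarrow> a ^ d + b ^ d \<le> (a + b) ^ d" for a b :: nat
proof (induction d rule: dec_induct)
  case (step n)
  have "a ^ Suc n + b ^ Suc n \<le> (a + b) * (a ^ n + b ^ n)" by (simp add: algebra_simps)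
  also have "\<dots> \<le> (a + b) * (a + b) ^ n" by (intro mult_left_mono step.IH) simp
  finally show ?case by simp
qed simp

text \<open>The centre is left out for every \<open>r\<close>, so whatever the annuli do is
  independent of the frogs at \<open>z\<close>; see \<open>prob_good\<close>.\<close>

definition annulus :: "int^'d::finite \<Rightarrow> nat \<Rightarrow> (int^'d) set" where
  "annulus z r = cube z r - cube z (r div 2)"

lemma card_annulus: "r \<ge> 1 \<Longrightarrow> r ^ CARD('d) \<le> card (annulus (z::int^'d::finite) r)"
proof -
  assume "r \<ge> 1"
  have "card (annulus z r) = (2 * r + 1) ^ CARD('d) - (2 * (r div 2) + 1) ^ CARD('d)"
    unfolding annulus_def by (subst card_Diff_subset) (auto simp: card_cube intro: cube_mono[THEN subsetD, rotated])
  moreover have "r ^ CARD('d) + (2 * (r div 2) + 1) ^ CARD('d) \<le> r ^ CARD('d) + (r + 1) ^ CARD('d)"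
    by (intro add_left_mono power_mono) auto
  moreover have "r ^ CARD('d) + (r + 1) ^ CARD('d) \<le> (2 * r + 1) ^ CARD('d)"
    using power_superadditive[of "CARD('d)" r "r + 1"] by (simp add: Suc_leI mult_2)
  ultimately show ?thesis by linarith
qed

text \<open>Hitting times are counted from the moment a frog wakes up, so the event does not involve
  the dynamics; \<open>fill_fpt\<close> adds the wake-up times. The distance from the annulus to a
  target is at most \<open>3 * r\<close>.\<close>

definition fill :: "nat \<Rightarrow> nat \<Rightarrow> int^'d::finite \<Rightarrow> 'd sample \<Rightarrow> bool" where
  "fill K r z s \<longleftrightarrow> (\<forall>w\<in>cube z (2 * r). \<exists>v\<in>annulus z r. occ_hits s v (K * (3 * r)\<^sup>2) w)"

lemma measurable_fill [measurable]: "Measurable.pred (frog_space nu) (fill K r z)"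
  unfolding fill_def annulus_def by measurable

lemma fill_rst: "annulus z r \<subseteq> L \<Longrightarrow> fill K r z (rst L s) \<longleftrightarrow> fill K r z s"
  unfolding fill_def by (intro ball_cong bex_cong refl occ_hits_rst) auto

text \<open>For each target at least r^d sites compete, with hitting probabilities of order r^(1 -
  d), so the expected number of hits is of order r; this is the exponent. The prefactor counts the
  targets.\<close>

lemma prob_not_fill:
  assumes "pmf nu 0 < 1"
  shows "\<exists>c>0. \<exists>K\<ge>1. \<forall>r\<ge>1. \<forall>z::int^'d::finite.
     measure (frog_space nu) {s. \<not> fill K r z s} \<le> (4 * real r + 1) ^ CARD('d) * exp (- c * real r)"
proof -
  let ?d = "CARD('d)"
  let ?p = "measure (measure_pmf nu) {1..}"
  have p: "?p > 0" by (rule occupied_positive[OF assms])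
  obtain c K where c: "c > 0" and K: "K \<ge> 1"
    and hp: "\<And>r z. r \<ge> 1 \<Longrightarrow> (z::int^'d) \<in> cube 0 r \<Longrightarrow> c / real r ^ (?d - 1) \<le> hp (K * r\<^sup>2) z"
    using hp_lower_bound[where 'd='d] by metis
  define c1 where "c1 = ?p * c / 3 ^ (?d - 1)"
  have "c1 > 0" using p c by (simp add: c1_def)
  have "measure (frog_space nu) {s. \<not> fill K r z s} \<le> (4 * real r + 1) ^ ?d * exp (- c1 * real r)"
    if r: "r \<ge> 1" for r and z :: "int^'d"
  proof -
    interpret F: prob_space "frog_space nu :: 'd sample measure" by (rule prob_space_frog_space)
    let ?N = "\<lambda>w. {s. \<forall>v\<in>annulus z r. \<not> occ_hits s v (K * (3 * r)\<^sup>2) w}"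
    have "{s. \<not> fill K r z s} = (\<Union>w\<in>cube z (2 * r). ?N w)" by (auto simp: fill_def)
    then have "F.prob {s. \<not> fill K r z s} \<le> (\<Sum>w\<in>cube z (2 * r). F.prob (?N w))"
      by (simp only:) (intro F.finite_measure_subadditive_finite finite_cube, auto intro!: sets_frogI simp: annulus_def)
    also have "\<dots> \<le> (\<Sum>w\<in>cube z (2 * r). exp (- c1 * real r))"
    proof (rule sum_mono)
      fix w assume w: "w \<in> cube z (2 * r)"
      have "F.prob (?N w) \<le> exp (- (?p * (c / real (3 * r) ^ (?d - 1)) * card (annulus z r)))"
      proof (rule prob_no_hit)
        fix v assume "v \<in> annulus z r"
        then have "v \<in> cube z r" by (simp add: annulus_def)
        then have "v \<in> cube w (2 * r + r)"
          using w cube_trans[of z w "2 * r" v r] cube_sym by blast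
        then have "v - w \<in> cube 0 (3 * r)" by (subst cube_diff[symmetric]) simp
        then show "c / real (3 * r) ^ (?d - 1) \<le> hp (K * (3 * r)\<^sup>2) (v - w)"
          using r by (intro hp) auto
      qed (simp add: annulus_def)
      also have "\<dots> \<le> exp (- c1 * real r)"
      proof -
        have dd: "real r ^ ?d = real r * real r ^ (?d - 1)"
          using power_Suc[of "real r" "?d - 1"] by (simp del: power_Suc)
        have "c1 * real r = ?p * (c / real (3 * r) ^ (?d - 1)) * real r ^ ?d"
          using r by (simp add: c1_def dd power_mult_distrib)
        also have "\<dots> \<le> ?p * (c / real (3 * r) ^ (?d - 1)) * card (annulus z r)"
          using p c card_annulus[OF r, of z]
          by (intro mult_left_mono) (auto simp: of_nat_power[symmetric] simp del: of_nat_power)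
        finally show ?thesis by simp
      qed
      finally show "F.prob (?N w) \<le> exp (- c1 * real r)" .
    qed
    also have "\<dots> = (4 * real r + 1) ^ ?d * exp (- c1 * real r)" by (simp add: card_cube add.commute)
    finally show ?thesis .
  qed
  with \<open>c1 > 0\<close> K show ?thesis by blast
qed

lemma fill_fpt:
  assumes "\<And>w. w \<in> cube z r \<Longrightarrow> fpt s x w \<le> enat t" "fill K r z s" "w \<in> cube z (2 * r)"
  shows "fpt s x w \<le> enat (t + K * (3 * r)\<^sup>2)"
proof -
  obtain v where v: "v \<in> annulus z r" "occ_hits s v (K * (3 * r)\<^sup>2) w"
    using assms(2,3) by (auto simp: fill_def)
  then show ?thesis using assms(1)[of v] fpt_trans_le[of s x v t w] occ_hits_fpt[of s v] by (simp add: annulus_def)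
qed

text \<open>The times \<open>9 * K * 4 ^ j\<close> of the scales grow geometrically, so the last
  scale dominates the total.\<close>

lemma fills_fpt:
  assumes "\<And>w. w \<in> cube z (2 ^ j0) \<Longrightarrow> fpt s x w \<le> enat t"
    and "j0 \<le> J" "\<And>j. j0 \<le> j \<Longrightarrow> j < J \<Longrightarrow> fill K (2 ^ j) z s"
  shows "w \<in> cube z (2 ^ J) \<Longrightarrow> fpt s x w \<le> enat (t + 9 * K * 4 ^ J)"
  using assms(2,3)
proof (induction J arbitrary: w rule: dec_induct)
  case base
  then show ?case using assms(1)[of w] by (auto intro: order_trans)
next
  case (step J)
  have "fpt s x w \<le> enat ((t + 9 * K * 4 ^ J) + K * (3 * 2 ^ J)\<^sup>2)"
    by (rule fill_fpt[where r="2 ^ J" and z=z]) (use step in auto)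
  also have "(t + 9 * K * 4 ^ J) + K * (3 * 2 ^ J)\<^sup>2 \<le> t + 9 * K * 4 ^ Suc J"
  proof -
    have "(2 ^ J)\<^sup>2 = (4::nat) ^ J" by (simp add: power_mult[symmetric] power2_eq_square power_mult_distrib[symmetric])
    then show ?thesis by (simp add: power_mult_distrib)
  qed
  finally show ?case by simp
qed

section \<open>The initial local event and good sites\<close>

lemma covering_steps:
  "finite A \<Longrightarrow> \<exists>es. set es \<subseteq> unit_steps \<and> (\<forall>w\<in>A. \<exists>k\<le>length es. sum_list (take k es) = (w::int^'d::finite))"
proof (induction A rule: finite_induct)
  case empty show ?case by (intro exI[of _ "[]"]) simp
next
  case (insert w A)
  \<comment> \<open>The unit steps generate the lattice as a monoid, so a tour through
    \<open>A\<close> can be continued from its end point to any further point.\<close>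
  define R where "R = {w::int^'d. \<exists>es. set es \<subseteq> unit_steps \<and> sum_list es = w}"
  have R0: "0 \<in> R" unfolding R_def by (auto intro: exI[of _ "[]"])
  have Radd: "a + b \<in> R" if "a \<in> R" "b \<in> R" for a b
  proof -
    obtain xs ys where "set xs \<subseteq> unit_steps" "sum_list xs = a" "set ys \<subseteq> unit_steps" "sum_list ys = b"
      using \<open>a \<in> R\<close> \<open>b \<in> R\<close> unfolding R_def by blast
    then show ?thesis unfolding R_def by (auto intro!: exI[of _ "xs @ ys"])
  qed
  have Re: "e \<in> R" if "e \<in> unit_steps" for e unfolding R_def using that by (auto intro!: exI[of _ "[e]"])
  have axis_add: "axis i (a + b) = axis i a + axis i b" for i :: 'd and a b :: int by (simp add: axis_def vec_eq_iff)
  have Rax: "axis i a \<in> R" for i :: 'd and a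
  proof (induction a rule: int_induct[where k=0])
    case base
    have "axis i (0::int) = 0" by (simp add: axis_def vec_eq_iff)
    then show ?case using R0 by (simp only:)
  next
    case (step1 a)
    have "axis i (1::int) \<in> R" by (rule Re) (simp add: unit_steps_eq)
    then show ?case using Radd[OF step1(2)] by (simp add: axis_add)
  next
    case (step2 a)
    have "axis i (-1::int) \<in> R" by (rule Re) (simp add: unit_steps_eq)
    then show ?case using Radd[OF step2(2)] axis_add[of i a "-1"] by simp
  qed
  have "(\<Sum>i\<in>F. axis i (v $ i)) \<in> R" if "finite F" for F and v :: "int^'d"
    using that by induction (auto intro: R0 Radd Rax)
  moreover have "(\<Sum>i\<in>UNIV. axis i (v $ i)) = v" for v :: "int^'d"
    by (simp add: vec_eq_iff axis_def if_distrib cong: if_cong)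
  ultimately have Rall: "v \<in> R" for v by (metis finite)
  obtain es where es: "set es \<subseteq> unit_steps" "\<forall>w\<in>A. \<exists>k\<le>length es. sum_list (take k es) = w"
    using insert.IH by blast
  obtain fs where fs: "set fs \<subseteq> unit_steps" "sum_list fs = w - sum_list es"
    using Rall[of "w - sum_list es"] unfolding R_def by blast
  have "\<exists>k\<le>length (es @ fs). sum_list (take k (es @ fs)) = v" if "v \<in> A" for v
  proof -
    obtain k where "k \<le> length es" "sum_list (take k es) = v" using es(2) \<open>v \<in> A\<close> by blast
    then show ?thesis by (intro exI[of _ k]) simp
  qed
  moreover have "\<exists>k\<le>length (es @ fs). sum_list (take k (es @ fs)) = w"
    using fs(2) by (intro exI[of _ "length (es @ fs)"]) simp
  ultimately show ?case using es fs by (intro exI[of _ "es @ fs"]) auto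
qed

definition covers :: "'d::finite sample \<Rightarrow> int^'d \<Rightarrow> nat \<Rightarrow> nat \<Rightarrow> bool" where
  "covers s z r t \<longleftrightarrow> (\<forall>w\<in>cube z r. occ_hits s z t w)"

lemma measurable_covers [measurable]: "Measurable.pred (frog_space nu) (\<lambda>s. covers s z r t)"
  unfolding covers_def by measurable

text \<open>With positive probability the first frog of \<open>z\<close> follows a prescribed finite
  tour of the cube. The tour is fixed relative to \<open>z\<close>, which makes the bound uniform in
  \<open>z\<close>.\<close>

lemma prob_covers:
  assumes "pmf nu 0 < 1"
  shows "\<exists>q>0. \<exists>t. \<forall>z::int^'d::finite. q \<le> measure (frog_space nu) {s. covers s z r t}"
proof -
  let ?p = "measure (measure_pmf nu) {1..}"
  have p: "?p > 0" by (rule occupied_positive[OF assms])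
  obtain es where es: "set es \<subseteq> unit_steps" "\<forall>w\<in>cube 0 r. \<exists>k\<le>length es. sum_list (take k es) = (w::int^'d)"
    using covering_steps[OF finite_cube] by blast
  define n where "n = length es"
  define E where "E = {s::nat \<Rightarrow> int^'d. \<forall>k<n. s k = es ! k}"
  have E: "E \<in> sets step_seq"
  proof -
    have "{s \<in> space step_seq. \<forall>k<n. s k = es ! k} \<in> sets step_seq" by measurable
    then show ?thesis by (simp add: E_def)
  qed
  interpret S: product_prob_space "\<lambda>_::nat. measure_pmf (step_pmf :: (int^'d) pmf)" UNIV by unfold_locales
  have "E = prod_emb UNIV (\<lambda>_. measure_pmf step_pmf) {..<n} (\<Pi>\<^sub>E k\<in>{..<n}. {es ! k})"
    by (auto simp: E_def prod_emb_def space_PiM PiE_def Pi_def)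
  then have "measure step_seq E = (\<Prod>k<n. measure (measure_pmf step_pmf) {es ! k})"
    unfolding step_seq_def by (simp only:) (rule S.measure_PiM_emb; simp)
  also have "\<dots> > 0"
  proof (rule prod_pos)
    fix k assume "k \<in> {..<n}"
    then have "es ! k \<in> unit_steps" using es(1) by (auto simp: n_def)
    then show "0 < measure (measure_pmf step_pmf) {es ! k}"
      by (simp add: measure_pmf_single step_pmf_def card_gt_0_iff)
  qed
  finally have SE: "measure step_seq E > 0" .
  have "?p * measure step_seq E \<le> measure (frog_space nu) {s. covers s z r n}" for z :: "int^'d"
  proof -
    interpret F: prob_space "frog_space nu :: 'd sample measure" by (rule prob_space_frog_space)
    have "{s. fst s z \<in> {1..} \<and> (\<lambda>k. snd s (z, 1, k)) \<in> E} \<subseteq> {s. covers s z r n}"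
    proof
      fix s :: "'d sample" assume "s \<in> {s. fst s z \<in> {1..} \<and> (\<lambda>k. snd s (z, 1, k)) \<in> E}"
      then have h: "fst s z \<in> {1..}" "(\<lambda>k. snd s (z, 1, k)) \<in> E" by auto
      have w: "walk s z 1 k = z + sum_list (take k es)" if "k \<le> n" for k
        using that
      proof (induction k)
        case (Suc k)
        then have "snd s (z, 1, k) = es ! k" using h(2) by (auto simp: E_def)
        with Suc show ?case by (simp add: walk_Suc take_Suc_conv_app_nth n_def add.assoc)
      qed simp
      have "occ_hits s z n v" if "v \<in> cube z r" for v
      proof -
        have "v - z \<in> cube 0 r" using that cube_diff by blast
        then obtain k where "k \<le> n" "sum_list (take k es) = v - z" using es(2) by (auto simp: n_def)
        then show ?thesis using h(1) w by (auto simp: occ_hits_def intro!: exI[of _ k])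
      qed
      then show "s \<in> {s. covers s z r n}" by (simp add: covers_def)
    qed
    then have "F.prob {s. fst s z \<in> {1..} \<and> (\<lambda>k. snd s (z, 1, k)) \<in> E} \<le> F.prob {s. covers s z r n}"
      by (rule F.finite_measure_mono) (rule sets_frogI, measurable)
    then show ?thesis unfolding prob_frog[OF E] .
  qed
  moreover have "?p * measure step_seq E > 0" using p SE by simp
  ultimately show ?thesis by blast
qed

lemma prob_not_fill_exp:
  assumes "pmf nu 0 < 1"
  shows "\<exists>C>0. \<exists>c>0. \<exists>K\<ge>1. \<forall>r\<ge>1. \<forall>z::int^'d::finite.
     measure (frog_space nu) {s. \<not> fill K r z s} \<le> C * exp (- c * real r)"
proof -
  let ?d = "CARD('d)"
  obtain c K where c: "c > 0" and K: "K \<ge> 1"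
    and b: "\<And>r z. r \<ge> 1 \<Longrightarrow> measure (frog_space nu) {s. \<not> fill K r (z::int^'d) s} \<le> (4 * real r + 1) ^ ?d * exp (- c * real r)"
    using prob_not_fill[OF assms, where 'd='d] by metis
  obtain C where C: "C > 0" "\<And>x. x \<ge> 0 \<Longrightarrow> x ^ ?d * exp (- c * x) \<le> C * exp (- (c / 2) * x)"
    using poly_exp_bound[OF c] by metis
  have "measure (frog_space nu) {s. \<not> fill K r (z::int^'d) s} \<le> (5 ^ ?d * C) * exp (- (c / 2) * real r)"
    if r: "r \<ge> 1" for r z
  proof -
    have "(4 * real r + 1) ^ ?d \<le> (5 * real r) ^ ?d" using r by (intro power_mono) auto
    then have "(4 * real r + 1) ^ ?d * exp (- c * real r) \<le> 5 ^ ?d * (real r ^ ?d * exp (- c * real r))"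
      by (simp add: power_mult_distrib)
    also have "\<dots> \<le> 5 ^ ?d * (C * exp (- (c / 2) * real r))" by (intro mult_left_mono C(2)) auto
    finally show ?thesis using b[OF r, of z] by simp
  qed
  moreover have "5 ^ ?d * C > 0" "c / 2 > 0" using C c by auto
  ultimately show ?thesis using K by blast
qed

text \<open>For j0 <= J, reaching such a site means filling the cube of radius 2^J around it in a
  further time of order 4^J. Stopping at scale \<open>J\<close> confines the event to that cube
  (\<open>good_rst\<close>), so that well separated sites are independent.\<close>

definition good :: "nat \<Rightarrow> nat \<Rightarrow> nat \<Rightarrow> nat \<Rightarrow> int^'d::finite \<Rightarrow> 'd sample \<Rightarrow> bool" where
  "good j0 t K J z s \<longleftrightarrow> covers s z (2 ^ j0) t \<and> (\<forall>j\<in>{j0..<J}. fill K (2 ^ j) z s)"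

lemma measurable_good [measurable]: "Measurable.pred (frog_space nu) (good j0 t K J z)"
  unfolding good_def by measurable

lemma covers_rst: "z \<in> L \<Longrightarrow> covers (rst L s) z r t \<longleftrightarrow> covers s z r t"
  by (simp add: covers_def occ_hits_rst)

lemma good_rst: "cube z (2 ^ J) \<subseteq> L \<Longrightarrow> good j0 t K J z (rst L s) \<longleftrightarrow> good j0 t K J z s"
proof -
  assume L: "cube z (2 ^ J) \<subseteq> L"
  have "annulus z (2 ^ j) \<subseteq> L" if "j < J" for j
  proof -
    have "annulus z (2 ^ j) \<subseteq> cube z (2 ^ j)" by (auto simp: annulus_def)
    also have "\<dots> \<subseteq> cube z (2 ^ J)" using that by (intro cube_mono power_increasing) auto
    finally show ?thesis using L by blast
  qed
  moreover have "z \<in> L" using L cube_self by blast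
  ultimately show ?thesis unfolding good_def by (auto simp: covers_rst fill_rst)
qed

text \<open>The failure probabilities of the scales are summable, so from a suitable
  \<open>j0\<close> on all fills succeed with probability at least 1/2, whatever \<open>J\<close>.
  The local event at \<open>z\<close> is independent of them because no annulus contains
  \<open>z\<close>. It matters that \<open>q\<close> is uniform in \<open>J\<close>.\<close>

lemma prob_good:
  assumes nu: "pmf nu 0 < 1" and C: "C > 0" "c > 0"
    and b: "\<And>r z. r \<ge> 1 \<Longrightarrow> measure (frog_space nu) {s. \<not> fill K r (z::int^'d::finite) s} \<le> C * exp (- c * real r)"
  shows "\<exists>q>0. \<exists>j0 t. \<forall>J. \<forall>z::int^'d. q \<le> measure (frog_space nu) {s. good j0 t K J z s}"
proof -
  interpret F: prob_space "frog_space nu :: 'd sample measure" by (rule prob_space_frog_space)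
  have sm: "summable (\<lambda>j. C * exp (- c) ^ j)"
    using C by (intro summable_mult summable_geometric) simp
  obtain j0 where j0: "norm (\<Sum>i. C * exp (- c) ^ (i + j0)) < 1 / 2"
    using suminf_exist_split[OF _ sm, of "1 / 2"] by auto
  obtain q t where q: "q > 0" "\<And>z::int^'d. q \<le> F.prob {s. covers s z (2 ^ j0) t}"
    using prob_covers[OF nu, where r="2 ^ j0" and 'd='d] by metis
  have "q / 2 \<le> F.prob {s. good j0 t K J z s}" for J and z :: "int^'d"
  proof -
    let ?A = "{s. covers s z (2 ^ j0) t}" and ?B = "{s. \<forall>j\<in>{j0..<J}. fill K (2 ^ j) z s}"
    have mA: "?A \<in> F.events" and mB: "?B \<in> F.events" by (rule sets_frogI, measurable)+
    have "F.prob (?A \<inter> ?B) = F.prob ?A * F.prob ?B"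
    proof (rule prob_Int2_rst[where K="{z}" and L="- {z}"])
      have "annulus z r \<subseteq> - {z}" for r by (auto simp: annulus_def)
      then show "rst (- {z}) s \<in> ?B \<longleftrightarrow> s \<in> ?B" for s by (simp add: fill_rst)
    qed (use mA mB in \<open>auto simp: covers_rst\<close>)
    moreover have "F.prob ?B \<ge> 1 / 2"
    proof -
      have "F.prob (space (frog_space nu) - ?B) \<le> (\<Sum>j\<in>{j0..<J}. F.prob {s. \<not> fill K (2 ^ j) z s})"
      proof -
        have "space (frog_space nu) - ?B = (\<Union>j\<in>{j0..<J}. {s. \<not> fill K (2 ^ j) z s})" by auto
        then show ?thesis
          by (simp only:) (intro F.finite_measure_subadditive_finite, auto intro!: sets_frogI)
      qed
      also have "\<dots> \<le> (\<Sum>j\<in>{j0..<J}. C * exp (- c) ^ j)"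
      proof (rule sum_mono)
        fix j assume "j \<in> {j0..<J}"
        have "F.prob {s. \<not> fill K (2 ^ j) z s} \<le> C * exp (- c * real (2 ^ j))" by (rule b) simp
        also have "\<dots> \<le> C * exp (- c * real j)"
        proof -
          have "real j \<le> 2 ^ j" using less_exp[of j] by (metis less_imp_le of_nat_le_iff of_nat_numeral of_nat_power)
          then show ?thesis using C by simp
        qed
        also have "\<dots> = C * exp (- c) ^ j" by (simp add: exp_of_nat_mult[symmetric] mult.commute)
        finally show "F.prob {s. \<not> fill K (2 ^ j) z s} \<le> C * exp (- c) ^ j" .
      qed
      also have "\<dots> \<le> 1 / 2"
      proof -
        have "(\<Sum>j\<in>{j0..<J}. C * exp (- c) ^ j) = (\<Sum>i<J - j0. C * exp (- c) ^ (i + j0))"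
          by (rule sum.reindex_bij_witness[of _ "\<lambda>i. i + j0" "\<lambda>j. j - j0"]) auto
        also have "\<dots> \<le> (\<Sum>i. C * exp (- c) ^ (i + j0))"
          using sm C by (intro sum_le_suminf) (auto simp: summable_iff_shift[of "\<lambda>j. C * exp (- c) ^ j" j0])
        finally show ?thesis using j0 by auto
      qed
      finally show ?thesis using F.prob_compl[OF mB] by simp
    qed
    moreover have "{s. good j0 t K J z s} = ?A \<inter> ?B" by (auto simp: good_def)
    ultimately show ?thesis using q mult_mono[of q "F.prob ?A" "1 / 2" "F.prob ?B"] by simp
  qed
  then show ?thesis using q(1) by (metis half_gt_zero)
qed

section \<open>Independent attempts along the trace of one frog\<close>

definition trace :: "nat \<Rightarrow> int^'d::finite \<Rightarrow> 'd sample \<Rightarrow> (int^'d) set" where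
  "trace T x s = walk s x 1 ` {..T}"

definition level :: "int^'d::finite \<Rightarrow> nat \<Rightarrow> int^'d \<Rightarrow> bool" where
  "level x n w \<longleftrightarrow> w \<in> cube x n \<and> (\<exists>i. \<bar>w $ i - x $ i\<bar> = int n)"

text \<open>Unit steps cannot jump over a sphere: the first site outside
  \<open>cube x (n - 1)\<close> is at sup distance exactly \<open>n\<close>.\<close>

lemma trace_level:
  assumes u: "unit_sample s" and k: "k \<le> T" "walk s x 1 k \<notin> cube x M" and n: "1 \<le> n" "n \<le> M"
  shows "\<exists>w\<in>trace T x s. level x n w"
proof -
  let ?P = "\<lambda>k. walk s x 1 k \<notin> cube x (n - 1)"
  define k' where "k' = (LEAST k. ?P k)"
  have "cube x (n - 1) \<subseteq> cube x M" using n by (intro cube_mono) simp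
  then have Pk: "?P k" using k by blast
  then have P: "?P k'" unfolding k'_def by (rule LeastI)
  have "k' \<le> k" unfolding k'_def by (rule Least_le[of ?P, OF Pk])
  have "k' \<noteq> 0" using P by (metis cube_self walk_0)
  then obtain k'' where k'': "k' = Suc k''" by (cases k') auto
  have "\<not> ?P k''" using not_less_Least[of k'' ?P] k'' by (simp add: k'_def)
  then have "walk s x 1 k'' \<in> cube x (n - 1)" by simp
  moreover have "walk s x 1 k' \<in> cube (walk s x 1 k'') 1"
    unfolding k'' walk_Suc by (rule unit_step_cube) (use u in \<open>simp add: unit_sample_def del: split_paired_All\<close>)
  ultimately have c: "walk s x 1 k' \<in> cube x n" using cube_trans[of "walk s x 1 k''" x "n - 1" "walk s x 1 k'" 1] n by simp
  obtain i where i: "\<not> \<bar>walk s x 1 k' $ i - x $ i\<bar> \<le> int (n - 1)" using P by (auto simp: cube_def)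
  moreover have "\<bar>walk s x 1 k' $ i - x $ i\<bar> \<le> int n" using c by (simp add: cube_def)
  ultimately have "\<bar>walk s x 1 k' $ i - x $ i\<bar> = int n" using n by linarith
  with c have "level x n (walk s x 1 k')" by (auto simp: level_def)
  then show ?thesis using \<open>k' \<le> k\<close> k(1) by (auto simp: trace_def)
qed

lemma level_disjoint:
  assumes "level x (a * S) w" "level x (b * S) v" "a < b" "2 * r < S"
  shows "cube w r \<inter> cube v r = {}"
proof (rule ccontr)
  assume "cube w r \<inter> cube v r \<noteq> {}"
  then obtain y where y: "y \<in> cube w r" "y \<in> cube v r" by blast
  obtain i where i: "\<bar>v $ i - x $ i\<bar> = int (b * S)" using assms(2) by (auto simp: level_def)
  have "\<bar>w $ i - x $ i\<bar> \<le> int (a * S)" using assms(1) by (auto simp: level_def cube_def)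
  moreover have "\<bar>y $ i - w $ i\<bar> \<le> int r" "\<bar>y $ i - v $ i\<bar> \<le> int r" using y by (auto simp: cube_def)
  ultimately have "int (b * S) \<le> int (a * S) + 2 * int r" using i by linarith
  moreover have "Suc a * S \<le> b * S" using assms(3) by (intro mult_right_mono) auto
  then have "int S + int (a * S) \<le> int (b * S)" by (simp only: mult_Suc of_nat_add[symmetric] of_nat_le_iff)
  ultimately show False using assms(4) by linarith
qed

text \<open>The event is decomposed by the value \<open>A\<close> of the trace, which is determined
  by the frogs at \<open>x\<close>. Given \<open>A\<close>, one site of \<open>A\<close> is selected
  on each of \<open>m\<close> spheres. Their spacing 4 * 2^J keeps the cubes around these sites
  disjoint, so the failures are independent of the trace and of each other.\<close>

lemma prob_attempts:
  fixes x :: "int^'d::finite"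
  assumes q: "\<And>z::int^'d. q \<le> measure (frog_space nu) {s. good j0 t K J z s}"
  shows "measure (frog_space nu) {s. unit_sample s \<and> (\<exists>k\<le>T. walk s x 1 k \<notin> cube x (m * (4 * 2 ^ J)))
      \<and> (\<forall>w\<in>trace T x s \<inter> cube x (m * (4 * 2 ^ J)). \<not> good j0 t K J w s)} \<le> (1 - q) ^ m"
proof -
  interpret F: prob_space "frog_space nu :: 'd sample measure" by (rule prob_space_frog_space)
  let ?S = "4 * 2 ^ J :: nat"
  let ?Ev = "{s. unit_sample s \<and> (\<exists>k\<le>T. walk s x 1 k \<notin> cube x (m * ?S))
      \<and> (\<forall>w\<in>trace T x s \<inter> cube x (m * ?S). \<not> good j0 t K J w s)}"
  define AA where "AA = {A. A \<subseteq> cube x T \<and> (\<forall>n\<in>{1..m}. \<exists>w\<in>A. level x (n * ?S) w)}"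
  have fAA: "finite AA" unfolding AA_def by (rule finite_subset[of _ "Pow (cube x T)"]) auto
  \<comment> \<open>Chosen from the set \<open>A\<close> and not from the sample: for fixed
    \<open>A\<close> the sites are deterministic and independence applies.\<close>
  define zc where "zc A n = (SOME w. w \<in> A \<and> level x (n * ?S) w)" for A n
  have zc: "zc A n \<in> A \<and> level x (n * ?S) (zc A n)" if "A \<in> AA" "n \<in> {1..m}" for A n
    unfolding zc_def by (rule someI_ex) (use that in \<open>auto simp: AA_def\<close>)
  define TA where "TA A = {s. trace T x s = A}" for A
  define BA where "BA A = (\<Inter>n\<in>{1..m}. {s. \<not> good j0 t K J (zc A n) s})" for A
  have mT: "TA A \<in> F.events" if "A \<in> AA" for A
  proof -
    have "finite A" using that finite_subset[OF _ finite_cube] by (auto simp: AA_def)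
    have "trace T x s = A \<longleftrightarrow> (\<forall>k\<le>T. walk s x 1 k \<in> A) \<and> (\<forall>w\<in>A. \<exists>k\<le>T. walk s x 1 k = w)" for s
      by (auto simp: trace_def)
    moreover have "Measurable.pred (frog_space nu) (\<lambda>s. (\<forall>k\<le>T. walk s x 1 k \<in> A) \<and> (\<forall>w\<in>A. \<exists>k\<le>T. walk s x 1 k = w))"
      using \<open>finite A\<close> by measurable
    ultimately show ?thesis unfolding TA_def by (simp only: sets_frogI)
  qed
  have mG: "{s. \<not> good j0 t K J z s} \<in> F.events" for z by (rule sets_frogI) measurable
  have mB: "BA A \<in> F.events" for A
  proof -
    have "{s. \<forall>n\<in>{1..m}. \<not> good j0 t K J (zc A n) s} \<in> F.events" by (rule sets_frogI) measurable
    moreover have "{s. \<forall>n\<in>{1..m}. \<not> good j0 t K J (zc A n) s} = BA A" by (auto simp: BA_def)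
    ultimately show ?thesis by simp
  qed
  have "?Ev \<subseteq> (\<Union>A\<in>AA. TA A \<inter> BA A)"
  proof
    fix s assume s: "s \<in> ?Ev"
    define A where "A = trace T x s"
    have A: "A \<in> AA"
      unfolding AA_def
    proof (intro CollectI conjI ballI)
      show "A \<subseteq> cube x T" using s walk_in_cube[of s x 1] cube_mono by (fastforce simp: A_def trace_def)
      fix n assume n: "n \<in> {1..m}"
      from s obtain k where k: "k \<le> T" "walk s x 1 k \<notin> cube x (m * ?S)" by blast
      show "\<exists>w\<in>A. level x (n * ?S) w"
        unfolding A_def by (rule trace_level[OF _ k]) (use s n in auto)
    qed
    moreover have "s \<in> TA A" by (simp add: TA_def A_def)
    moreover have "s \<in> BA A"
    proof -
      have "zc A n \<in> A \<inter> cube x (m * ?S)" if n: "n \<in> {1..m}" for n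
      proof -
        have "cube x (n * ?S) \<subseteq> cube x (m * ?S)" using n by (intro cube_mono) auto
        then show ?thesis using zc[OF A n] by (auto simp: level_def)
      qed
      then show ?thesis using s by (simp add: BA_def A_def)
    qed
    ultimately show "s \<in> (\<Union>A\<in>AA. TA A \<inter> BA A)" by blast
  qed
  then have "F.prob ?Ev \<le> F.prob (\<Union>A\<in>AA. TA A \<inter> BA A)"
    using fAA mT mB by (intro F.finite_measure_mono sets.finite_UN sets.Int) auto
  also have "\<dots> \<le> (\<Sum>A\<in>AA. F.prob (TA A \<inter> BA A))"
    using fAA mT mB by (intro F.finite_measure_subadditive_finite) auto
  also have "\<dots> \<le> (\<Sum>A\<in>AA. F.prob (TA A) * (1 - q) ^ m)"
  proof (rule sum_mono)
    fix A assume A: "A \<in> AA"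
    \<comment> \<open>The starting point counts as level 0, so the chosen cubes avoid it. This
      separates \<open>BA A\<close> from the frog that makes the trace.\<close>
    have sub: "cube (zc A n) (2 ^ J) \<subseteq> - {x}" if n: "n \<in> {1..m}" for n
    proof -
      have "level x (0 * ?S) x" by (simp add: level_def)
      moreover have "level x (n * ?S) (zc A n)" using zc[OF A n] by blast
      ultimately have "cube x (2 ^ J) \<inter> cube (zc A n) (2 ^ J) = {}"
        by (rule level_disjoint) (use n in auto)
      then show ?thesis using cube_self by blast
    qed
    have "F.prob (TA A \<inter> BA A) = F.prob (TA A) * F.prob (BA A)"
    proof (rule prob_Int2_rst[where K="{x}" and L="- {x}"])
      show "rst {x} s \<in> TA A \<longleftrightarrow> s \<in> TA A" for s by (simp add: TA_def trace_def walk_rst)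
      show "rst (- {x}) s \<in> BA A \<longleftrightarrow> s \<in> BA A" for s
        using good_rst[OF sub] by (simp add: BA_def)
    qed (use mT[OF A] mB in auto)
    moreover have "F.prob (BA A) = (\<Prod>n\<in>{1..m}. F.prob {s. \<not> good j0 t K J (zc A n) s})"
      unfolding BA_def
    proof (rule prob_Int_rst[where K="\<lambda>n. cube (zc A n) (2 ^ J)"])
      have *: "cube (zc A a) (2 ^ J) \<inter> cube (zc A b) (2 ^ J) = {}" if "a \<in> {1..m}" "b \<in> {1..m}" "a < b" for a b
        using zc[OF A that(1)] zc[OF A that(2)] that(3) by (intro level_disjoint[where x=x and S="?S"]) auto
      show "disjoint_family_on (\<lambda>n. cube (zc A n) (2 ^ J)) {1..m}"
        unfolding disjoint_family_on_def
      proof (intro ballI impI)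
        fix a b assume "a \<in> {1..m}" "b \<in> {1..m}" "a \<noteq> b"
        then show "cube (zc A a) (2 ^ J) \<inter> cube (zc A b) (2 ^ J) = {}"
          using *[of a b] *[of b a] by (cases "a < b") (auto simp: Int_commute)
      qed
      show "rst (cube (zc A n) (2 ^ J)) s \<in> {s. \<not> good j0 t K J (zc A n) s} \<longleftrightarrow> s \<in> {s. \<not> good j0 t K J (zc A n) s}" for n s
        using good_rst[OF order_refl] by simp
    qed (use mG in auto)
    moreover have "\<dots> \<le> (\<Prod>n\<in>{1..m}. 1 - q)"
    proof (intro prod_mono conjI)
      fix n
      have "{s. good j0 t K J (zc A n) s} \<in> F.events" by (rule sets_frogI) measurable
      then have "F.prob {s. \<not> good j0 t K J (zc A n) s} = 1 - F.prob {s. good j0 t K J (zc A n) s}"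
        using F.prob_compl[of "{s. good j0 t K J (zc A n) s}"] by (simp add: Collect_neg_eq Compl_eq_Diff_UNIV)
      then show "F.prob {s. \<not> good j0 t K J (zc A n) s} \<le> 1 - q" using q[of "zc A n"] by simp
    qed simp
    ultimately show "F.prob (TA A \<inter> BA A) \<le> F.prob (TA A) * (1 - q) ^ m"
      by (simp add: mult_left_mono)
  qed
  also have "\<dots> = F.prob (\<Union>A\<in>AA. TA A) * (1 - q) ^ m"
    unfolding sum_distrib_right[symmetric]
    using fAA mT by (subst F.finite_measure_finite_Union[symmetric]) (auto simp: disjoint_family_on_def TA_def)
  also have "\<dots> \<le> 1 * (1 - q) ^ m"
    using order_trans[OF q F.prob_le_1] by (intro mult_right_mono) auto
  finally show ?thesis by simp
qed

lemma prob_walk_confined: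
  fixes x :: "int^'d::finite"
  shows "measure (frog_space nu) {s. \<forall>k\<le>T. walk s x l k \<in> cube x M} = confine M T (0::int^'d::finite)"
proof -
  let ?E = "{s. \<forall>k\<le>T. (0::int^'d) + (\<Sum>j<k. s j) \<in> cube 0 M}"
  have m: "?E \<in> sets step_seq"
  proof -
    have "{s \<in> space step_seq. \<forall>k\<le>T. (0::int^'d) + (\<Sum>j<k. s j) \<in> cube 0 M} \<in> sets step_seq" by measurable
    then show ?thesis by simp
  qed
  have "{s. \<forall>k\<le>T. walk s x l k \<in> cube x M} = {s. fst s x \<in> UNIV \<and> (\<lambda>k. snd s (x, l, k)) \<in> ?E}"
    by (subst cube_diff) (simp add: walk_def)
  then show ?thesis using prob_frog[OF m, of nu x UNIV l] by (simp add: prob_confine[of T 0 M, simplified])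
qed

lemma measurable_unit_sample [measurable]: "Measurable.pred (frog_space nu) unit_sample"
  unfolding unit_sample_def by measurable

lemma prob_not_unit_sample: "measure (frog_space nu) {s. \<not> unit_sample s} = 0"
proof -
  interpret F: prob_space "frog_space nu :: 'a sample measure" by (rule prob_space_frog_space)
  have "F.prob {s. unit_sample s} = 1"
    using AE_unit_sample F.prob_eq_1[OF sets_frogI[OF measurable_unit_sample]] by simp
  then show ?thesis using F.prob_compl[OF sets_frogI[OF measurable_unit_sample]]
    by (simp add: Collect_neg_eq Compl_eq_Diff_UNIV)
qed

section \<open>Tail of the passage time\<close>

lemma time_bound1:
  fixes l :: nat
  assumes "l \<ge> 1"
  shows "l * (2 * d * (2 * (4 * l\<^sup>2) + 1))\<^sup>2 \<le> 324 * d\<^sup>2 * l ^ 5"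
proof -
  have "1 \<le> l\<^sup>2" using assms by (simp add: one_le_power)
  then have "2 * d * (2 * (4 * l\<^sup>2) + 1) \<le> 2 * d * (9 * l\<^sup>2)" by (intro mult_left_mono) linarith+
  then have "(2 * d * (2 * (4 * l\<^sup>2) + 1))\<^sup>2 \<le> (2 * d * (9 * l\<^sup>2))\<^sup>2" by (rule power_mono) simp
  then have "l * (2 * d * (2 * (4 * l\<^sup>2) + 1))\<^sup>2 \<le> l * (2 * d * (9 * l\<^sup>2))\<^sup>2" by (rule mult_left_mono) simp
  also have "\<dots> = 324 * d\<^sup>2 * (l * (l\<^sup>2)\<^sup>2)" by (simp add: power_mult_distrib)
  also have "l * (l\<^sup>2)\<^sup>2 = l ^ 5" by (simp add: power_mult[symmetric] power_Suc[symmetric] del: power_Suc)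
  finally show ?thesis .
qed

lemma time_bound2:
  fixes l :: nat
  assumes "l \<ge> 1" "2 ^ J = 8 * l\<^sup>2"
  shows "4 ^ J \<le> 64 * l ^ 5"
proof -
  have "(4::nat) ^ J = (2 ^ J)\<^sup>2" by (simp add: power2_eq_square power_mult_distrib[symmetric])
  also have "\<dots> = 64 * l ^ 4" unfolding assms(2) by (simp add: power_mult_distrib power_mult[symmetric])
  also have "\<dots> \<le> 64 * l ^ 5" using assms(1) by (intro mult_left_mono power_increasing) auto
  finally show ?thesis .
qed

text \<open>At scales from \<open>J\<close> on, a fill fails with probability of order exp (-b l) at
  most, l = 2^J, which allows a union bound over all sites of a cube of radius of order l^2. Smaller
  scales fail too often for this and are left to the repeated attempts of
  \<open>prob_attempts\<close>. A confined walk and l failed attempts are exponentially unlikely in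
  l as well.\<close>

lemma tail_dyadic:
  assumes nu: "pmf nu 0 < 1"
  shows "\<exists>C::nat. \<exists>A>0. \<exists>c>0. \<forall>J. \<forall>x::int^'d::finite. \<forall>y\<in>cube x (2 ^ J).
    measure (frog_space nu) {s. 1 \<le> fst s x \<and> \<not> fpt s x y \<le> enat (C * (2 ^ J) ^ 5)} \<le> A * exp (- c * 2 ^ J)"
proof -
  interpret F: prob_space "frog_space nu :: 'd sample measure" by (rule prob_space_frog_space)
  let ?d = "CARD('d)"
  obtain B b K where B: "B > 0" "b > 0"
    and fillb: "\<And>r z. r \<ge> 1 \<Longrightarrow> F.prob {s. \<not> fill K r (z::int^'d) s} \<le> B * exp (- b * real r)"
    using prob_not_fill_exp[OF nu, where 'd='d] by metis
  obtain q j0 t where q: "q > 0" and goodq: "\<And>J z::int^'d. q \<le> F.prob {s. good j0 t K J z s}"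
    using prob_good[OF nu B fillb] by metis
  have q1: "q \<le> 1" using order_trans[OF goodq F.prob_le_1] by simp
  obtain B2 where B2: "B2 > 0" "\<And>x. x \<ge> 0 \<Longrightarrow> x ^ (2 * ?d + 1) * exp (- b * x) \<le> B2 * exp (- (b / 2) * x)"
    using poly_exp_bound[OF B(2), of "2 * ?d + 1"] by metis
  define C where "C = 324 * ?d\<^sup>2 + t + 576 * K"
  define A0 where "A0 = 1 + 1 + 9 ^ ?d * 4 * B * B2"
  define c where "c = min (ln 2) (min q (b / 2))"
  have c: "c > 0" "c \<le> ln 2" "c \<le> q" "c \<le> b / 2" using q B by (auto simp: c_def)
  have A0: "A0 > 0" using B B2 by (simp add: A0_def add_pos_pos)
  have main: "F.prob {s. 1 \<le> fst s x \<and> \<not> fpt s x y \<le> enat (C * (2 ^ J) ^ 5)} \<le> A0 * exp (- c * 2 ^ J)"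
    if J: "j0 \<le> J" and y: "y \<in> cube x (2 ^ J)" for J and x y :: "int^'d"
  proof -
    define l where "l = (2::nat) ^ J"
    have l1: "l \<ge> 1" by (simp add: l_def)
    \<comment> \<open>The radius that accommodates \<open>l\<close> spheres at spacing 4 * 2^J,
      hence \<open>l\<close> attempts.\<close>
    define M where "M = l * (4 * 2 ^ J)"
    have M: "M = 4 * l\<^sup>2" by (simp add: M_def l_def power2_eq_square)
    \<comment> \<open>This is \<open>l\<close> periods, each of which confines the walk to
      \<open>cube x M\<close> with probability at most 1/2; the total is of order l M^2, that is
      l^5.\<close>
    define T where "T = l * (2 * ?d * (2 * M + 1))\<^sup>2"
    \<comment> \<open>The radius 2^J' = 8 l^2 is at least M + 2^J, so from any site of
      \<open>cube x M\<close> the filled cube contains \<open>y\<close>.\<close>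
    define J' where "J' = 2 * J + 3"
    have J': "2 ^ J' = 8 * l\<^sup>2" by (simp add: J'_def l_def power_add power_mult power2_eq_square power_mult_distrib[symmetric])
    let ?N = "{s. \<not> unit_sample s}"
    let ?Cf = "{s. \<forall>k\<le>T. walk s x 1 k \<in> cube x M}"
    let ?At = "{s. unit_sample s \<and> (\<exists>k\<le>T. walk s x 1 k \<notin> cube x M) \<and> (\<forall>w\<in>trace T x s \<inter> cube x M. \<not> good j0 t K J w s)}"
    let ?I = "cube x M \<times> {J..<J'}"
    let ?Fl = "\<Union>zj\<in>?I. {s. \<not> fill K (2 ^ snd zj) (fst zj) s}"
    have sub: "{s. 1 \<le> fst s x \<and> \<not> fpt s x y \<le> enat (C * (2 ^ J) ^ 5)} \<subseteq> ?N \<union> ?Cf \<union> ?At \<union> ?Fl"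
    proof (rule ccontr)
      assume "\<not> ?thesis"
      then obtain s where s: "1 \<le> fst s x" "\<not> fpt s x y \<le> enat (C * (2 ^ J) ^ 5)"
        and u: "s \<notin> ?N" "s \<notin> ?Cf" "s \<notin> ?At" "s \<notin> ?Fl" by blast
      then obtain w where w: "w \<in> trace T x s" "w \<in> cube x M" "good j0 t K J w s" by blast
      from w(1) obtain k where k: "k \<le> T" "walk s x 1 k = w" by (auto simp: trace_def)
      have "tau s x w \<le> enat T" unfolding tau_le_iff using k s(1) by (auto intro!: exI[of _ k] bexI[of _ 1])
      then have xw: "fpt s x w \<le> enat T" using fpt_le_tau order_trans by blast
      have base: "fpt s x v \<le> enat (T + t)" if "v \<in> cube w (2 ^ j0)" for v
      proof -
        have "occ_hits s w t v" using w(3) that by (simp add: good_def covers_def)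
        then show ?thesis by (intro fpt_trans_le[OF xw] occ_hits_fpt)
      qed
      have "fill K (2 ^ j) w s" if "j0 \<le> j" "j < J'" for j
      proof (cases "j < J")
        case True then show ?thesis using w(3) that by (auto simp: good_def)
      next
        case False
        then have "(w, j) \<in> ?I" using w(2) that by auto
        with u(4) show ?thesis by fastforce
      qed
      then have all: "fpt s x v \<le> enat (T + t + 9 * K * 4 ^ J')" if "v \<in> cube w (2 ^ J')" for v
        using fills_fpt[of w j0 s x "T + t" J' K v] base that J by (auto simp: J'_def)
      have "y \<in> cube w (M + 2 ^ J)"
        using cube_trans[of x w M y "2 ^ J"] w(2) y cube_sym by blast
      moreover have "M + 2 ^ J \<le> 2 ^ J'"
        using l1 unfolding M J' l_def[symmetric] by (simp add: power2_eq_square)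
      ultimately have "y \<in> cube w (2 ^ J')" using cube_mono by blast
      then have f: "fpt s x y \<le> enat (T + t + 9 * K * 4 ^ J')" by (rule all)
      have "T + t + 9 * K * 4 ^ J' \<le> C * l ^ 5"
      proof -
        have "T \<le> 324 * ?d\<^sup>2 * l ^ 5" unfolding T_def M by (rule time_bound1[OF l1])
        moreover have "t * 1 \<le> t * l ^ 5" using l1 by (intro mult_left_mono) auto
        moreover have "9 * K * 4 ^ J' \<le> 576 * K * l ^ 5"
          using mult_left_mono[OF time_bound2[OF l1 J'], of "9 * K"] by simp
        ultimately show ?thesis unfolding C_def add_mult_distrib by linarith
      qed
      then have "fpt s x y \<le> enat (C * l ^ 5)" using f order_trans enat_ord_simps(1) by blast
      then show False using s(2) by (simp add: l_def)
    qed
    have mN: "?N \<in> F.events" by (rule sets_frogI) measurable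
    have mC: "?Cf \<in> F.events" by (rule sets_frogI) measurable
    have mFl: "{s. \<not> fill K (2 ^ snd zj) (fst zj) s} \<in> F.events" for zj by (rule sets_frogI) measurable
    have mA: "?At \<in> F.events"
    proof -
      have "{s. unit_sample s \<and> (\<exists>k\<le>T. walk s x 1 k \<notin> cube x M)
          \<and> (\<forall>k\<le>T. \<forall>w\<in>cube x M. walk s x 1 k = w \<longrightarrow> \<not> good j0 t K J w s)} \<in> F.events"
        by (rule sets_frogI) measurable
      moreover have "?At = {s. unit_sample s \<and> (\<exists>k\<le>T. walk s x 1 k \<notin> cube x M)
          \<and> (\<forall>k\<le>T. \<forall>w\<in>cube x M. walk s x 1 k = w \<longrightarrow> \<not> good j0 t K J w s)}"
        unfolding trace_def by blast
      ultimately show ?thesis by simp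
    qed
    have mF: "?Fl \<in> F.events" using mFl by (intro sets.finite_UN) auto
    have "F.prob {s. 1 \<le> fst s x \<and> \<not> fpt s x y \<le> enat (C * (2 ^ J) ^ 5)} \<le> F.prob (?N \<union> ?Cf \<union> ?At \<union> ?Fl)"
      by (rule F.finite_measure_mono[OF sub]) (intro sets.Un mN mC mA mF)
    moreover have "F.prob (?N \<union> ?Cf \<union> ?At \<union> ?Fl) \<le> F.prob ?N + F.prob ?Cf + F.prob ?At + F.prob ?Fl"
      using measure_Un_le[of "?N \<union> ?Cf \<union> ?At" "frog_space nu" ?Fl] measure_Un_le[of "?N \<union> ?Cf" "frog_space nu" ?At]
        measure_Un_le[OF mN mC] mN mC mA mF by (simp add: sets.Un)
    moreover have "F.prob ?N = 0" by (rule prob_not_unit_sample)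
    moreover have "F.prob ?Cf \<le> exp (- c * l)"
    proof -
      have "F.prob ?Cf \<le> (1 / 2) ^ l" unfolding prob_walk_confined T_def by (rule confine_exponential)
      also have "(1 / 2 :: real) ^ l = exp (- ln 2 * l)"
        using exp_of_nat2_mult[of "- ln (2::real)" l] by (simp add: exp_minus inverse_eq_divide)
      also have "\<dots> \<le> exp (- c * l)" using c(2) l1 by simp
      finally show ?thesis .
    qed
    moreover have "F.prob ?At \<le> exp (- c * l)"
    proof -
      have "F.prob ?At \<le> (1 - q) ^ l" unfolding M_def by (rule prob_attempts[OF goodq])
      also have "\<dots> \<le> exp (- q) ^ l" using q1 exp_ge_add_one_self[of "- q"] by (intro power_mono) auto
      also have "\<dots> = exp (- q * l)" by (rule exp_of_nat2_mult[symmetric])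
      also have "\<dots> \<le> exp (- c * l)"
      proof -
        have "c * real l \<le> q * real l" using c(3) by (rule mult_right_mono) simp
        then show ?thesis by simp
      qed
      finally show ?thesis .
    qed
    moreover have "F.prob ?Fl \<le> 9 ^ ?d * 4 * B * B2 * exp (- c * l)"
    proof -
      have "F.prob ?Fl \<le> (\<Sum>zj\<in>?I. F.prob {s. \<not> fill K (2 ^ snd zj) (fst zj) s})"
        using mFl by (intro F.finite_measure_subadditive_finite) auto
      also have "\<dots> \<le> (\<Sum>zj\<in>?I. B * exp (- b * l))"
      proof (rule sum_mono)
        fix zj assume "zj \<in> ?I"
        then have "J \<le> snd zj" by auto
        then have "l \<le> 2 ^ snd zj" unfolding l_def by (intro power_increasing) auto
        then have "real l \<le> real (2 ^ snd zj)" by (simp only: of_nat_le_iff)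
        then have "B * exp (- b * real (2 ^ snd zj)) \<le> B * exp (- b * l)" using B by simp
        moreover have "F.prob {s. \<not> fill K (2 ^ snd zj) (fst zj) s} \<le> B * exp (- b * real (2 ^ snd zj))"
          by (rule fillb) simp
        ultimately show "F.prob {s. \<not> fill K (2 ^ snd zj) (fst zj) s} \<le> B * exp (- b * l)" by linarith
      qed
      also have "\<dots> = real (card ?I) * (B * exp (- b * l))" by simp
      also have "\<dots> \<le> 9 ^ ?d * 4 * real l ^ (2 * ?d + 1) * (B * exp (- b * l))"
      proof -
        have "card ?I = (2 * M + 1) ^ ?d * (J + 3)" by (simp add: card_cube J'_def card_cartesian_product)
        also have "\<dots> \<le> (9 * l\<^sup>2) ^ ?d * (4 * l)"
        proof (rule mult_mono)
          show "(2 * M + 1) ^ ?d \<le> (9 * l\<^sup>2) ^ ?d" using l1 unfolding M by (intro power_mono) (auto simp: power2_eq_square)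
          have "J < l" unfolding l_def by (rule less_exp)
          then show "J + 3 \<le> 4 * l" using l1 by linarith
        qed auto
        also have "\<dots> = 9 ^ ?d * 4 * l ^ (2 * ?d + 1)" by (simp add: power_mult_distrib power_mult[symmetric])
        finally have "real (card ?I) \<le> real (9 ^ ?d * 4 * l ^ (2 * ?d + 1))" by (simp only: of_nat_le_iff)
        then show ?thesis using B by (intro mult_right_mono) auto
      qed
      also have "\<dots> = 9 ^ ?d * 4 * B * (real l ^ (2 * ?d + 1) * exp (- b * l))" by (simp only: mult_ac)
      also have "\<dots> \<le> 9 ^ ?d * 4 * B * (B2 * exp (- (b / 2) * l))"
        using B by (intro mult_left_mono B2(2)) auto
      also have "\<dots> \<le> 9 ^ ?d * 4 * B * (B2 * exp (- c * l))"
      proof -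
        have "c * real l \<le> b / 2 * real l" using c(4) by (rule mult_right_mono) simp
        then show ?thesis using B B2 by (intro mult_left_mono) auto
      qed
      finally show ?thesis by (simp only: mult.assoc)
    qed
    ultimately have "F.prob {s. 1 \<le> fst s x \<and> \<not> fpt s x y \<le> enat (C * (2 ^ J) ^ 5)}
        \<le> exp (- c * l) + exp (- c * l) + 9 ^ ?d * 4 * B * B2 * exp (- c * l)" by linarith
    also have "\<dots> = A0 * exp (- c * l)" unfolding A0_def distrib_right by simp
    finally show ?thesis by (simp add: l_def)
  qed
  \<comment> \<open>The second summand makes the bound at least 1, hence trivial, for the finitely
    many \<open>J\<close> below \<open>j0\<close>.\<close>
  define A where "A = A0 + exp (c * 2 ^ j0)"
  have "F.prob {s. 1 \<le> fst s x \<and> \<not> fpt s x y \<le> enat (C * (2 ^ J) ^ 5)} \<le> A * exp (- c * 2 ^ J)"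
    if y: "y \<in> cube x (2 ^ J)" for J and x y :: "int^'d"
  proof (cases "j0 \<le> J")
    case True
    have "A0 * exp (- c * 2 ^ J) \<le> A * exp (- c * 2 ^ J)" by (intro mult_right_mono) (auto simp: A_def)
    with main[OF True y] show ?thesis by linarith
  next
    case False
    then have "(2::real) ^ J \<le> 2 ^ j0" by (intro power_increasing) auto
    then have "c * 2 ^ J \<le> c * 2 ^ j0" using c by (intro mult_left_mono) auto
    then have "1 \<le> exp (c * 2 ^ j0) * exp (- c * 2 ^ J)" by (simp add: exp_add[symmetric])
    also have "\<dots> \<le> A * exp (- c * 2 ^ J)" using A0 by (intro mult_right_mono) (auto simp: A_def)
    finally show ?thesis using F.prob_le_1 order_trans by blast
  qed
  moreover have "A > 0" using A0 by (simp add: A_def add_pos_pos)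
  ultimately show ?thesis using c(1) by blast
qed

text \<open>Rounding \<open>l\<close> up to a power of two below 2l costs the factor 32 = 2^5 in
  time.\<close>

lemma tail:
  assumes nu: "pmf nu 0 < 1"
  shows "\<exists>C::nat. \<exists>A>0. \<exists>c>0. \<forall>l\<ge>1. \<forall>x::int^'d::finite. \<forall>y\<in>cube x l.
    measure (frog_space nu) {s. 1 \<le> fst s x \<and> \<not> fpt s x y \<le> enat (C * l ^ 5)} \<le> A * exp (- c * real l)"
proof -
  interpret F: prob_space "frog_space nu :: 'd sample measure" by (rule prob_space_frog_space)
  obtain C A c where A: "A > 0" "c > 0"
    and t: "\<forall>J. \<forall>x::int^'d. \<forall>y\<in>cube x (2 ^ J).
      F.prob {s. 1 \<le> fst s x \<and> \<not> fpt s x y \<le> enat (C * (2 ^ J) ^ 5)} \<le> A * exp (- c * 2 ^ J)"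
    using tail_dyadic[OF nu, where 'd='d] by blast
  have "F.prob {s. 1 \<le> fst s x \<and> \<not> fpt s x y \<le> enat ((32 * C) * l ^ 5)} \<le> A * exp (- c * real l)"
    if l: "l \<ge> 1" and y: "y \<in> cube x l" for l and x y :: "int^'d"
  proof -
    obtain J where J: "l \<le> 2 ^ J" "2 ^ J < 2 * l"
    proof -
      define J where "J = (LEAST J. l \<le> 2 ^ J)"
      have "l \<le> 2 ^ l" by (simp add: less_imp_le)
      then have "l \<le> 2 ^ J" unfolding J_def by (rule LeastI)
      moreover have "2 ^ J < 2 * l"
      proof (cases J)
        case 0 then show ?thesis using l by simp
      next
        case (Suc j)
        then have "\<not> l \<le> 2 ^ j" using not_less_Least[of j "\<lambda>J. l \<le> 2 ^ J"] by (simp add: J_def)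
        then show ?thesis using Suc by simp
      qed
      ultimately show ?thesis by (rule that)
    qed
    have le: "C * (2 ^ J) ^ 5 \<le> (32 * C) * l ^ 5"
    proof -
      have "(2 ^ J) ^ 5 \<le> (2 * l) ^ 5" using J(2) by (intro power_mono) auto
      then have "C * (2 ^ J) ^ 5 \<le> C * (2 * l) ^ 5" by (rule mult_left_mono) simp
      then show ?thesis by (simp add: power_mult_distrib)
    qed
    have "F.prob {s. 1 \<le> fst s x \<and> \<not> fpt s x y \<le> enat ((32 * C) * l ^ 5)}
        \<le> F.prob {s. 1 \<le> fst s x \<and> \<not> fpt s x y \<le> enat (C * (2 ^ J) ^ 5)}"
    proof (rule F.finite_measure_mono)
      show "{s. 1 \<le> fst s x \<and> \<not> fpt s x y \<le> enat ((32 * C) * l ^ 5)}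
          \<subseteq> {s. 1 \<le> fst s x \<and> \<not> fpt s x y \<le> enat (C * (2 ^ J) ^ 5)}"
        using le by (auto dest: order_trans[of _ "enat (C * (2 ^ J) ^ 5)" "enat ((32 * C) * l ^ 5)"])
      show "{s. 1 \<le> fst s x \<and> \<not> fpt s x y \<le> enat (C * (2 ^ J) ^ 5)} \<in> F.events"
        by (rule sets_frogI) measurable
    qed
    also have "\<dots> \<le> A * exp (- c * 2 ^ J)"
      by (rule t[rule_format]) (use y cube_mono[OF J(1)] in blast)
    also have "\<dots> \<le> A * exp (- c * real l)"
    proof -
      have "real l \<le> 2 ^ J" using J(1) by (metis of_nat_le_iff of_nat_numeral of_nat_power)
      then show ?thesis using A by simp
    qed
    finally show ?thesis .
  qed
  with A show ?thesis by blast
qed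

section \<open>Hops between occupied sites\<close>

text \<open>\<open>undefined\<close> is an arbitrary fixed coordinate direction. A ray instead of a
  cube gives the candidate sites a linear order, so that \<open>LEAST\<close> can select
  one.\<close>

definition ray :: "int^'d::finite \<Rightarrow> nat \<Rightarrow> int^'d" where
  "ray y g = y + axis undefined (int g)"

definition near :: "nat \<Rightarrow> int^'d::finite \<Rightarrow> 'd sample \<Rightarrow> bool" where
  "near l y s \<longleftrightarrow> (\<exists>g<l. 1 \<le> fst s (ray y g))"

text \<open>The least element is junk if no site of the ray is occupied; \<open>near\<close> excludes this.\<close>

definition site :: "int^'d::finite \<Rightarrow> 'd sample \<Rightarrow> int^'d" where
  "site y s = ray y (LEAST g. 1 \<le> fst s (ray y g))"

definition hop :: "int^'d::finite \<Rightarrow> int^'d \<Rightarrow> 'd sample \<Rightarrow> enat" where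
  "hop y y' s = fpt s (site y s) (site y' s)"

text \<open>The minimum is taken before \<open>the_enat\<close>, so an infinite hop has the value
  \<open>M\<close>.\<close>

definition hop_min :: "nat \<Rightarrow> int^'d::finite \<Rightarrow> int^'d \<Rightarrow> 'd sample \<Rightarrow> real" where
  "hop_min M y y' s = real (the_enat (min (enat M) (hop y y' s)))"

lemma ray_cube: "g \<le> l \<Longrightarrow> ray y g \<in> cube y l"
  by (auto simp: ray_def cube_def axis_def)

lemma ray_0 [simp]: "ray y 0 = y"
  by (simp add: ray_def axis_def vec_eq_iff)

lemma inj_ray: "ray y g = ray y h \<Longrightarrow> g = h"
  by (auto simp: ray_def axis_def vec_eq_iff split: if_splits)

lemma near_site:
  assumes "near l y s"
  shows "1 \<le> fst s (site y s)" "\<exists>g<l. site y s = ray y g"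
proof -
  from assms obtain g where g: "g < l" "1 \<le> fst s (ray y g)" by (auto simp: near_def)
  show "1 \<le> fst s (site y s)" unfolding site_def by (rule LeastI[of "\<lambda>g. 1 \<le> fst s (ray y g)", OF g(2)])
  have "(LEAST g. 1 \<le> fst s (ray y g)) \<le> g" by (rule Least_le[of "\<lambda>g. 1 \<le> fst s (ray y g)", OF g(2)])
  then show "\<exists>g<l. site y s = ray y g" unfolding site_def using g(1) by (intro exI[of _ "LEAST g. 1 \<le> fst s (ray y g)"]) simp
qed

lemma near_site_cube: "near l y s \<Longrightarrow> site y s \<in> cube y l"
  using near_site(2) ray_cube by (metis less_imp_le)

lemma site_occupied: "1 \<le> fst s y \<Longrightarrow> site y s = y"
proof -
  assume "1 \<le> fst s y"
  then have "(LEAST g. 1 \<le> fst s (ray y g)) = 0" by (intro Least_equality) auto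
  then show ?thesis by (simp add: site_def)
qed

lemma site_rst:
  assumes "near l y s" "cube y l \<subseteq> K"
  shows "site y (rst K s) = site y s"
proof -
  obtain g where g: "g < l" "1 \<le> fst s (ray y g)" using assms(1) by (auto simp: near_def)
  have K: "ray y h \<in> K" if "h \<le> l" for h using ray_cube[OF that] assms(2) by blast
  define G where "G = (LEAST g. 1 \<le> fst s (ray y g))"
  have G: "1 \<le> fst s (ray y G)" unfolding G_def by (rule LeastI[of "\<lambda>g. 1 \<le> fst s (ray y g)", OF g(2)])
  have "G \<le> g" unfolding G_def by (rule Least_le[of "\<lambda>g. 1 \<le> fst s (ray y g)", OF g(2)])
  then have "G \<le> l" using g(1) by simp
  have "(LEAST g. 1 \<le> fst (rst K s) (ray y g)) = G"
  proof (rule Least_equality)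
    show "1 \<le> fst (rst K s) (ray y G)" using G K[OF \<open>G \<le> l\<close>] by simp
    fix h assume "1 \<le> fst (rst K s) (ray y h)"
    then have "1 \<le> fst s (ray y h)" by (simp split: if_splits)
    then show "G \<le> h" unfolding G_def by (rule Least_le)
  qed
  then show ?thesis by (simp add: site_def G_def)
qed

lemma measurable_near [measurable]: "Measurable.pred (frog_space nu) (near l y)"
  unfolding near_def by measurable

lemma measurable_site [measurable]: "site y \<in> frog_space nu \<rightarrow>\<^sub>M count_site"
proof -
  have "(\<lambda>s. LEAST g. 1 \<le> fst s (ray y g)) \<in> frog_space nu \<rightarrow>\<^sub>M count_space UNIV" by measurable
  then have "(\<lambda>s. ray y (LEAST g. 1 \<le> fst s (ray y g))) \<in> frog_space nu \<rightarrow>\<^sub>M count_site"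
    by (rule measurable_compose) simp
  then show ?thesis by (simp add: site_def[abs_def])
qed

lemma measurable_hop [measurable]: "hop y y' \<in> frog_space nu \<rightarrow>\<^sub>M count_space UNIV"
proof -
  have 1: "(\<lambda>s. fpt s a (site y' s)) \<in> frog_space nu \<rightarrow>\<^sub>M count_space UNIV" for a
    by (rule measurable_compose_countable[where f="\<lambda>b s. fpt s a b", OF measurable_fpt measurable_site])
  have "(\<lambda>s. fpt s (site y s) (site y' s)) \<in> frog_space nu \<rightarrow>\<^sub>M count_space UNIV"
    by (rule measurable_compose_countable[where f="\<lambda>a s. fpt s a (site y' s)", OF 1 measurable_site])
  then show ?thesis by (simp add: hop_def[abs_def])
qed

lemma measurable_hop_min [measurable]: "hop_min M y y' \<in> borel_measurable (frog_space nu)"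
proof -
  have "(\<lambda>s. real (the_enat (min (enat M) (hop y y' s)))) \<in> borel_measurable (frog_space nu)"
    by (rule measurable_compose[OF measurable_hop]) simp
  then show ?thesis by (simp add: hop_min_def[abs_def])
qed

lemma hop_min_bounds: "0 \<le> hop_min M y y' s" "hop_min M y y' s \<le> real M"
  unfolding hop_min_def by (cases "hop y y' s"; simp add: min_def)+

lemma hop_min_le: "hop y y' s \<le> enat n \<Longrightarrow> hop_min M y y' s \<le> real n"
  unfolding hop_min_def by (cases "hop y y' s") (auto simp: min_def)

lemma prob_shift:
  assumes "Measurable.pred (frog_space nu) P"
  shows "measure (frog_space nu) {s. P (shift a s)} = measure (frog_space nu) {s. P (s :: 'd::finite sample)}"
proof -
  have "measure (frog_space nu) {s. P s} = measure (distr (frog_space nu) (frog_space nu) (shift a)) {s. P s}"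
    by (simp only: distr_shift)
  also have "\<dots> = measure (frog_space nu) (shift a -` {s. P s} \<inter> space (frog_space nu))"
    by (rule measure_distr[OF measurable_shift sets_frogI[OF assms]])
  finally show ?thesis by (simp add: vimage_def)
qed

lemma prob_occupied: "measure (frog_space nu) {s. 1 \<le> fst s (x::int^'d::finite)} = measure (measure_pmf nu) {1..}"
proof -
  interpret S: prob_space "step_seq :: (nat \<Rightarrow> int^'d) measure" by (rule prob_space_step_seq)
  have "UNIV \<in> sets (step_seq :: (nat \<Rightarrow> int^'d) measure)" using sets.top[of step_seq] by simp
  from prob_frog[OF this, of nu x "{1..}" 0] show ?thesis using S.prob_space by simp
qed

lemma prob_not_near:
  "measure (frog_space nu) {s. \<not> near l (y::int^'d::finite) s} \<le> exp (- (measure (measure_pmf nu) {1..} * l))"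
proof -
  interpret F: prob_space "frog_space nu :: 'd sample measure" by (rule prob_space_frog_space)
  let ?p = "measure (measure_pmf nu) {1..}"
  have e: "{s. \<not> near l y s} = (\<Inter>g\<in>{..<l}. {s. \<not> 1 \<le> fst s (ray y g)})" by (auto simp: near_def)
  have "F.prob {s. \<not> near l y s} = (\<Prod>g\<in>{..<l}. F.prob {s. \<not> 1 \<le> fst s (ray y g)})"
    unfolding e
  proof (rule prob_Int_rst[where K="\<lambda>g. {ray y g}"])
    show "disjoint_family_on (\<lambda>g. {ray y g}) {..<l}" using inj_ray by (auto simp: disjoint_family_on_def)
    show "{s. \<not> 1 \<le> fst s (ray y g)} \<in> F.events" for g by (rule sets_frogI) measurable
  qed auto
  also have "\<dots> \<le> (\<Prod>g\<in>{..<l}. exp (- ?p))"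
  proof (intro prod_mono conjI)
    fix g
    have "{s. 1 \<le> fst s (ray y g)} \<in> F.events" by (rule sets_frogI) measurable
    then have "F.prob {s. \<not> 1 \<le> fst s (ray y g)} = 1 - ?p"
      using F.prob_compl[of "{s. 1 \<le> fst s (ray y g)}"] prob_occupied[of nu "ray y g"]
      by (simp add: Collect_neg_eq Compl_eq_Diff_UNIV del: not_le One_nat_def)
    then show "F.prob {s. \<not> 1 \<le> fst s (ray y g)} \<le> exp (- ?p)" using exp_ge_add_one_self[of "- ?p"] by simp
  qed simp
  also have "\<dots> = exp (- (?p * l))" by (simp add: exp_of_nat_mult[symmetric] mult.commute)
  finally show ?thesis .
qed

text \<open>The end points are random, so \<open>tail\<close> is applied to all l^2 pairs of
  candidate sites, and \<open>poly_exp_bound\<close> absorbs their number.\<close>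

lemma hop_tail:
  assumes nu: "pmf nu 0 < 1"
  shows "\<exists>C\<ge>1. \<exists>A>0. \<exists>c>0. \<forall>l\<ge>1. \<forall>y::int^'d::finite. \<forall>y'\<in>cube y l.
    measure (frog_space nu) {s. \<not> (near l y s \<and> near l y' s \<and> hop y y' s \<le> enat (C * l ^ 5))} \<le> A * exp (- c * real l)"
proof -
  interpret F: prob_space "frog_space nu :: 'd sample measure" by (rule prob_space_frog_space)
  let ?p = "measure (measure_pmf nu) {1..}"
  obtain C A c where A: "A > 0" "c > 0"
    and t: "\<forall>l\<ge>1. \<forall>x::int^'d. \<forall>y\<in>cube x l.
      F.prob {s. 1 \<le> fst s x \<and> \<not> fpt s x y \<le> enat (C * l ^ 5)} \<le> A * exp (- c * real l)"
    using tail[OF nu, where 'd='d] by blast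
  obtain B where B: "B > 0" "\<And>x. x \<ge> 0 \<Longrightarrow> x ^ 2 * exp (- c * x) \<le> B * exp (- (c / 2) * x)"
    using poly_exp_bound[OF A(2), of 2] by blast
  \<comment> \<open>Candidate end points are within distance 3l of each other, and 243 = 3^5. The
    summand 1 secures C' >= 1, which is used later.\<close>
  define C' where "C' = 243 * C + 1"
  define c' where "c' = min ?p (c / 2)"
  have c': "c' > 0" "c' \<le> ?p" "c' \<le> c / 2" using A occupied_positive[OF nu] by (auto simp: c'_def)
  have "F.prob {s. \<not> (near l y s \<and> near l y' s \<and> hop y y' s \<le> enat (C' * l ^ 5))} \<le> (2 + A * B) * exp (- c' * real l)"
    if l: "l \<ge> 1" and y': "y' \<in> cube y l" for l and y y' :: "int^'d"
  proof -
    let ?N = "\<lambda>y. {s. \<not> near l y s}"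
    let ?B = "\<lambda>gh. {s. 1 \<le> fst s (ray y (fst gh)) \<and> \<not> fpt s (ray y (fst gh)) (ray y' (snd gh)) \<le> enat (C * (3 * l) ^ 5)}"
    let ?I = "{..<l} \<times> {..<l}"
    have le: "C * (3 * l) ^ 5 \<le> C' * l ^ 5" by (simp add: C'_def power_mult_distrib)
    have sub: "{s. \<not> (near l y s \<and> near l y' s \<and> hop y y' s \<le> enat (C' * l ^ 5))} \<subseteq> ?N y \<union> ?N y' \<union> (\<Union>gh\<in>?I. ?B gh)"
    proof
      fix s assume s: "s \<in> {s. \<not> (near l y s \<and> near l y' s \<and> hop y y' s \<le> enat (C' * l ^ 5))}"
      show "s \<in> ?N y \<union> ?N y' \<union> (\<Union>gh\<in>?I. ?B gh)"
      proof (cases "near l y s \<and> near l y' s")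
        case True
        then have h: "\<not> hop y y' s \<le> enat (C' * l ^ 5)" using s by simp
        obtain g where g: "g < l" "site y s = ray y g" using near_site(2) True by blast
        obtain g' where g': "g' < l" "site y' s = ray y' g'" using near_site(2) True by blast
        have "1 \<le> fst s (ray y g)" using near_site(1)[of l y s] True g by simp
        moreover have "\<not> fpt s (ray y g) (ray y' g') \<le> enat (C * (3 * l) ^ 5)"
        proof -
          have "enat (C * (3 * l) ^ 5) \<le> enat (C' * l ^ 5)" using le by (simp only: enat_ord_simps)
          then show ?thesis using h order_trans unfolding hop_def g(2) g'(2) by blast
        qed
        ultimately have "s \<in> ?B (g, g')" by simp
        moreover have "(g, g') \<in> ?I" using g g' by simp
        ultimately show ?thesis by blast
      qed auto
    qed
    have mN: "?N y \<in> F.events" for y by (rule sets_frogI) measurable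
    have mB: "?B gh \<in> F.events" for gh by (rule sets_frogI) measurable
    have mU: "(\<Union>gh\<in>?I. ?B gh) \<in> F.events" using mB by (intro sets.finite_UN) auto
    have "F.prob {s. \<not> (near l y s \<and> near l y' s \<and> hop y y' s \<le> enat (C' * l ^ 5))}
       \<le> F.prob (?N y \<union> ?N y' \<union> (\<Union>gh\<in>?I. ?B gh))"
      by (rule F.finite_measure_mono[OF sub]) (intro sets.Un mN mU)
    moreover have "F.prob (?N y \<union> ?N y' \<union> (\<Union>gh\<in>?I. ?B gh)) \<le> F.prob (?N y \<union> ?N y') + F.prob (\<Union>gh\<in>?I. ?B gh)"
      by (intro measure_Un_le sets.Un mN mU)
    moreover have "F.prob (?N y \<union> ?N y') \<le> F.prob (?N y) + F.prob (?N y')" by (intro measure_Un_le mN)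
    moreover have "F.prob (?N y) \<le> exp (- c' * real l)" for y
    proof -
      have "c' * real l \<le> ?p * real l" using c'(2) by (rule mult_right_mono) simp
      then show ?thesis using prob_not_near[of nu l y] by (auto intro: order_trans)
    qed
    from this[of y] this[of y'] have "F.prob (?N y) + F.prob (?N y') \<le> 2 * exp (- c' * real l)" by simp
    moreover have "F.prob (\<Union>gh\<in>?I. ?B gh) \<le> A * B * exp (- c' * real l)"
    proof -
      have "F.prob (\<Union>gh\<in>?I. ?B gh) \<le> (\<Sum>gh\<in>?I. F.prob (?B gh))"
        using mB by (intro F.finite_measure_subadditive_finite) auto
      also have "\<dots> \<le> (\<Sum>gh\<in>?I. A * exp (- c * real l))"
      proof (rule sum_mono)
        fix gh assume gh: "gh \<in> ?I"
        have "ray y' (snd gh) \<in> cube y (l + l)"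
          by (rule cube_trans[OF y']) (use gh in \<open>auto intro: ray_cube\<close>)
        moreover have "y \<in> cube (ray y (fst gh)) l" using gh by (subst cube_sym) (auto intro: ray_cube)
        moreover have "3 * l = l + (l + l)" by simp
        ultimately have "ray y' (snd gh) \<in> cube (ray y (fst gh)) (3 * l)"
          using cube_trans[of y "ray y (fst gh)" l "ray y' (snd gh)" "l + l"] by (simp only:)
        then have "F.prob (?B gh) \<le> A * exp (- c * real (3 * l))"
          by (intro t[rule_format]) (use l in auto)
        also have "\<dots> \<le> A * exp (- c * real l)" using A by simp
        finally show "F.prob (?B gh) \<le> A * exp (- c * real l)" .
      qed
      also have "\<dots> = A * (real l ^ 2 * exp (- c * real l))" by (simp add: power2_eq_square)
      also have "\<dots> \<le> A * (B * exp (- (c / 2) * real l))" using A by (intro mult_left_mono B(2)) auto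
      also have "\<dots> \<le> A * (B * exp (- c' * real l))"
      proof -
        have "c' * real l \<le> c / 2 * real l" using c'(3) by (rule mult_right_mono) simp
        then show ?thesis using A B by (intro mult_left_mono) auto
      qed
      finally show ?thesis by (simp only: mult.assoc)
    qed
    ultimately have "F.prob {s. \<not> (near l y s \<and> near l y' s \<and> hop y y' s \<le> enat (C' * l ^ 5))}
       \<le> 2 * exp (- c' * real l) + A * B * exp (- c' * real l)" by linarith
    then show ?thesis by (simp only: distrib_right)
  qed
  moreover have "C' \<ge> 1" "2 + A * B > 0" using A B by (auto simp: C'_def add_pos_pos)
  ultimately show ?thesis using c'(1) by blast
qed

lemma expectation_of_bool:
  assumes "Measurable.pred (frog_space nu) P"
  shows "integral\<^sup>L (frog_space nu) (\<lambda>s. of_bool (P s)) = measure (frog_space nu) {s. P s}"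
proof -
  have "(\<lambda>s. of_bool (P s)) = (indicator {s. P s} :: _ \<Rightarrow> real)" by (auto simp: indicator_def fun_eq_iff)
  then show ?thesis using sets_frogI[OF assms] by (simp add: measure_def)
qed

lemma integrable_bounded:
  assumes "f \<in> borel_measurable (frog_space nu)" "\<And>s. 0 \<le> f s" "\<And>s. f s \<le> (B::real)"
  shows "integrable (frog_space nu) f"
proof -
  interpret F: prob_space "frog_space nu" by (rule prob_space_frog_space)
  show ?thesis by (rule F.integrable_const_bound[where B=B]) (use assms in auto)
qed

text \<open>The truncation level \<open>M\<close> does not enter the bound: the truncated hop times are uniformly integrable.\<close>

lemma hop_uniformly_integrable:
  assumes nu: "pmf nu 0 < 1" and eta: "\<eta> > 0"
  shows "\<exists>k. \<forall>M. \<forall>y::int^'d::finite. \<forall>y'\<in>cube y 1.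
    integral\<^sup>L (frog_space nu) (\<lambda>s. hop_min M y y' s * of_bool (\<not> hop y y' s \<le> enat k)) \<le> \<eta>"
proof -
  interpret F: prob_space "frog_space nu :: 'd sample measure" by (rule prob_space_frog_space)
  obtain C A c where C: "C \<ge> 1" and A: "A > 0" "c > 0"
    and t: "\<forall>l\<ge>1. \<forall>y::int^'d. \<forall>y'\<in>cube y l.
    F.prob {s. \<not> (near l y s \<and> near l y' s \<and> hop y y' s \<le> enat (C * l ^ 5))} \<le> A * exp (- c * real l)"
    using hop_tail[OF nu, where 'd='d] by blast
  obtain B where B: "B > 0" "\<And>x. x \<ge> 0 \<Longrightarrow> x ^ 5 * exp (- c * x) \<le> B * exp (- (c / 2) * x)"
    using poly_exp_bound[OF A(2), of 5] by blast
  \<comment> \<open>The bound for layer \<open>l\<close>, with 32 from (l + 1)^5 <= (2l)^5. Its sum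
    does not involve \<open>M\<close>.\<close>
  define b where "b l = C * 32 * A * B * exp (- (c / 2)) ^ l" for l
  have sm: "summable b"
    unfolding b_def using A by (intro summable_mult summable_geometric) simp
  obtain l0 where l0: "\<And>n. n \<ge> l0 \<Longrightarrow> norm (\<Sum>i. b (i + n)) < \<eta>"
    using suminf_exist_split[OF eta sm] by auto
  define m where "m = max l0 1"
  have b0: "b l \<ge> 0" for l using A B by (simp add: b_def)
  have "integral\<^sup>L (frog_space nu) (\<lambda>s. hop_min M y y' s * of_bool (\<not> hop y y' s \<le> enat (C * m ^ 5))) \<le> \<eta>"
    if y': "y' \<in> cube y 1" for M and y y' :: "int^'d"
  proof -
    \<comment> \<open>At the top layer the truncation itself is the bound, since M <= C (N + 1)^5;
      so finitely many layers suffice.\<close>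
    define N where "N = max m M"
    let ?P = "\<lambda>l s. \<not> hop y y' s \<le> enat (C * l ^ 5)"
    \<comment> \<open>If \<open>l\<close> is the last layer that the hop exceeds, the truncated time
      is at most the threshold of layer l + 1, or at most \<open>M\<close> if l = N.\<close>
    have pw: "hop_min M y y' s * of_bool (?P m s) \<le> (\<Sum>l\<in>{m..N}. real (C * Suc l ^ 5) * of_bool (?P l s))" for s
    proof (cases "?P m s")
      case True
      define S where "S = {l\<in>{m..N}. ?P l s}"
      have fS: "finite S" and "m \<in> S" using True by (auto simp: S_def N_def)
      define l where "l = Max S"
      have lS: "l \<in> S" unfolding l_def using fS \<open>m \<in> S\<close> by (intro Max_in) auto
      have "hop_min M y y' s \<le> real (C * Suc l ^ 5)"
      proof (cases "l = N")
        case True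
        have "M \<le> C * Suc N ^ 5"
        proof -
          have "M \<le> Suc N" by (simp add: N_def)
          also have "\<dots> \<le> Suc N ^ 5" by (rule self_le_power) auto
          also have "\<dots> \<le> C * Suc N ^ 5" using C by simp
          finally show ?thesis .
        qed
        then have "real M \<le> real (C * Suc N ^ 5)" by (simp only: of_nat_le_iff)
        with hop_min_bounds(2)[of M y y' s] show ?thesis unfolding True by (rule order_trans)
      next
        case False
        have "Suc l \<notin> S" using Max_ge[OF fS, of "Suc l"] by (auto simp: l_def[symmetric])
        moreover have "Suc l \<in> {m..N}" using lS False by (auto simp: S_def)
        ultimately have "hop y y' s \<le> enat (C * Suc l ^ 5)" by (auto simp: S_def)
        then show ?thesis by (rule hop_min_le)
      qed
      also have "\<dots> = real (C * Suc l ^ 5) * of_bool (?P l s)" using lS by (simp add: S_def)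
      also have "\<dots> \<le> (\<Sum>l\<in>{m..N}. real (C * Suc l ^ 5) * of_bool (?P l s))"
        using lS by (intro member_le_sum) (auto simp: S_def)
      finally show ?thesis using True by simp
    qed (simp add: sum_nonneg)
    have intP: "integrable (frog_space nu) (\<lambda>s. of_bool (?P l s) :: real)" for l
      by (rule integrable_bounded[where B=1]) auto
    have "integral\<^sup>L (frog_space nu) (\<lambda>s. hop_min M y y' s * of_bool (?P m s))
        \<le> integral\<^sup>L (frog_space nu) (\<lambda>s. \<Sum>l\<in>{m..N}. real (C * Suc l ^ 5) * of_bool (?P l s))"
    proof (rule integral_mono)
      show "integrable (frog_space nu) (\<lambda>s. hop_min M y y' s * of_bool (?P m s))"
        by (rule integrable_bounded[where B="real M"]) (use hop_min_bounds[of M y y'] in auto)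
      show "integrable (frog_space nu) (\<lambda>s. \<Sum>l\<in>{m..N}. real (C * Suc l ^ 5) * of_bool (?P l s))"
        by (intro Bochner_Integration.integrable_sum integrable_mult_right intP)
    qed (rule pw)
    also have "\<dots> = (\<Sum>l\<in>{m..N}. real (C * Suc l ^ 5) * F.prob {s. ?P l s})"
    proof -
      have "integral\<^sup>L (frog_space nu) (\<lambda>s. of_bool (?P l s)) = F.prob {s. ?P l s}" for l
        by (rule expectation_of_bool) measurable
      then show ?thesis
        by (subst Bochner_Integration.integral_sum) (auto intro!: integrable_mult_right intP)
    qed
    also have "\<dots> \<le> (\<Sum>l\<in>{m..N}. b l)"
    proof (rule sum_mono)
      fix l assume l: "l \<in> {m..N}"
      then have l1: "l \<ge> 1" by (auto simp: m_def)
      have "F.prob {s. ?P l s} \<le> F.prob {s. \<not> (near l y s \<and> near l y' s \<and> hop y y' s \<le> enat (C * l ^ 5))}"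
        by (rule F.finite_measure_mono) (auto intro!: sets_frogI)
      also have "\<dots> \<le> A * exp (- c * real l)"
        by (rule t[rule_format, OF l1]) (use y' cube_mono[OF l1] in blast)
      finally have "real (C * Suc l ^ 5) * F.prob {s. ?P l s} \<le> real (C * Suc l ^ 5) * (A * exp (- c * real l))"
        by (rule mult_left_mono) simp
      also have "\<dots> \<le> real (C * (32 * l ^ 5)) * (A * exp (- c * real l))"
      proof -
        have "Suc l ^ 5 \<le> (2 * l) ^ 5" using l1 by (intro power_mono) auto
        then have "C * Suc l ^ 5 \<le> C * (32 * l ^ 5)" by (simp add: power_mult_distrib)
        then have "real (C * Suc l ^ 5) \<le> real (C * (32 * l ^ 5))" by (simp only: of_nat_le_iff)
        then show ?thesis using A by (intro mult_right_mono) auto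
      qed
      also have "\<dots> = C * 32 * A * (real l ^ 5 * exp (- c * real l))" by simp
      also have "\<dots> \<le> C * 32 * A * (B * exp (- (c / 2) * real l))"
        using A by (intro mult_left_mono B(2)) auto
      also have "\<dots> = b l" unfolding b_def by (simp add: exp_of_nat2_mult[symmetric])
      finally show "real (C * Suc l ^ 5) * F.prob {s. ?P l s} \<le> b l" .
    qed
    also have "\<dots> = (\<Sum>i<Suc N - m. b (i + m))"
      by (rule sum.reindex_bij_witness[of _ "\<lambda>i. i + m" "\<lambda>l. l - m"]) auto
    also have "\<dots> \<le> (\<Sum>i. b (i + m))"
      using sm b0 by (intro sum_le_suminf) (auto simp: summable_iff_shift[of b m])
    also have "\<dots> \<le> \<eta>" using l0[of m] by (auto simp: m_def)
    finally show ?thesis .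
  qed
  then show ?thesis by blast
qed

section \<open>Mean hop times\<close>

lemma norm1_nonneg [simp]: "0 \<le> norm1 x"
  by (simp add: norm1_def sum_nonneg)

lemma norm1_triangle: "norm1 (x + y) \<le> norm1 x + norm1 y"
  unfolding norm1_def sum.distrib[symmetric] by (intro sum_mono) (simp add: abs_triangle_ineq)

lemma norm1_minus [simp]: "norm1 (- x) = norm1 x"
  by (simp add: norm1_def)

lemma norm1_axis: "norm1 (axis i a :: int^'d::finite) = \<bar>a\<bar>"
  by (simp add: norm1_def axis_def if_distrib cong: if_cong)

lemma real_vec_add: "real_vec (x + y) = real_vec x + real_vec y"
  and real_vec_axis: "real_vec (axis i a) = real_of_int a *\<^sub>R axis i 1"
  by (auto simp: real_vec_def vec_eq_iff axis_def)

lemma is_normD: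
  assumes "is_norm mu"
  shows "0 \<le> mu x" "mu (c *\<^sub>R x) = \<bar>c\<bar> * mu x" "mu (x + y) \<le> mu x + mu y"
  using assms by (auto simp: is_norm_def)

text \<open>The limit runs over all lattice points at once, so almost surely exceedances stop beyond
  a random radius. The events \<open>BN\<close> therefore decrease to a null set, and the resulting
  bound is uniform over directions.\<close>

lemma first_passage_in_probability:
  fixes mu :: "real^'d::finite \<Rightarrow> real" and \<delta> \<delta>' :: real
  assumes lim: "AE s in frog_space nu. fst s 0 \<ge> 1 \<longrightarrow>
          ((\<lambda>x. (ereal_of_enat (fpt s 0 x) - ereal (mu (real_vec x)))
                   / ereal (real_of_int (norm1 x))) \<longlongrightarrow> 0) norm1_infty"
    and "\<delta> > 0" "\<delta>' > 0"
  shows "\<exists>R. \<forall>v::int^'d. norm1 v \<ge> R \<longrightarrow>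
    measure (frog_space nu) {s. 1 \<le> fst s 0 \<and> \<not> ereal_of_enat (fpt s 0 v) \<le> ereal (mu (real_vec v) + \<delta> * norm1 v)} \<le> \<delta>'"
proof -
  interpret F: prob_space "frog_space nu :: 'd sample measure" by (rule prob_space_frog_space)
  define P where "P v s \<longleftrightarrow> 1 \<le> fst s 0 \<and> \<not> ereal_of_enat (fpt s 0 v) \<le> ereal (mu (real_vec v) + \<delta> * norm1 v)"
    for v and s :: "'d sample"
  have mE: "Measurable.pred (frog_space nu) (\<lambda>s. \<not> ereal_of_enat (fpt s 0 v) \<le> a)" for v a
    by (rule measurable_compose[OF measurable_fpt]) simp
  have mP [measurable]: "Measurable.pred (frog_space nu) (P v)" for v
    unfolding P_def using mE by measurable
  define BN where "BN N = {s. \<exists>v. norm1 v \<ge> int N \<and> P v s}" for N :: nat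
  have mB: "BN N \<in> F.events" for N unfolding BN_def by (rule sets_frogI) measurable
  have dec: "decseq BN"
    unfolding decseq_def
  proof (intro allI impI)
    fix a b :: nat assume "a \<le> b"
    then have "int a \<le> int b" by simp
    then show "BN b \<subseteq> BN a" unfolding BN_def using order_trans by blast
  qed
  have "AE s in frog_space nu. s \<notin> (\<Inter>N. BN N)"
    using lim
  proof eventually_elim
    fix s :: "'d sample"
    assume h: "fst s 0 \<ge> 1 \<longrightarrow> ((\<lambda>x. (ereal_of_enat (fpt s 0 x) - ereal (mu (real_vec x)))
                   / ereal (real_of_int (norm1 x))) \<longlongrightarrow> 0) norm1_infty"
    show "s \<notin> (\<Inter>N. BN N)"
    proof
      assume B: "s \<in> (\<Inter>N. BN N)"
      then have "1 \<le> fst s 0" by (auto simp: BN_def P_def)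
      with h have "((\<lambda>x. (ereal_of_enat (fpt s 0 x) - ereal (mu (real_vec x)))
                   / ereal (real_of_int (norm1 x))) \<longlongrightarrow> 0) norm1_infty" by simp
      then have "\<forall>\<^sub>F x in norm1_infty. (ereal_of_enat (fpt s 0 x) - ereal (mu (real_vec x)))
                   / ereal (real_of_int (norm1 x)) < ereal \<delta>"
        by (rule order_tendstoD) (use \<open>\<delta> > 0\<close> in simp)
      then obtain R where R: "\<And>x. R \<le> real_of_int (norm1 x) \<Longrightarrow>
          (ereal_of_enat (fpt s 0 x) - ereal (mu (real_vec x))) / ereal (real_of_int (norm1 x)) < ereal \<delta>"
        unfolding norm1_infty_def eventually_filtercomap eventually_at_top_linorder by blast
      define N where "N = nat \<lceil>max R 1\<rceil>"
      obtain v where v: "norm1 v \<ge> int N" "P v s" using B by (auto simp: BN_def)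
      have N: "real N \<ge> R" "N \<ge> 1" unfolding N_def by linarith+
      have n0: "real_of_int (norm1 v) > 0" using v(1) N(2) by linarith
      have "R \<le> real_of_int (norm1 v)" using v(1) N(1) by linarith
      from R[OF this] have "ereal_of_enat (fpt s 0 v) \<le> ereal (mu (real_vec v) + \<delta> * norm1 v)"
        using n0 by (cases "fpt s 0 v") (auto simp: field_simps)
      then show False using v(2) by (simp add: P_def)
    qed
  qed
  then have "F.prob (\<Inter>N. BN N) = 0"
    using mB by (subst F.prob_eq_0) auto
  then have "(\<lambda>N. F.prob (BN N)) \<longlonglongrightarrow> 0"
    using F.finite_Lim_measure_decseq[of BN] mB dec by auto
  then have "\<forall>\<^sub>F N in sequentially. F.prob (BN N) < \<delta>'"
    by (rule order_tendstoD) (use \<open>\<delta>' > 0\<close> in simp)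
  then obtain N where N: "F.prob (BN N) < \<delta>'" by (auto simp: eventually_sequentially)
  have "F.prob {s. P v s} \<le> \<delta>'" if "norm1 v \<ge> int N" for v
  proof -
    have "F.prob {s. P v s} \<le> F.prob (BN N)"
      by (rule F.finite_measure_mono) (use that mB in \<open>auto simp: BN_def\<close>)
    then show ?thesis using N by simp
  qed
  then show ?thesis unfolding P_def by (intro exI[of _ "int N"]) blast
qed

text \<open>Beyond a small probability the offsets of both end points are below a constant
  \<open>l\<close>. For each of the l^2 pairs of offsets a translation turns the hop into a passage
  time from an occupied origin to a point near \<open>v\<close>.\<close>

lemma hop_in_probability:
  fixes mu :: "real^'d::finite \<Rightarrow> real" and \<delta> \<delta>' :: real
  assumes nu: "pmf nu 0 < 1" and norm: "is_norm mu"
    and lim: "AE s in frog_space nu. fst s 0 \<ge> 1 \<longrightarrow>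
          ((\<lambda>x. (ereal_of_enat (fpt s 0 x) - ereal (mu (real_vec x)))
                   / ereal (real_of_int (norm1 x))) \<longlongrightarrow> 0) norm1_infty"
    and d: "\<delta> > 0" "\<delta>' > 0"
  shows "\<exists>R. \<forall>y v::int^'d. norm1 v \<ge> R \<longrightarrow>
    measure (frog_space nu) {s. \<not> ereal_of_enat (hop y (y + v) s) \<le> ereal (mu (real_vec v) + \<delta> * norm1 v)} \<le> \<delta>'"
proof -
  interpret F: prob_space "frog_space nu :: 'd sample measure" by (rule prob_space_frog_space)
  let ?p = "measure (measure_pmf nu) {1..}"
  have p: "?p > 0" by (rule occupied_positive[OF nu])
  have "(\<lambda>l. exp (- ?p) ^ l) \<longlonglongrightarrow> 0" using p by (intro LIMSEQ_power_zero) simp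
  then have "\<forall>\<^sub>F l in sequentially. exp (- ?p) ^ l < \<delta>' / 4"
    by (rule order_tendstoD) (use d in simp)
  then obtain l0 where l0: "\<And>l. l \<ge> l0 \<Longrightarrow> exp (- ?p) ^ l < \<delta>' / 4" by (auto simp: eventually_sequentially)
  define l where "l = max l0 1"
  have l: "exp (- (?p * l)) < \<delta>' / 4" "l \<ge> 1"
    using l0[of l] by (auto simp: l_def exp_of_nat2_mult[symmetric])
  obtain R0 where R0: "\<And>v::int^'d. norm1 v \<ge> R0 \<Longrightarrow>
    F.prob {s. 1 \<le> fst s 0 \<and> \<not> ereal_of_enat (fpt s 0 v) \<le> ereal (mu (real_vec v) + \<delta> / 2 * norm1 v)} \<le> \<delta>' / (2 * l ^ 2)"
    using first_passage_in_probability[OF lim, of "\<delta> / 2" "\<delta>' / (2 * l ^ 2)"] d l(2) by auto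
  define m1 where "m1 = mu (axis undefined 1)"
  have m1: "m1 \<ge> 0" unfolding m1_def by (rule is_normD[OF norm])
  \<comment> \<open>The first entry keeps the displaced vectors within the range of
    \<open>R0\<close>. By the second, the displacement costs at most \<delta> / 2 times
    \<open>norm1 v\<close>, both in \<open>mu\<close> and in the error term.\<close>
  define R where "R = max (R0 + int l) \<lceil>2 / \<delta> * (l * m1 + \<delta> / 2 * l)\<rceil>"
  let ?Q = "\<lambda>y v s. ereal_of_enat (hop y (y + v) s) \<le> ereal (mu (real_vec v) + \<delta> * norm1 v)"
  have mE: "Measurable.pred (frog_space nu) (\<lambda>s. \<not> ereal_of_enat (fpt s x v) \<le> a)" for x v a
    by (rule measurable_compose[OF measurable_fpt]) simp
  have "F.prob {s. \<not> ?Q y v s} \<le> \<delta>'" if v: "norm1 v \<ge> R" for y v :: "int^'d"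
  proof -
    let ?N = "\<lambda>y. {s. \<not> near l y s}"
    define w where "w gh = v + axis undefined (int (snd gh) - int (fst gh))" for gh :: "nat \<times> nat"
    define Q where "Q gh s \<longleftrightarrow> 1 \<le> fst s 0 \<and> \<not> ereal_of_enat (fpt s 0 (w gh)) \<le> ereal (mu (real_vec (w gh)) + \<delta> / 2 * norm1 (w gh))"
      for gh and s :: "'d sample"
    have mQ [measurable]: "Measurable.pred (frog_space nu) (Q gh)" for gh
      unfolding Q_def using mE by measurable
    let ?B = "\<lambda>gh. {s. Q gh (shift (ray y (fst gh)) s)}"
    let ?I = "{..<l} \<times> {..<l}"
    have w: "norm1 (w gh) \<ge> R0 \<and> mu (real_vec (w gh)) + \<delta> / 2 * norm1 (w gh) \<le> mu (real_vec v) + \<delta> * norm1 v"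
      if "gh \<in> ?I" for gh
    proof -
      define k where "k = int (snd gh) - int (fst gh)"
      have k: "\<bar>k\<bar> \<le> int l" using that by (auto simp: k_def)
      have wk: "w gh = v + axis undefined k" by (simp add: w_def k_def)
      have "norm1 (w gh) \<le> norm1 v + \<bar>k\<bar>"
        using norm1_triangle[of v "axis undefined k"] by (simp add: wk norm1_axis)
      moreover have "norm1 v \<le> norm1 (w gh) + \<bar>k\<bar>"
        using norm1_triangle[of "w gh" "- axis undefined k"] by (simp add: wk norm1_axis)
      ultimately have n: "norm1 (w gh) \<le> norm1 v + int l" "norm1 v \<le> norm1 (w gh) + int l" using k by linarith+
      have "mu (real_vec (w gh)) \<le> mu (real_vec v) + \<bar>real_of_int k\<bar> * m1"
        using is_normD(3)[OF norm, of "real_vec v" "real_vec (axis undefined k)"]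
        by (simp add: wk real_vec_add real_vec_axis is_normD(2)[OF norm] m1_def)
      also have "\<bar>real_of_int k\<bar> * m1 \<le> l * m1" using k m1 by (intro mult_right_mono) linarith+
      finally have mw: "mu (real_vec (w gh)) \<le> mu (real_vec v) + l * m1" by simp
      have "2 / \<delta> * (l * m1 + \<delta> / 2 * l) \<le> norm1 v" using v unfolding R_def by linarith
      then have "\<delta> / 2 * (2 / \<delta> * (l * m1 + \<delta> / 2 * l)) \<le> \<delta> / 2 * norm1 v" using d by (intro mult_left_mono) auto
      then have a: "l * m1 + \<delta> / 2 * l \<le> \<delta> / 2 * norm1 v" using d by simp
      have "\<delta> / 2 * norm1 (w gh) \<le> \<delta> / 2 * (real_of_int (norm1 v) + real l)" using n(1) d by (intro mult_left_mono) linarith+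
      then have b: "\<delta> / 2 * norm1 (w gh) \<le> \<delta> / 2 * norm1 v + \<delta> / 2 * l" by (simp only: distrib_left)
      have "\<delta> * norm1 v = \<delta> / 2 * norm1 v + \<delta> / 2 * norm1 v" by simp
      then have "mu (real_vec (w gh)) + \<delta> / 2 * norm1 (w gh) \<le> mu (real_vec v) + \<delta> * norm1 v"
        using a b mw by linarith
      moreover have "norm1 (w gh) \<ge> R0" using n(2) v unfolding R_def by linarith
      ultimately show ?thesis by blast
    qed
    have sub: "{s. \<not> ?Q y v s} \<subseteq> ?N y \<union> ?N (y + v) \<union> (\<Union>gh\<in>?I. ?B gh)"
    proof
      fix s assume s: "s \<in> {s. \<not> ?Q y v s}"
      show "s \<in> ?N y \<union> ?N (y + v) \<union> (\<Union>gh\<in>?I. ?B gh)"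
      proof (cases "near l y s \<and> near l (y + v) s")
        case True
        obtain g where g: "g < l" "site y s = ray y g" using near_site(2) True by blast
        obtain g' where g': "g' < l" "site (y + v) s = ray (y + v) g'" using near_site(2) True by blast
        have I: "(g, g') \<in> ?I" using g g' by simp
        have "1 \<le> fst s (ray y g)" using near_site(1)[of l y s] True g by simp
        then have o: "1 \<le> fst (shift (ray y g) s) 0" by (simp add: shift_def)
        have "w (g, g') + ray y g = ray (y + v) g'"
          by (simp add: w_def ray_def vec_eq_iff axis_def)
        then have f: "fpt (shift (ray y g) s) 0 (w (g, g')) = hop y (y + v) s"
          by (simp add: fpt_shift hop_def g g')
        have "\<not> ereal_of_enat (hop y (y + v) s) \<le> ereal (mu (real_vec (w (g, g'))) + \<delta> / 2 * norm1 (w (g, g')))"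
        proof
          assume "ereal_of_enat (hop y (y + v) s) \<le> ereal (mu (real_vec (w (g, g'))) + \<delta> / 2 * norm1 (w (g, g')))"
          also have "\<dots> \<le> ereal (mu (real_vec v) + \<delta> * norm1 v)" using w[OF I] by simp
          finally show False using s by simp
        qed
        then have "s \<in> ?B (g, g')" using o by (simp add: Q_def f)
        then show ?thesis using I by blast
      qed auto
    qed
    have mN: "?N y \<in> F.events" for y by (rule sets_frogI) measurable
    have mB: "?B gh \<in> F.events" for gh by (rule sets_frogI) measurable
    have mU: "(\<Union>gh\<in>?I. ?B gh) \<in> F.events" using mB by (intro sets.finite_UN) auto
    have "F.prob {s. \<not> ?Q y v s} \<le> F.prob (?N y \<union> ?N (y + v) \<union> (\<Union>gh\<in>?I. ?B gh))"
      by (rule F.finite_measure_mono[OF sub]) (intro sets.Un mN mU)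
    moreover have "F.prob (?N y \<union> ?N (y + v) \<union> (\<Union>gh\<in>?I. ?B gh)) \<le> F.prob (?N y \<union> ?N (y + v)) + F.prob (\<Union>gh\<in>?I. ?B gh)"
      by (intro measure_Un_le sets.Un mN mU)
    moreover have "F.prob (?N y \<union> ?N (y + v)) \<le> F.prob (?N y) + F.prob (?N (y + v))" by (intro measure_Un_le mN)
    moreover have "F.prob (?N y) \<le> \<delta>' / 4" for y
      using prob_not_near[of nu l y] l(1) by linarith
    from this[of y] this[of "y + v"] have "F.prob (?N y) + F.prob (?N (y + v)) \<le> \<delta>' / 2" by simp
    moreover have "F.prob (\<Union>gh\<in>?I. ?B gh) \<le> \<delta>' / 2"
    proof -
      have "F.prob (\<Union>gh\<in>?I. ?B gh) \<le> (\<Sum>gh\<in>?I. F.prob (?B gh))"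
        using mB by (intro F.finite_measure_subadditive_finite) auto
      also have "\<dots> \<le> (\<Sum>gh\<in>?I. \<delta>' / (2 * l ^ 2))"
      proof (rule sum_mono)
        fix gh assume "gh \<in> ?I"
        then have "F.prob {s. Q gh s} \<le> \<delta>' / (2 * l ^ 2)" unfolding Q_def using w by (intro R0) blast
        then show "F.prob (?B gh) \<le> \<delta>' / (2 * l ^ 2)" by (simp only: prob_shift[OF mQ])
      qed
      also have "\<dots> = \<delta>' / 2" using l(2) by (simp add: power2_eq_square)
      finally show ?thesis .
    qed
    ultimately show ?thesis by linarith
  qed
  then show ?thesis by blast
qed

text \<open>All coordinates advance at once and stop at their targets. Consecutive points are then
  sup-norm neighbours, as \<open>hop_uniformly_integrable\<close> demands, and
  \<open>norm1 v\<close> steps suffice.\<close>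

lemma unit_path:
  fixes v :: "int^'d::finite"
  shows "\<exists>w. w 0 = y \<and> w (nat (norm1 v)) = y + v \<and> (\<forall>j. w (Suc j) \<in> cube (w j) 1)"
proof -
  define c where "c j a = (if a \<ge> 0 then min a (int j) else max a (- int j))" for j :: nat and a :: int
  define w where "w j = y + (\<chi> i. c j (v $ i))" for j
  have "w 0 = y" by (simp add: w_def c_def vec_eq_iff)
  moreover have "w (nat (norm1 v)) = y + v"
  proof -
    have "\<bar>v $ i\<bar> \<le> norm1 v" for i unfolding norm1_def by (rule member_le_sum) auto
    then have "c (nat (norm1 v)) (v $ i) = v $ i" for i
      using abs_le_D1 abs_le_D2 by (fastforce simp: c_def min_def max_def)
    then show ?thesis by (simp add: w_def vec_eq_iff)
  qed
  moreover have "w (Suc j) \<in> cube (w j) 1" for j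
    by (auto simp: w_def cube_def c_def)
  ultimately show ?thesis by blast
qed

text \<open>The triangle inequality survives truncation: if one hop on the right exceeds
  \<open>M\<close>, the right side is already at least \<open>M\<close>.\<close>

lemma hop_min_path:
  assumes "1 \<le> n"
  shows "hop_min M (w 0) (w n) s \<le> (\<Sum>j<n. hop_min M (w j) (w (Suc j)) s)"
proof (cases "\<exists>j<n. \<not> hop (w j) (w (Suc j)) s \<le> enat M")
  case True
  then obtain j where j: "j < n" "\<not> hop (w j) (w (Suc j)) s \<le> enat M" by blast
  then have "hop_min M (w j) (w (Suc j)) s = real M" by (simp add: hop_min_def min_absorb1)
  then have "real M \<le> (\<Sum>j<n. hop_min M (w j) (w (Suc j)) s)"
    using member_le_sum[of j "{..<n}" "\<lambda>j. hop_min M (w j) (w (Suc j)) s"] j(1) hop_min_bounds(1)[of M _ _ s] by auto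
  then show ?thesis using hop_min_bounds(2) order_trans by blast
next
  case False
  define a where "a j = the_enat (hop (w j) (w (Suc j)) s)" for j
  have a: "hop (w j) (w (Suc j)) s = enat (a j)" "a j \<le> M" if "j < n" for j
  proof -
    have "hop (w j) (w (Suc j)) s \<le> enat M" using False that by blast
    then show "hop (w j) (w (Suc j)) s = enat (a j)" "a j \<le> M"
      by (cases "hop (w j) (w (Suc j)) s"; simp add: a_def)+
  qed
  have "hop (w 0) (w n) s \<le> (\<Sum>j<n. hop (w j) (w (Suc j)) s)"
    using fpt_path_le[OF assms, of s "\<lambda>j. site (w j) s"] by (simp add: hop_def)
  also have "\<dots> = (\<Sum>j<n. enat (a j))" using a by simp
  also have "\<dots> = enat (\<Sum>j<n. a j)" by (induction n) (auto simp: zero_enat_def)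
  finally have "hop_min M (w 0) (w n) s \<le> real (\<Sum>j<n. a j)" by (rule hop_min_le)
  also have "\<dots> = (\<Sum>j<n. hop_min M (w j) (w (Suc j)) s)"
    using a by (simp add: hop_min_def min_absorb2)
  finally show ?thesis .
qed

text \<open>Uniform integrability of unit hops turns convergence in probability into an upper bound
  for means, since a path of \<open>norm1 v\<close> unit hops dominates the long hop.
  \<open>R\<close> is chosen before \<open>M\<close>: later the piece length is fixed while
  \<open>M\<close> grows.\<close>

lemma mean_hop:
  fixes mu :: "real^'d::finite \<Rightarrow> real" and \<eta> :: real
  assumes nu: "pmf nu 0 < 1" and norm: "is_norm mu"
    and lim: "AE s in frog_space nu. fst s 0 \<ge> 1 \<longrightarrow>
          ((\<lambda>x. (ereal_of_enat (fpt s 0 x) - ereal (mu (real_vec x)))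
                   / ereal (real_of_int (norm1 x))) \<longlongrightarrow> 0) norm1_infty"
    and eta: "\<eta> > 0"
  shows "\<exists>R. \<forall>M. \<forall>y v::int^'d. norm1 v \<ge> R \<longrightarrow>
    integral\<^sup>L (frog_space nu) (hop_min M y (y + v)) \<le> mu (real_vec v) + \<eta> * norm1 v"
proof -
  interpret F: prob_space "frog_space nu :: 'd sample measure" by (rule prob_space_frog_space)
  obtain k where k: "\<forall>M. \<forall>y::int^'d. \<forall>y'\<in>cube y 1.
    integral\<^sup>L (frog_space nu) (\<lambda>s. hop_min M y y' s * of_bool (\<not> hop y y' s \<le> enat k)) \<le> \<eta> / 3"
    using hop_uniformly_integrable[OF nu, of "\<eta> / 3", where 'd='d] eta by auto
  obtain R0 where R0: "\<forall>y v::int^'d. norm1 v \<ge> R0 \<longrightarrow>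
    F.prob {s. \<not> ereal_of_enat (hop y (y + v) s) \<le> ereal (mu (real_vec v) + \<eta> / 3 * norm1 v)} \<le> \<eta> / (3 * (real k + 1))"
    using hop_in_probability[OF nu norm lim, of "\<eta> / 3" "\<eta> / (3 * (real k + 1))"] eta by auto
  define R where "R = max R0 1"
  have "integral\<^sup>L (frog_space nu) (hop_min M y (y + v)) \<le> mu (real_vec v) + \<eta> * norm1 v"
    if v: "norm1 v \<ge> R" for M and y v :: "int^'d"
  proof -
    define n where "n = nat (norm1 v)"
    have n: "n \<ge> 1" "real n = real_of_int (norm1 v)" using v by (auto simp: n_def R_def)
    obtain w where w: "w 0 = y" "w n = y + v" "\<forall>j. w (Suc j) \<in> cube (w j) 1"
      using unit_path[of y v] unfolding n_def by blast
    define b where "b = mu (real_vec v) + \<eta> / 3 * norm1 v"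
    have b0: "b \<ge> 0" using is_normD(1)[OF norm] eta by (simp add: b_def)
    define D where "D s \<longleftrightarrow> \<not> ereal_of_enat (hop y (y + v) s) \<le> ereal b" for s
    have mD [measurable]: "Measurable.pred (frog_space nu) D"
      unfolding D_def by (rule measurable_compose[OF measurable_hop]) simp
    let ?h = "\<lambda>j s. hop_min M (w j) (w (Suc j)) s * of_bool (\<not> hop (w j) (w (Suc j)) s \<le> enat k)"
    have h0: "0 \<le> ?h j s" for j s using hop_min_bounds(1)[of M _ _ s] by simp
    \<comment> \<open>Off \<open>D\<close> the hop is at most \<open>b\<close>. On \<open>D\<close>
      each unit hop of the path contributes at most \<open>k\<close> or its excess over that level;
      in the mean both amount to at most \<eta> / 3 per step, the former because \<open>D\<close> is
      made rare after \<open>k\<close> is fixed.\<close>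
    have pw: "hop_min M y (y + v) s \<le> b + (\<Sum>j<n. real k * of_bool (D s) + ?h j s)" for s
    proof (cases "D s")
      case True
      have "hop_min M y (y + v) s \<le> (\<Sum>j<n. hop_min M (w j) (w (Suc j)) s)"
        using hop_min_path[OF n(1), of M w s] w by simp
      also have "\<dots> \<le> (\<Sum>j<n. real k * of_bool (D s) + ?h j s)"
      proof (rule sum_mono)
        fix j
        show "hop_min M (w j) (w (Suc j)) s \<le> real k * of_bool (D s) + ?h j s"
          using True hop_min_le[of "w j" "w (Suc j)" s k M] hop_min_bounds(1)[of M _ _ s] by (cases "hop (w j) (w (Suc j)) s \<le> enat k") auto
      qed
      finally show ?thesis using b0 by linarith
    next
      case False
      then have "hop_min M y (y + v) s \<le> b"
      proof -
        obtain a where a: "hop y (y + v) s = enat a" using False by (cases "hop y (y + v) s") (auto simp: D_def)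
        then have "real a \<le> b" using False by (simp add: D_def)
        moreover have "hop_min M y (y + v) s \<le> real a" by (rule hop_min_le) (simp add: a)
        ultimately show ?thesis by linarith
      qed
      moreover have "0 \<le> (\<Sum>j<n. real k * of_bool (D s) + ?h j s)" using h0 by (intro sum_nonneg add_nonneg_nonneg) auto
      ultimately show ?thesis by linarith
    qed
    have iD: "integrable (frog_space nu) (\<lambda>s. of_bool (D s) :: real)"
      by (rule integrable_bounded[where B=1]) auto
    have ih: "integrable (frog_space nu) (?h j)" for j
      by (rule integrable_bounded[where B="real M"]) (use hop_min_bounds in auto)
    have "integral\<^sup>L (frog_space nu) (hop_min M y (y + v))
       \<le> integral\<^sup>L (frog_space nu) (\<lambda>s. b + (\<Sum>j<n. real k * of_bool (D s) + ?h j s))"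
    proof (rule integral_mono[OF _ _ pw])
      show "integrable (frog_space nu) (hop_min M y (y + v))"
        by (rule integrable_bounded[where B="real M"]) (use hop_min_bounds in auto)
      show "integrable (frog_space nu) (\<lambda>s. b + (\<Sum>j<n. real k * of_bool (D s) + ?h j s))"
        by (intro Bochner_Integration.integrable_add Bochner_Integration.integrable_sum integrable_mult_right iD ih) simp
    qed
    also have "\<dots> = b + (\<Sum>j<n. real k * F.prob {s. D s} + integral\<^sup>L (frog_space nu) (?h j))"
      using iD ih
      by (subst Bochner_Integration.integral_add) (auto simp: expectation_of_bool[OF mD, symmetric]
          Bochner_Integration.integral_sum F.prob_space[simplified] intro!: Bochner_Integration.integrable_add Bochner_Integration.integrable_sum integrable_mult_right)
    also have "\<dots> \<le> b + (\<Sum>j<n. \<eta> / 3 + \<eta> / 3)"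
    proof (intro add_left_mono sum_mono add_mono)
      fix j
      have "F.prob {s. D s} \<le> \<eta> / (3 * (real k + 1))"
        unfolding D_def b_def by (rule R0[rule_format]) (use v in \<open>simp add: R_def\<close>)
      then have "k * F.prob {s. D s} \<le> (real k + 1) * (\<eta> / (3 * (real k + 1)))"
        by (intro mult_mono) auto
      also have "\<dots> = \<eta> / 3" by (simp add: field_simps)
      finally show "k * F.prob {s. D s} \<le> \<eta> / 3" .
      show "integral\<^sup>L (frog_space nu) (?h j) \<le> \<eta> / 3"
        using k w(3) by blast
    qed
    also have "\<dots> = mu (real_vec v) + \<eta> * norm1 v" by (simp add: b_def n(2)[symmetric])
    finally show ?thesis .
  qed
  then show ?thesis by blast
qed

section \<open>Concentration along a segment\<close>

text \<open>Within a residue class the regions are disjoint, so the summands are independent and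
  Hoeffding's inequality applies. If no class exceeds its mean by \<open>t\<close>, the total stays
  below its mean plus q t.\<close>

lemma concentration_mod_classes:
  fixes f :: "nat \<Rightarrow> 'd::finite sample \<Rightarrow> real" and m q :: nat and B t :: real
  assumes disj: "\<And>i j. i < m \<Longrightarrow> j < m \<Longrightarrow> i \<noteq> j \<Longrightarrow> i mod q = j mod q \<Longrightarrow> K i \<inter> K j = {}"
    and meas: "\<And>i. f i \<in> borel_measurable (frog_space nu)"
    and bounds: "\<And>i s. 0 \<le> f i s" "\<And>i s. f i s \<le> B"
    and pos: "B > 0" "q > 0" "t > 0"
  shows "measure (frog_space nu) {s. (\<Sum>i<m. f i (rst (K i) s)) \<ge>
      (\<Sum>i<m. integral\<^sup>L (frog_space nu) (\<lambda>s. f i (rst (K i) s))) + q * t} \<le> q * exp (- 2 * t\<^sup>2 / (m * B\<^sup>2))"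
proof -
  interpret F: prob_space "frog_space nu :: 'd sample measure" by (rule prob_space_frog_space)
  define X where "X i s = f i (rst (K i) s)" for i s
  define e where "e i = F.expectation (X i)" for i
  have mX [measurable]: "X i \<in> borel_measurable (frog_space nu)" for i
    unfolding X_def by (rule measurable_compose[OF measurable_rst meas])
  define I where "I r = {i\<in>{..<m}. i mod q = r}" for r
  have fI: "finite (I r)" for r by (simp add: I_def)
  let ?E = "\<lambda>r. {s. (\<Sum>i\<in>I r. X i s) \<ge> (\<Sum>i\<in>I r. e i) + t}"
  have mE: "?E r \<in> F.events" for r by (rule sets_frogI) measurable
  have per_class: "F.prob (?E r) \<le> exp (- 2 * t\<^sup>2 / (m * B\<^sup>2))" for r
  proof (cases "I r = {}")
    case True
    then have e: "?E r = {}" using pos by auto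
    show ?thesis unfolding e by simp
  next
    case False
    have "disjoint_family_on K (I r)"
      using disj by (auto simp: disjoint_family_on_def I_def)
    then have "F.indep_vars (\<lambda>_. borel) (\<lambda>i s. f i (rst (K i) s)) (I r)"
      by (rule F.indep_vars_compose2[OF indep_vars_rst]) (rule meas)
    then have ind: "F.indep_vars (\<lambda>_. borel) X (I r)" by (simp add: X_def[abs_def])
    interpret H: Hoeffding_ineq "frog_space nu" "I r" X "\<lambda>_. 0" "\<lambda>_. B" "\<Sum>i\<in>I r. e i"
      by unfold_locales (use fI ind bounds in \<open>auto simp: e_def X_def\<close>)
    have card: "card (I r) > 0" "card (I r) \<le> m"
      using False fI card_mono[of "{..<m}" "I r"] by (auto simp: card_gt_0_iff I_def)
    have S: "(\<Sum>i\<in>I r. (B - 0)\<^sup>2) = card (I r) * B\<^sup>2" by simp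
    have "F.prob (?E r) \<le> exp (- 2 * t\<^sup>2 / (card (I r) * B\<^sup>2))"
      using H.Hoeffding_ineq_ge[of t] pos card unfolding S by simp
    also have "\<dots> \<le> exp (- 2 * t\<^sup>2 / (m * B\<^sup>2))"
    proof -
      have "2 * t\<^sup>2 / (m * B\<^sup>2) \<le> 2 * t\<^sup>2 / (card (I r) * B\<^sup>2)"
        using card pos by (intro divide_left_mono mult_right_mono mult_pos_pos) auto
      then show ?thesis by simp
    qed
    finally show ?thesis .
  qed
  have split: "(\<Sum>i<m. g i) = (\<Sum>r<q. \<Sum>i\<in>I r. g i)" for g :: "nat \<Rightarrow> real"
    unfolding I_def by (rule sum.group[symmetric]) (use pos in auto)
  have "{s. (\<Sum>i<m. X i s) \<ge> (\<Sum>i<m. e i) + q * t} \<subseteq> (\<Union>r\<in>{..<q}. ?E r)"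
  proof (rule ccontr)
    assume "\<not> ?thesis"
    then obtain s where s: "(\<Sum>i<m. X i s) \<ge> (\<Sum>i<m. e i) + q * t" and n: "\<And>r. r < q \<Longrightarrow> s \<notin> ?E r" by blast
    have "(\<Sum>r<q. \<Sum>i\<in>I r. X i s) < (\<Sum>r<q. (\<Sum>i\<in>I r. e i) + t)"
      by (rule sum_strict_mono) (use n pos in \<open>force+\<close>)
    then show False using s unfolding split sum.distrib by simp
  qed
  then have "F.prob {s. (\<Sum>i<m. X i s) \<ge> (\<Sum>i<m. e i) + q * t} \<le> F.prob (\<Union>r\<in>{..<q}. ?E r)"
    using mE by (intro F.finite_measure_mono sets.finite_UN) auto
  also have "\<dots> \<le> (\<Sum>r<q. F.prob (?E r))"
    using mE by (intro F.finite_measure_subadditive_finite) auto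
  also have "\<dots> \<le> (\<Sum>r<q. exp (- 2 * t\<^sup>2 / (m * B\<^sup>2)))" by (intro sum_mono per_class)
  finally show ?thesis by (simp add: X_def e_def[unfolded X_def])
qed

text \<open>A hop of duration at most \<open>M\<close> uses only frogs of \<open>K\<close>. A longer
  one gets longer still when frogs are removed, so both sides equal \<open>M\<close>.\<close>

lemma hop_min_rst:
  assumes u: "unit_sample s" and n: "near l y s" "near l y' s"
    and K: "cube y l \<subseteq> K" "cube y' l \<subseteq> K" "cube y (l + M) \<subseteq> K"
  shows "hop_min M y y' (rst K s) = hop_min M y y' s"
proof -
  have h: "hop y y' (rst K s) = fpt (rst K s) (site y s) (site y' s)"
    using n K by (simp add: hop_def site_rst)
  show ?thesis
  proof (cases "hop y y' s \<le> enat M")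
    case True
    have "cube (site y s) M \<subseteq> K" using K(3) near_site_cube[OF n(1)] cube_trans by blast
    then have "hop y y' (rst K s) = hop y y' s"
      unfolding h using fpt_rst_eq[OF u] True by (simp add: hop_def)
    then show ?thesis by (simp add: hop_min_def)
  next
    case False
    moreover from this have "\<not> hop y y' (rst K s) \<le> enat M"
      using fpt_rst_ge[of s "site y s" "site y' s" K] order_trans unfolding h by (auto simp: hop_def)
    ultimately show ?thesis by (simp add: hop_min_def min_absorb1)
  qed
qed

section \<open>Cutting the segment into pieces\<close>

definition waypoint :: "nat \<Rightarrow> int^'d::finite \<Rightarrow> nat \<Rightarrow> int^'d" where
  "waypoint m x i = (\<chi> k. (int i * x $ k) div int m)"

lemma waypoint_0 [simp]: "waypoint m x 0 = 0"
  by (simp add: waypoint_def vec_eq_iff)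

lemma waypoint_last: "m > 0 \<Longrightarrow> waypoint m x m = x"
  by (simp add: waypoint_def vec_eq_iff)

lemma div_diff_bounds:
  assumes "m > 0"
  shows "\<bar>real_of_int (a div int m - b div int m) - real_of_int (a - b) / real m\<bar> < 1"
proof -
  have a: "real_of_int (a div int m) = of_int \<lfloor>real_of_int a / real m\<rfloor>" for a
    using floor_divide_of_int_eq[of a "int m", where 'a=real] by simp
  have "real_of_int (a - b) / real m = real_of_int a / real m - real_of_int b / real m" by (simp add: diff_divide_distrib)
  then show ?thesis using a[of a] a[of b] by simp linarith
qed

text \<open>Both points are rounded down, so the two rounding errors partly cancel and the
  difference errs by less than 1.\<close>

lemma waypoint_diff:
  assumes "m > 0"
  shows "\<bar>real_of_int (waypoint m x j $ k - waypoint m x i $ k) - (real j - real i) * (real_of_int (x $ k) / real m)\<bar> < 1"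
proof -
  have e: "real_of_int (int j * x $ k - int i * x $ k) / real m = (real j - real i) * (real_of_int (x $ k) / real m)"
    by (simp add: left_diff_distrib diff_divide_distrib)
  show ?thesis
    using div_diff_bounds[OF assms, of "int j * x $ k" "int i * x $ k"] unfolding e by (simp add: waypoint_def)
qed

lemma norm1_real: "real_of_int (norm1 x) = (\<Sum>k\<in>UNIV. \<bar>real_of_int (x $ k)\<bar>)"
  by (simp add: norm1_def)

lemma waypoint_norm1:
  fixes x :: "int^'d::finite" and i :: nat
  assumes "m > 0"
  defines "v \<equiv> waypoint m x (Suc i) - waypoint m x i"
  shows "norm1 x / m - CARD('d) \<le> norm1 v" "norm1 v \<le> norm1 x / m + CARD('d)"
proof -
  have v: "\<bar>real_of_int (v $ k) - real_of_int (x $ k) / real m\<bar> < 1" for k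
    using waypoint_diff[OF assms(1), of x "Suc i" k i] by (simp add: v_def)
  have n: "norm1 x / m = (\<Sum>k\<in>UNIV. \<bar>real_of_int (x $ k) / real m\<bar>)"
    by (simp add: norm1_real sum_divide_distrib)
  have "(\<Sum>k::'d\<in>UNIV. \<bar>real_of_int (x $ k) / real m\<bar>) \<le> (\<Sum>k\<in>UNIV. \<bar>real_of_int (v $ k)\<bar> + 1)"
  proof (rule sum_mono)
    fix k show "\<bar>real_of_int (x $ k) / real m\<bar> \<le> \<bar>real_of_int (v $ k)\<bar> + 1" using v[of k] by linarith
  qed
  then show "norm1 x / m - CARD('d) \<le> norm1 v" unfolding n by (simp add: norm1_real sum.distrib)
  have "(\<Sum>k::'d\<in>UNIV. \<bar>real_of_int (v $ k)\<bar>) \<le> (\<Sum>k\<in>UNIV. \<bar>real_of_int (x $ k) / real m\<bar> + 1)"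
  proof (rule sum_mono)
    fix k show "\<bar>real_of_int (v $ k)\<bar> \<le> \<bar>real_of_int (x $ k) / real m\<bar> + 1" using v[of k] by linarith
  qed
  then show "norm1 v \<le> norm1 x / m + CARD('d)" unfolding n by (simp add: norm1_real sum.distrib)
qed

lemma cube_norm1: "norm1 (w - y) \<le> int l \<Longrightarrow> w \<in> cube y l"
proof -
  assume h: "norm1 (w - y) \<le> int l"
  have "\<bar>(w - y) $ i\<bar> \<le> norm1 (w - y)" for i unfolding norm1_def by (rule member_le_sum) auto
  then show ?thesis using h unfolding cube_def by (auto intro: order_trans)
qed

text \<open>Some coordinate \<open>k\<close> carries at least the fraction 1/d of
  \<open>norm1 x\<close>. Along it, each index step advances by at least 1/d on average, so indices
  that differ by at least \<open>q\<close> are 2D + 2 apart up to a rounding error below 1.\<close>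

lemma waypoint_cubes_disjoint:
  fixes x :: "int^'d::finite"
  assumes m: "m > 0" "real m \<le> norm1 x" and ij: "i \<noteq> j" "i mod q = j mod q"
    and q: "q \<ge> CARD('d) * (2 * D + 2)"
  shows "cube (waypoint m x i) D \<inter> cube (waypoint m x j) D = {}"
proof (rule ccontr)
  assume "cube (waypoint m x i) D \<inter> cube (waypoint m x j) D \<noteq> {}"
  then obtain z where z: "z \<in> cube (waypoint m x i) D" "z \<in> cube (waypoint m x j) D" by blast
  let ?d = "real CARD('d)"
  have d0: "?d > 0" by simp
  obtain k where k: "real_of_int (norm1 x) \<le> ?d * \<bar>real_of_int (x $ k)\<bar>"
  proof (rule ccontr)
    assume "\<not> thesis"
    then have "\<forall>k. ?d * \<bar>real_of_int (x $ k)\<bar> < real_of_int (norm1 x)" using that by (meson not_le)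
    then have "(\<Sum>k::'d\<in>UNIV. ?d * \<bar>real_of_int (x $ k)\<bar>) < (\<Sum>k::'d\<in>UNIV. real_of_int (norm1 x))"
      by (intro sum_strict_mono) auto
    then show False unfolding sum_distrib_left[symmetric] norm1_real[symmetric] by simp
  qed
  have "q \<le> (if i < j then j - i else i - j)"
    using ij mod_eq_dvd_iff_nat[of i j q] mod_eq_dvd_iff_nat[of j i q] by (auto intro: dvd_imp_le)
  then have "real q \<le> real (if i < j then j - i else i - j)" by (simp only: of_nat_le_iff)
  then have qd: "real q \<le> \<bar>real j - real i\<bar>" by (auto split: if_splits)
  have "1 \<le> ?d * (\<bar>real_of_int (x $ k)\<bar> / real m)"
    using order_trans[OF m(2) k] m(1) by (simp add: field_simps)
  then have "real q * 1 \<le> \<bar>real j - real i\<bar> * (?d * (\<bar>real_of_int (x $ k)\<bar> / real m))"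
    using qd by (intro mult_mono) auto
  moreover have "?d * (2 * real D + 2) \<le> real q"
  proof -
    have "real (CARD('d) * (2 * D + 2)) \<le> real q" using q by (simp only: of_nat_le_iff)
    then show ?thesis by (simp add: algebra_simps)
  qed
  ultimately have "?d * (2 * real D + 2) \<le> ?d * (\<bar>real j - real i\<bar> * (\<bar>real_of_int (x $ k)\<bar> / real m))"
    by (simp add: mult.left_commute)
  then have "2 * real D + 2 \<le> \<bar>real j - real i\<bar> * (\<bar>real_of_int (x $ k)\<bar> / real m)"
    by (rule mult_left_le_imp_le) (rule d0)
  also have "\<dots> = \<bar>(real j - real i) * (real_of_int (x $ k) / real m)\<bar>" by (simp add: abs_mult)
  also have "\<dots> < \<bar>real_of_int (waypoint m x j $ k - waypoint m x i $ k)\<bar> + 1"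
    using waypoint_diff[OF m(1), of x j k i] by linarith
  finally have "2 * real D + 1 < \<bar>real_of_int (waypoint m x j $ k - waypoint m x i $ k)\<bar>" by linarith
  moreover have "\<bar>z $ k - waypoint m x i $ k\<bar> \<le> int D" "\<bar>z $ k - waypoint m x j $ k\<bar> \<le> int D"
    using z by (auto simp: cube_def)
  ultimately show False by linarith
qed

section \<open>Norms on the lattice\<close>

lemma norm_le_sum_axis:
  fixes mu :: "real^'d::finite \<Rightarrow> real"
  assumes "is_norm mu"
  shows "mu v \<le> (\<Sum>k\<in>UNIV. \<bar>v $ k\<bar> * mu (axis k 1))"
proof -
  have z: "mu 0 = 0" using is_normD(2)[OF assms, of 0 0] by simp
  have "mu (\<Sum>k\<in>A. v $ k *\<^sub>R axis k 1) \<le> (\<Sum>k\<in>A. \<bar>v $ k\<bar> * mu (axis k 1))" if "finite A" for A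
    using that
  proof induction
    case (insert k A)
    then show ?case
      using is_normD(3)[OF assms, of "v $ k *\<^sub>R axis k 1" "\<Sum>k\<in>A. v $ k *\<^sub>R axis k 1"]
      by (simp add: is_normD(2)[OF assms])
  qed (simp add: z)
  moreover have "(\<Sum>k\<in>UNIV. v $ k *\<^sub>R axis k 1) = v"
    by (simp add: vec_eq_iff axis_def if_distrib cong: if_cong)
  ultimately show ?thesis by (metis finite)
qed

text \<open>Bounding \<open>mu\<close> by a multiple of the Euclidean norm makes it Lipschitz, hence
  continuous. It then attains a positive minimum on the compact Euclidean unit sphere.\<close>

lemma norm_ge_norm1:
  fixes mu :: "real^'d::finite \<Rightarrow> real"
  assumes n: "is_norm mu"
  shows "\<exists>c>0. \<forall>x. c * real_of_int (norm1 x) \<le> mu (real_vec x)"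
proof -
  define b where "b = (\<Sum>k\<in>UNIV. mu (axis k 1 :: real^'d))"
  have b0: "b \<ge> 0" unfolding b_def by (intro sum_nonneg is_normD(1)[OF n])
  have ub: "mu v \<le> b * norm v" for v
  proof -
    have "mu v \<le> (\<Sum>k\<in>UNIV. \<bar>v $ k\<bar> * mu (axis k 1))" by (rule norm_le_sum_axis[OF n])
    also have "\<dots> \<le> (\<Sum>k\<in>UNIV. norm v * mu (axis k 1))"
      by (intro sum_mono mult_right_mono component_le_norm_cart is_normD(1)[OF n])
    finally show ?thesis by (simp add: b_def sum_distrib_left mult.commute)
  qed
  have neg: "mu (- v) = mu v" for v using is_normD(2)[OF n, of "-1" v] by simp
  have lip: "\<bar>mu u - mu v\<bar> \<le> b * norm (u - v)" for u v
    using is_normD(3)[OF n, of "u - v" v] is_normD(3)[OF n, of "v - u" u] ub[of "u - v"] neg[of "u - v"] by simp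
  have "continuous_on (sphere 0 1) mu"
  proof (rule continuous_onI)
    fix v :: "real^'d" and e :: real assume e: "e > 0"
    have "dist (mu u) (mu v) \<le> e" if "dist u v < e / (b + 1)" for u
    proof -
      have "\<bar>mu u - mu v\<bar> \<le> b * norm (u - v)" by (rule lip)
      also have "\<dots> \<le> (b + 1) * (e / (b + 1))"
        using that b0 by (intro mult_mono) (auto simp: dist_norm)
      also have "\<dots> = e" using b0 by simp
      finally show ?thesis by (simp add: dist_real_def)
    qed
    then show "\<exists>d>0. \<forall>u\<in>sphere 0 1. dist u v < d \<longrightarrow> dist (mu u) (mu v) \<le> e"
      using e b0 by (intro exI[of _ "e / (b + 1)"]) auto
  qed
  moreover have "sphere (0::real^'d) 1 \<noteq> {}" by simp
  ultimately obtain u where u: "u \<in> sphere 0 1" "\<And>v. v \<in> sphere 0 1 \<Longrightarrow> mu u \<le> mu v"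
    using continuous_attains_inf[OF compact_sphere] by blast
  have "u \<noteq> 0" using u(1) by auto
  then have mu0: "mu u > 0" using n by (metis is_norm_def order_less_le)
  have lb: "mu u * norm v \<le> mu v" for v
  proof (cases "v = 0")
    case False
    have "mu u \<le> mu ((1 / norm v) *\<^sub>R v)" by (rule u(2)) (use False in simp)
    also have "\<dots> = mu v / norm v" unfolding is_normD(2)[OF n] by simp
    finally show ?thesis using False by (simp add: field_simps)
  qed (use is_normD(1)[OF n] in simp)
  have "mu u / CARD('d) * real_of_int (norm1 x) \<le> mu (real_vec x)" for x
  proof -
    have "real_of_int (norm1 x) \<le> (\<Sum>k::'d\<in>UNIV. norm (real_vec x))"
      unfolding norm1_real
    proof (rule sum_mono)
      fix k show "\<bar>real_of_int (x $ k)\<bar> \<le> norm (real_vec x)"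
        using component_le_norm_cart[of "real_vec x" k] by (simp add: real_vec_def)
    qed
    then have "mu u / CARD('d) * real_of_int (norm1 x) \<le> mu u / CARD('d) * (CARD('d) * norm (real_vec x))"
      using mu0 by (intro mult_left_mono) auto
    also have "\<dots> \<le> mu (real_vec x)" using lb[of "real_vec x"] by simp
    finally show ?thesis .
  qed
  moreover have "mu u / CARD('d) > 0" using mu0 by simp
  ultimately show ?thesis by blast
qed

text \<open>A piece differs from x / m by at most 1 in every coordinate, which costs a constant
  independent of \<open>x\<close> and \<open>m\<close>.\<close>

lemma waypoint_norm:
  fixes mu :: "real^'d::finite \<Rightarrow> real"
  assumes n: "is_norm mu" and m: "m > 0"
  shows "mu (real_vec (waypoint m x (Suc i) - waypoint m x i)) \<le> mu (real_vec x) / m + (\<Sum>k\<in>UNIV. mu (axis k 1))"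
proof -
  define v where "v = waypoint m x (Suc i) - waypoint m x i"
  let ?w = "real_vec v - (1 / real m) *\<^sub>R real_vec x"
  have "mu ?w \<le> (\<Sum>k\<in>UNIV. \<bar>?w $ k\<bar> * mu (axis k 1))" by (rule norm_le_sum_axis[OF n])
  also have "\<dots> \<le> (\<Sum>k\<in>UNIV. 1 * mu (axis k 1))"
  proof (intro sum_mono mult_right_mono is_normD(1)[OF n])
    fix k
    show "\<bar>?w $ k\<bar> \<le> 1"
      using waypoint_diff[OF m, of x "Suc i" k i] by (simp add: real_vec_def v_def)
  qed
  finally have "mu ?w \<le> (\<Sum>k\<in>UNIV. mu (axis k 1))" by simp
  moreover have "mu (real_vec v) \<le> mu ((1 / real m) *\<^sub>R real_vec x) + mu ?w"
    using is_normD(3)[OF n, of "(1 / real m) *\<^sub>R real_vec x" ?w] by simp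
  moreover have "mu ((1 / real m) *\<^sub>R real_vec x) = mu (real_vec x) / m"
    unfolding is_normD(2)[OF n] by simp
  ultimately show ?thesis by (simp add: v_def)
qed

text \<open>Outside four rare events (a sample with illegal steps, an atypical hop, a slow last leg
  into \<open>x\<close>, a large deviation of the localised hops) the concatenated path is faster
  than (1 + \<epsilon>) \<open>mu (real_vec x)\<close>. The lower bound on \<open>norm1 x\<close>
  serves the Hoeffding exponent; the upper one keeps the number of pieces polynomial in
  \<open>l\<close>.\<close>

lemma deviation_at_scale:
  fixes mu :: "real^'d::finite \<Rightarrow> real" and \<epsilon> :: real
  assumes nu: "pmf nu 0 < 1" and norm: "is_norm mu"
    and lim: "AE s in frog_space nu. fst s 0 \<ge> 1 \<longrightarrow>
          ((\<lambda>x. (ereal_of_enat (fpt s 0 x) - ereal (mu (real_vec x)))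
                   / ereal (real_of_int (norm1 x))) \<longlongrightarrow> 0) norm1_infty"
    and eps: "\<epsilon> > 0"
  shows "\<exists>B>0. \<exists>c>0. \<exists>l0. \<forall>l\<ge>l0. \<forall>x::int^'d. int l ^ 22 \<le> norm1 x \<longrightarrow> norm1 x \<le> (2 * int l) ^ 22 \<longrightarrow>
    measure (frog_space nu) {s. 1 \<le> fst s 0 \<and> ereal ((1 + \<epsilon>) * mu (real_vec x)) \<le> ereal_of_enat (fpt s 0 x)} \<le> B * exp (- c * real l)"
proof -
  interpret F: prob_space "frog_space nu :: 'd sample measure" by (rule prob_space_frog_space)
  let ?d = "real CARD('d)"
  obtain C1 A1 c1 where A1: "A1 > 0" "c1 > 0"
    and tail1: "\<forall>l\<ge>1. \<forall>x::int^'d. \<forall>y\<in>cube x l.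
      F.prob {s. 1 \<le> fst s x \<and> \<not> fpt s x y \<le> enat (C1 * l ^ 5)} \<le> A1 * exp (- c1 * real l)"
    using tail[OF nu, where 'd='d] by blast
  obtain C2 A2 c2 where C2: "C2 \<ge> 1" and A2: "A2 > 0" "c2 > 0"
    and tail2: "\<forall>l\<ge>1. \<forall>y::int^'d. \<forall>y'\<in>cube y l.
      F.prob {s. \<not> (near l y s \<and> near l y' s \<and> hop y y' s \<le> enat (C2 * l ^ 5))} \<le> A2 * exp (- c2 * real l)"
    using hop_tail[OF nu, where 'd='d] by blast
  define C where "C = C1 + C2"
  obtain cm where cm: "cm > 0" "\<And>x. cm * real_of_int (norm1 x) \<le> mu (real_vec x)"
    using norm_ge_norm1[OF norm] by blast
  \<comment> \<open>The budget is five errors of size \<kappa> n: three in the means, one for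
    concentration, one for the last leg. Together they are \<epsilon> / 2 times cm n, at most half
    of \<epsilon> \<open>mu (real_vec x)\<close>.\<close>
  define \<kappa> where "\<kappa> = \<epsilon> * cm / 10"
  have kap: "\<kappa> > 0" using eps cm by (simp add: \<kappa>_def)
  define b where "b = (\<Sum>k\<in>UNIV. mu (axis k 1 :: real^'d))"
  have b0: "b \<ge> 0" unfolding b_def by (intro sum_nonneg is_normD(1)[OF norm])
  obtain R where R: "\<forall>M. \<forall>y v::int^'d. norm1 v \<ge> R \<longrightarrow>
    integral\<^sup>L (frog_space nu) (hop_min M y (y + v)) \<le> mu (real_vec v) + \<kappa> * norm1 v"
    using mean_hop[OF nu norm lim kap] by blast
  \<comment> \<open>The fixed piece length. Rounding errors of a piece stay below \<kappa> L, and
    even after losing d to rounding a piece is long enough for \<open>mean_hop\<close>.\<close>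
  define L where "L = nat \<lceil>max ((b + \<kappa> * ?d) / \<kappa>) (max (R + ?d) 1)\<rceil>"
  have L: "(b + \<kappa> * ?d) / \<kappa> \<le> L" "R + ?d \<le> L" "1 \<le> L" unfolding L_def by linarith+
  have L': "b + \<kappa> * ?d \<le> \<kappa> * L" using L(1) kap by (simp add: field_simps)
  \<comment> \<open>The constant in the Hoeffding exponent: 64 d^2 C^4 l^20 bounds the square of q M
    below.\<close>
  define c4 where "c4 = 2 * \<kappa>\<^sup>2 / (64 * ?d\<^sup>2 * real C ^ 4)"
  have C0: "C \<ge> 1" using C2 by (simp add: C_def)
  have c4: "c4 > 0" using kap C0 by (simp add: c4_def)
  have ev1: "\<forall>\<^sub>F l in sequentially. real C * real l ^ 5 * (A2 * exp (- c2 * real l)) \<le> \<kappa>"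
  proof -
    have "((\<lambda>l. real C * real l ^ 5 * (A2 * exp (- c2 * real l))) \<longlongrightarrow> 0) sequentially"
      using A2 by real_asymp
    then have "\<forall>\<^sub>F l in sequentially. real C * real l ^ 5 * (A2 * exp (- c2 * real l)) < \<kappa>"
      by (rule order_tendstoD) (rule kap)
    then show ?thesis by eventually_elim simp
  qed
  have ev2: "\<forall>\<^sub>F l in sequentially. real C * real l ^ 5 \<le> \<kappa> * real l ^ 22"
    using kap by real_asymp
  obtain l1 where l1: "\<And>l. l \<ge> l1 \<Longrightarrow> real C * real l ^ 5 * (A2 * exp (- c2 * real l)) \<le> \<kappa>"
    "\<And>l. l \<ge> l1 \<Longrightarrow> real C * real l ^ 5 \<le> \<kappa> * real l ^ 22"
    using eventually_conj[OF ev1 ev2] by (auto simp: eventually_sequentially)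
  obtain B1 where B1: "B1 > 0" "\<And>x. x \<ge> 0 \<Longrightarrow> x ^ 22 * exp (- c2 * x) \<le> B1 * exp (- (c2 / 2) * x)"
    using poly_exp_bound[OF A2(2), of 22] by blast
  obtain B2 where B2: "B2 > 0" "\<And>x. x \<ge> 0 \<Longrightarrow> x ^ 1 * exp (- c1 * x) \<le> B2 * exp (- (c1 / 2) * x)"
    using poly_exp_bound[OF A1(2), of 1] by blast
  obtain B3 where B3: "B3 > 0" "\<And>x::real. x \<ge> 0 \<Longrightarrow> x ^ 5 * exp (- 1 * x) \<le> B3 * exp (- (1 / 2) * x)"
    using poly_exp_bound[OF zero_less_one, of 5] by blast
  define c where "c = min (c2 / 2) (min (c1 / 2) (1 / 2))"
  have c: "c > 0" "c \<le> c2 / 2" "c \<le> c1 / 2" "c \<le> 1 / 2" using A1 A2 by (auto simp: c_def)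
  define B where "B = 2 ^ 22 * A2 * B1 + A1 * B2 + 8 * ?d * C * B3"
  have B: "B > 0" using A1 A2 B1 B2 B3 by (simp add: B_def add_pos_nonneg)
  \<comment> \<open>\<open>l1\<close> keeps the truncation error and the last leg within budget, 2L
    + d bounds the length of a piece, and 1 / c4 ensures c4 l^2 >= l.\<close>
  define l0 where "l0 = max l1 (max (2 * L + CARD('d)) (nat \<lceil>1 / c4\<rceil>))"
  have "F.prob {s. 1 \<le> fst s 0 \<and> ereal ((1 + \<epsilon>) * mu (real_vec x)) \<le> ereal_of_enat (fpt s 0 x)} \<le> B * exp (- c * real l)"
    if l: "l \<ge> l0" and x: "int l ^ 22 \<le> norm1 x" "norm1 x \<le> (2 * int l) ^ 22" for l and x :: "int^'d"
  proof -
    define n where "n = nat (norm1 x)"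
    have n: "real n = real_of_int (norm1 x)" "int n = norm1 x" by (auto simp: n_def)
    have ll: "l \<ge> l1" "l \<ge> 2 * L + CARD('d)" "l \<ge> 1" "1 \<le> c4 * real l"
    proof -
      show "l \<ge> l1" "l \<ge> 2 * L + CARD('d)" using l by (auto simp: l0_def)
      then show "l \<ge> 1" using L(3) by linarith
      have "l \<ge> nat \<lceil>1 / c4\<rceil>" using l by (simp add: l0_def)
      then have "1 / c4 \<le> real l" by linarith
      then show "1 \<le> c4 * real l" using c4 by (simp add: field_simps)
    qed
    have n22: "l ^ 22 \<le> n" "n \<le> (2 * l) ^ 22"
    proof -
      have "int (l ^ 22) \<le> int n" using x(1) unfolding n(2) by simp
      then show "l ^ 22 \<le> n" by (simp only: of_nat_le_iff)
      have "int n \<le> int ((2 * l) ^ 22)" using x(2) unfolding n(2) by simp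
      then show "n \<le> (2 * l) ^ 22" by (simp only: of_nat_le_iff)
    qed
    have ln: "l \<le> n" using self_le_power[OF ll(3), of 22] n22(1) by simp
    define M where "M = C * l ^ 5"
    have M: "l \<le> M" "M \<ge> 1"
    proof -
      have "l \<le> l ^ 5" using ll(3) by (intro self_le_power) auto
      also have "\<dots> \<le> M" using C0 by (simp add: M_def)
      finally show "l \<le> M" .
      then show "M \<ge> 1" using ll(3) by simp
    qed
    define m where "m = n div L"
    have mL: "m * L \<le> n" "n < (m + 1) * L"
      using dividend_less_div_times[of L n] L(3) by (auto simp: m_def)
    have m1: "m \<ge> 1"
    proof (rule ccontr)
      assume "\<not> m \<ge> 1"
      then have "m = 0" by simp
      then have "n < L" using mL(2) by simp
      then show False using ll(2) ln by simp
    qed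
    have mn: "m \<le> n" using mL(1) L(3) mult_le_mono2[of 1 L m] by linarith
    have nm: "L \<le> real n / m" "real n / m \<le> 2 * L"
    proof -
      have "real (m * L) \<le> real n" using mL(1) by (simp only: of_nat_le_iff)
      then show "L \<le> real n / m" using m1 by (simp add: field_simps)
      have "L * 1 \<le> L * m" by (rule mult_le_mono2[OF m1])
      moreover have "(m + 1) * L = L * m + L * 1" by (simp add: algebra_simps)
      ultimately have "n \<le> L * m + L * m" using mL(2) by linarith
      then have "n \<le> 2 * L * m" by simp
      then have "real n \<le> real (2 * L * m)" by (simp only: of_nat_le_iff)
      then show "real n / m \<le> 2 * L" using m1 by (simp add: field_simps)
    qed
    define y where "y = waypoint m x"
    define v where "v i = y (Suc i) - y i" for i
    have yv: "y (Suc i) = y i + v i" for i by (simp add: v_def)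
    have v1: "norm1 (v i) \<ge> R" "norm1 (v i) \<le> int l" "norm1 (v i) \<le> real n / m + ?d" for i
    proof -
      have a: "real n / m - ?d \<le> norm1 (v i)" "norm1 (v i) \<le> real n / m + ?d"
        using waypoint_norm1[of m x i] m1 by (auto simp: v_def y_def n)
      show "norm1 (v i) \<ge> R" using a(1) nm(1) L(2) by linarith
      show "norm1 (v i) \<le> int l" using a(2) nm(2) ll(2) by linarith
      show "norm1 (v i) \<le> real n / m + ?d" by (rule a(2))
    qed
    have yc: "y (Suc i) \<in> cube (y i) l" for i by (rule cube_norm1) (use v1(2)[of i] in \<open>simp add: v_def\<close>)
    \<comment> \<open>As l <= M, this radius contains the cubes that locate both end points and all
      paths of duration \<open>M\<close> from the first one.\<close>
    define D where "D = 3 * M"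
    define K where "K i = cube (y i) D" for i
    have K: "cube (y i) l \<subseteq> K i" "cube (y (Suc i)) l \<subseteq> K i" "cube (y i) (l + M) \<subseteq> K i" for i
    proof -
      show "cube (y i) l \<subseteq> K i" unfolding K_def using M by (intro cube_mono) (simp add: D_def)
      have "cube (y (Suc i)) l \<subseteq> cube (y i) (l + l)" using cube_trans[OF yc] by blast
      also have "\<dots> \<subseteq> K i" unfolding K_def using M by (intro cube_mono) (simp add: D_def)
      finally show "cube (y (Suc i)) l \<subseteq> K i" .
      show "cube (y i) (l + M) \<subseteq> K i" unfolding K_def using M by (intro cube_mono) (simp add: D_def)
    qed
    define G where "G i s \<longleftrightarrow> near l (y i) s \<and> near l (y (Suc i)) s \<and> hop (y i) (y (Suc i)) s \<le> enat (C2 * l ^ 5)" for i s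
    have mG [measurable]: "Measurable.pred (frog_space nu) (G i)" for i unfolding G_def by measurable
    have PG: "F.prob {s. \<not> G i s} \<le> A2 * exp (- c2 * real l)" for i
      unfolding G_def by (rule tail2[rule_format, OF ll(3) yc])
    \<comment> \<open>The localised hop, a function of the frogs in \<open>K i\<close> alone. On
      \<open>G i\<close> it agrees with the truncated hop for unit samples.\<close>
    define Z where "Z i s = hop_min M (y i) (y (Suc i)) (rst (K i) s)" for i s
    have Zeq: "Z i s = hop_min M (y i) (y (Suc i)) s" if "unit_sample s" "G i s" for i s
      unfolding Z_def by (rule hop_min_rst[OF that(1) _ _ K]) (use that(2) in \<open>auto simp: G_def\<close>)
    have mZ [measurable]: "Z i \<in> borel_measurable (frog_space nu)" for i
      unfolding Z_def by (rule measurable_compose[OF measurable_rst measurable_hop_min])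
    have EZ: "F.expectation (Z i) \<le> mu (real_vec x) / m + b + \<kappa> * (real n / m + ?d) + \<kappa>" for i
    proof -
      \<comment> \<open>Off \<open>G i\<close> the two may differ, but by at most \<open>M\<close>,
        which is polynomial in \<open>l\<close>, whereas that event is exponentially rare.\<close>
      have pw: "Z i s \<le> hop_min M (y i) (y (Suc i)) s + (real M * of_bool (\<not> G i s) + real M * of_bool (\<not> unit_sample s))" for s
      proof (cases "unit_sample s \<and> G i s")
        case True then show ?thesis using Zeq by simp
      next
        case False
        have "Z i s \<le> real M" unfolding Z_def by (rule hop_min_bounds)
        with False hop_min_bounds(1)[of M "y i" "y (Suc i)" s] show ?thesis by auto
      qed
      have i1: "integrable (frog_space nu) (hop_min M (y i) (y (Suc i)))"
        by (rule integrable_bounded[where B="real M"]) (use hop_min_bounds in auto)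
      have i2: "integrable (frog_space nu) (\<lambda>s. of_bool (\<not> G i s) :: real)"
        and i3: "integrable (frog_space nu) (\<lambda>s. of_bool (\<not> unit_sample s) :: real)"
        by (rule integrable_bounded[where B=1]; auto)+
      have "F.expectation (Z i) \<le> F.expectation (\<lambda>s. hop_min M (y i) (y (Suc i)) s + (real M * of_bool (\<not> G i s) + real M * of_bool (\<not> unit_sample s)))"
      proof (rule integral_mono[OF _ _ pw])
        show "integrable (frog_space nu) (Z i)"
          by (rule integrable_bounded[where B="real M", OF mZ]) (simp_all add: Z_def hop_min_bounds)
        show "integrable (frog_space nu) (\<lambda>s. hop_min M (y i) (y (Suc i)) s + (real M * of_bool (\<not> G i s) + real M * of_bool (\<not> unit_sample s)))"
          by (intro Bochner_Integration.integrable_add integrable_mult_right i1 i2 i3)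
      qed
      also have "\<dots> = F.expectation (hop_min M (y i) (y (Suc i))) + (real M * F.prob {s. \<not> G i s} + real M * F.prob {s. \<not> unit_sample s})"
      proof -
        have e: "F.expectation (\<lambda>s. of_bool (\<not> G i s)) = F.prob {s. \<not> G i s}"
          "F.expectation (\<lambda>s. of_bool (\<not> unit_sample s)) = F.prob {s. \<not> unit_sample s}"
          by (rule expectation_of_bool, measurable)+
        have j2: "integrable (frog_space nu) (\<lambda>s. real M * of_bool (\<not> G i s))" by (intro integrable_mult_right i2)
        have j3: "integrable (frog_space nu) (\<lambda>s. real M * of_bool (\<not> unit_sample s))" by (intro integrable_mult_right i3)
        show ?thesis
          unfolding Bochner_Integration.integral_add[OF i1 Bochner_Integration.integrable_add[OF j2 j3]]
            Bochner_Integration.integral_add[OF j2 j3] integral_mult_right_zero e ..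
      qed
      finally have 1: "F.expectation (Z i) \<le> F.expectation (hop_min M (y i) (y (Suc i))) + real M * F.prob {s. \<not> G i s}"
        by (simp add: prob_not_unit_sample)
      have "real M * F.prob {s. \<not> G i s} \<le> real M * (A2 * exp (- c2 * real l))" by (intro mult_left_mono PG) simp
      also have "\<dots> \<le> \<kappa>" using l1(1)[OF ll(1)] by (simp add: M_def)
      finally have 2: "real M * F.prob {s. \<not> G i s} \<le> \<kappa>" .
      have "F.expectation (hop_min M (y i) (y (Suc i))) \<le> mu (real_vec (v i)) + \<kappa> * norm1 (v i)"
        unfolding yv by (rule R[rule_format, OF v1(1)])
      moreover have "mu (real_vec (v i)) \<le> mu (real_vec x) / m + b"
        unfolding v_def y_def b_def by (rule waypoint_norm[OF norm]) (use m1 in simp)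
      moreover have "\<kappa> * norm1 (v i) \<le> \<kappa> * (real n / m + ?d)" using kap by (intro mult_left_mono v1(3)) simp
      ultimately show ?thesis using 1 2 by linarith
    qed
    have ES: "(\<Sum>i<m. F.expectation (Z i)) \<le> mu (real_vec x) + 3 * \<kappa> * n"
    proof -
      have "(\<Sum>i<m. F.expectation (Z i)) \<le> (\<Sum>i<m. mu (real_vec x) / m + b + \<kappa> * (real n / m + ?d) + \<kappa>)"
        by (intro sum_mono EZ)
      also have "\<dots> = mu (real_vec x) + m * (b + \<kappa> * ?d) + \<kappa> * n + \<kappa> * m"
        using m1 by (simp add: field_simps)
      also have "m * (b + \<kappa> * ?d) \<le> m * (\<kappa> * L)" by (intro mult_left_mono L') simp
      also have "m * (\<kappa> * L) = \<kappa> * real (m * L)" by simp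
      also have "\<kappa> * real (m * L) \<le> \<kappa> * n" by (rule mult_left_mono[OF of_nat_mono[OF mL(1)] less_imp_le[OF kap]])
      also have "\<kappa> * m \<le> \<kappa> * n" using mn kap by (intro mult_left_mono) auto
      finally show ?thesis by simp
    qed
    define q where "q = CARD('d) * (2 * D + 2)"
    have q0: "q > 0" by (simp add: q_def)
    \<comment> \<open>The share of the total deviation \<kappa> n allotted to each of the
      \<open>q\<close> residue classes.\<close>
    define t where "t = \<kappa> * n / q"
    have n0: "real n > 0" using ln ll(3) by simp
    have t0: "t > 0" using kap q0 n0 by (simp add: t_def)
    let ?Conc = "{s. (\<Sum>i<m. Z i s) \<ge> (\<Sum>i<m. F.expectation (Z i)) + \<kappa> * n}"
    have PC: "F.prob ?Conc \<le> q * exp (- 2 * t\<^sup>2 / (m * (real M)\<^sup>2))"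
    proof -
      have "real q * t = \<kappa> * n" using q0 by (simp add: t_def)
      moreover have "F.prob {s. (\<Sum>i<m. hop_min M (y i) (y (Suc i)) (rst (K i) s)) \<ge>
          (\<Sum>i<m. F.expectation (\<lambda>s. hop_min M (y i) (y (Suc i)) (rst (K i) s))) + real q * t}
        \<le> q * exp (- 2 * t\<^sup>2 / (m * (real M)\<^sup>2))"
      proof (rule concentration_mod_classes[where f="\<lambda>i. hop_min M (y i) (y (Suc i))" and K=K])
        show "K i \<inter> K j = {}" if "i < m" "j < m" "i \<noteq> j" "i mod q = j mod q" for i j
          unfolding K_def y_def
          by (rule waypoint_cubes_disjoint[OF _ _ that(3,4)]) (use m1 mn n(1) in \<open>auto simp: q_def\<close>)
      qed (use M q0 t0 in \<open>auto simp: hop_min_bounds\<close>)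
      ultimately show ?thesis by (simp only: Z_def[abs_def])
    qed
    let ?H = "\<lambda>g. {s. 1 \<le> fst s (ray x g) \<and> \<not> fpt s (ray x g) x \<le> enat (C1 * l ^ 5)}"
    have PH: "F.prob (?H g) \<le> A1 * exp (- c1 * real l)" if "g < l" for g
    proof (rule tail1[rule_format, OF ll(3)])
      show "x \<in> cube (ray x g) l" using that by (subst cube_sym) (auto intro: ray_cube)
    qed
    let ?Bad = "{s. 1 \<le> fst s 0 \<and> ereal ((1 + \<epsilon>) * mu (real_vec x)) \<le> ereal_of_enat (fpt s 0 x)}"
    let ?N = "{s. \<not> unit_sample s}"
    let ?UG = "\<Union>i\<in>{..<m}. {s. \<not> G i s}"
    let ?UH = "\<Union>g\<in>{..<l}. ?H g"
    have sub: "?Bad \<subseteq> ?N \<union> ?UG \<union> ?UH \<union> ?Conc"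
    proof (rule ccontr)
      assume "\<not> ?thesis"
      then obtain s where s: "1 \<le> fst s 0" "ereal ((1 + \<epsilon>) * mu (real_vec x)) \<le> ereal_of_enat (fpt s 0 x)"
        and u: "unit_sample s" and g: "\<And>i. i < m \<Longrightarrow> G i s"
        and h: "\<And>g. g < l \<Longrightarrow> 1 \<le> fst s (ray x g) \<Longrightarrow> fpt s (ray x g) x \<le> enat (C1 * l ^ 5)"
        and z: "\<not> (\<Sum>i<m. Z i s) \<ge> (\<Sum>i<m. F.expectation (Z i)) + \<kappa> * n"
        by blast
      have hopM: "hop (y i) (y (Suc i)) s \<le> enat M" if "i < m" for i
      proof -
        have "C2 * l ^ 5 \<le> M" by (simp add: M_def C_def)
        then have "enat (C2 * l ^ 5) \<le> enat M" by (simp only: enat_ord_simps)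
        then show ?thesis using g[OF that] order_trans unfolding G_def by blast
      qed
      define a where "a i = the_enat (hop (y i) (y (Suc i)) s)" for i
      have a: "hop (y i) (y (Suc i)) s = enat (a i)" "real (a i) = Z i s" if "i < m" for i
      proof -
        show 1: "hop (y i) (y (Suc i)) s = enat (a i)"
          using hopM[OF that] by (cases "hop (y i) (y (Suc i)) s") (auto simp: a_def)
        show "real (a i) = Z i s"
          using hopM[OF that] unfolding Zeq[OF u g[OF that]] by (simp add: hop_min_def 1 min_absorb2)
      qed
      have y0: "y 0 = 0" "y m = x" using m1 waypoint_last[of m x] by (auto simp: y_def)
      \<comment> \<open>The last waypoint is \<open>x\<close> itself, so the event for the last
        piece already provides an occupied site near \<open>x\<close>.\<close>
      have near_x: "near l x s"
      proof -
        have "G (m - 1) s" by (rule g) (use m1 in simp)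
        then show ?thesis using y0(2) m1 by (simp add: G_def)
      qed
      \<comment> \<open>On the conditioning event 0 is occupied, so the first hop starts exactly
        there. The last hop ends at \<open>site x s\<close>, which may differ from \<open>x\<close>;
        hence the extra leg \<open>f2\<close>.\<close>
      have "fpt s 0 (site x s) \<le> (\<Sum>i<m. hop (y i) (y (Suc i)) s)"
        using fpt_path_le[OF m1, of s "\<lambda>i. site (y i) s"] y0 site_occupied[OF s(1)] by (simp add: hop_def)
      also have "\<dots> = (\<Sum>i<m. enat (a i))" using a by simp
      also have "\<dots> = enat (\<Sum>i<m. a i)" by (induction m) (auto simp: zero_enat_def)
      finally have f1: "fpt s 0 (site x s) \<le> enat (\<Sum>i<m. a i)" .
      obtain g where "g < l" "site x s = ray x g" using near_site(2)[OF near_x] by blast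
      then have f2: "fpt s (site x s) x \<le> enat (C1 * l ^ 5)" using h near_site(1)[OF near_x] by simp
      have "fpt s 0 x \<le> enat ((\<Sum>i<m. a i) + C1 * l ^ 5)" by (rule fpt_trans_le[OF f1 f2])
      then have "(1 + \<epsilon>) * mu (real_vec x) \<le> real ((\<Sum>i<m. a i) + C1 * l ^ 5)"
      proof (cases "fpt s 0 x")
        case (enat j)
        have "j \<le> (\<Sum>i<m. a i) + C1 * l ^ 5"
          using \<open>fpt s 0 x \<le> enat ((\<Sum>i<m. a i) + C1 * l ^ 5)\<close> enat by simp
        then have "real j \<le> real ((\<Sum>i<m. a i) + C1 * l ^ 5)" by (simp only: of_nat_le_iff)
        moreover have "(1 + \<epsilon>) * mu (real_vec x) \<le> real j" using s(2) enat by simp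
        ultimately show ?thesis by linarith
      qed simp
      also have "\<dots> = (\<Sum>i<m. Z i s) + real (C1 * l ^ 5)" using a by simp
      also have "real (C1 * l ^ 5) \<le> \<kappa> * n"
      proof -
        have "real (C1 * l ^ 5) \<le> real (C * l ^ 5)" by (simp add: C_def mult_right_mono)
        also have "\<dots> \<le> \<kappa> * real l ^ 22" using l1(2)[OF ll(1)] by simp
        also have "\<dots> \<le> \<kappa> * real n"
        proof -
          have "real (l ^ 22) \<le> real n" using n22(1) by (simp only: of_nat_le_iff)
          then show ?thesis using kap by simp
        qed
        finally show ?thesis .
      qed
      finally have "(1 + \<epsilon>) * mu (real_vec x) \<le> mu (real_vec x) + 5 * \<kappa> * n" using z ES by linarith
      then have "\<epsilon> * mu (real_vec x) \<le> \<epsilon> / 2 * (cm * n)" by (simp add: \<kappa>_def algebra_simps)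
      also have "\<dots> \<le> \<epsilon> / 2 * mu (real_vec x)" using cm(2)[of x] eps by (intro mult_left_mono) (auto simp: n)
      finally have "\<epsilon> * mu (real_vec x) \<le> 0" by simp
      moreover have "0 < cm * n" using cm(1) n0 by simp
      then have "0 < mu (real_vec x)" using cm(2)[of x] unfolding n by linarith
      ultimately show False using eps by (simp add: mult_le_0_iff)
    qed
    have mN: "?N \<in> F.events" by (rule sets_frogI) measurable
    have mGi: "{s. \<not> G i s} \<in> F.events" for i by (rule sets_frogI) measurable
    have mH: "?H g \<in> F.events" for g by (rule sets_frogI) measurable
    have mUG: "?UG \<in> F.events" using mGi by (intro sets.finite_UN) auto
    have mUH: "?UH \<in> F.events" using mH by (intro sets.finite_UN) auto
    have mC: "?Conc \<in> F.events" by (rule sets_frogI) measurable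
    have "F.prob ?Bad \<le> F.prob (?N \<union> ?UG \<union> ?UH \<union> ?Conc)"
      by (rule F.finite_measure_mono[OF sub]) (intro sets.Un mN mUG mUH mC)
    moreover have "F.prob (?N \<union> ?UG \<union> ?UH \<union> ?Conc) \<le> F.prob (?N \<union> ?UG \<union> ?UH) + F.prob ?Conc"
      by (intro measure_Un_le sets.Un mN mUG mUH mC)
    moreover have "F.prob (?N \<union> ?UG \<union> ?UH) \<le> F.prob (?N \<union> ?UG) + F.prob ?UH"
      by (intro measure_Un_le sets.Un mN mUG mUH)
    moreover have "F.prob (?N \<union> ?UG) \<le> F.prob ?N + F.prob ?UG" by (intro measure_Un_le mN mUG)
    moreover have "F.prob ?N = 0" by (rule prob_not_unit_sample)
    moreover have "F.prob ?UG \<le> 2 ^ 22 * A2 * B1 * exp (- c * real l)"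
    proof -
      have "F.prob ?UG \<le> (\<Sum>i<m. F.prob {s. \<not> G i s})"
        using mGi by (intro F.finite_measure_subadditive_finite) auto
      also have "\<dots> \<le> (\<Sum>i<m. A2 * exp (- c2 * real l))" by (intro sum_mono PG)
      also have "\<dots> = real m * (A2 * exp (- c2 * real l))" by simp
      also have "\<dots> \<le> (2 * real l) ^ 22 * (A2 * exp (- c2 * real l))"
      proof -
        have "m \<le> (2 * l) ^ 22" using mn n22(2) by (rule order_trans)
        then have "real m \<le> real ((2 * l) ^ 22)" by (simp only: of_nat_le_iff)
        then have "real m \<le> (2 * real l) ^ 22" by simp
        then show ?thesis using A2 by (intro mult_right_mono) auto
      qed
      also have "\<dots> = 2 ^ 22 * A2 * (real l ^ 22 * exp (- c2 * real l))" by (simp add: power_mult_distrib)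
      also have "\<dots> \<le> 2 ^ 22 * A2 * (B1 * exp (- (c2 / 2) * real l))"
        using A2 by (intro mult_left_mono B1(2)) auto
      also have "\<dots> \<le> 2 ^ 22 * A2 * (B1 * exp (- c * real l))"
      proof -
        have "c * real l \<le> c2 / 2 * real l" using c(2) by (rule mult_right_mono) simp
        then show ?thesis using A2 B1 by (intro mult_left_mono) auto
      qed
      finally show ?thesis by (simp only: mult.assoc)
    qed
    moreover have "F.prob ?UH \<le> A1 * B2 * exp (- c * real l)"
    proof -
      have "F.prob ?UH \<le> (\<Sum>g<l. F.prob (?H g))"
        using mH by (intro F.finite_measure_subadditive_finite) auto
      also have "\<dots> \<le> (\<Sum>g<l. A1 * exp (- c1 * real l))" by (intro sum_mono PH) simp
      also have "\<dots> = A1 * (real l ^ 1 * exp (- c1 * real l))" by simp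
      also have "\<dots> \<le> A1 * (B2 * exp (- (c1 / 2) * real l))"
        using A1 by (intro mult_left_mono B2(2)) auto
      also have "\<dots> \<le> A1 * (B2 * exp (- c * real l))"
      proof -
        have "c * real l \<le> c1 / 2 * real l" using c(3) by (rule mult_right_mono) simp
        then show ?thesis using A1 B2 by (intro mult_left_mono) auto
      qed
      finally show ?thesis by (simp only: mult.assoc)
    qed
    moreover have "F.prob ?Conc \<le> 8 * ?d * C * B3 * exp (- c * real l)"
    proof -
      have qM: "real q \<le> 8 * ?d * real M"
      proof -
        have "2 * D + 2 \<le> 8 * M" using M by (simp add: D_def)
        then have "q \<le> CARD('d) * (8 * M)" unfolding q_def by (rule mult_left_mono) simp
        then have "real q \<le> real (CARD('d) * (8 * M))" by (simp only: of_nat_le_iff)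
        then show ?thesis by simp
      qed
      \<comment> \<open>By m <= n the exponent is at least 2 \<kappa>^2 n / (q M)^2, and q M is at
        most of order l^10. With n >= l^22 this leaves order l^2, which exceeds l.\<close>
      have e: "real l \<le> 2 * t\<^sup>2 / (m * (real M)\<^sup>2)"
      proof -
        have "real q * real M \<le> 8 * ?d * real M * real M" using qM by (rule mult_right_mono) simp
        then have "(real q * real M)\<^sup>2 \<le> (8 * ?d * real M * real M)\<^sup>2" by (rule power_mono) simp
        also have "\<dots> = 64 * ?d\<^sup>2 * real M ^ 4" by (simp add: power2_eq_square power4_eq_xxxx)
        also have "real M ^ 4 = real C ^ 4 * real l ^ 20" by (simp add: M_def power_mult_distrib power_mult[symmetric])
        finally have qb: "(real q * real M)\<^sup>2 \<le> 64 * ?d\<^sup>2 * (real C ^ 4 * real l ^ 20)" .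
        have l20: "real l ^ 22 = real l ^ 2 * real l ^ 20" by (simp add: power_add[symmetric])
        have "real l * 1 \<le> real l * (c4 * real l)" using ll(4) by (rule mult_left_mono) simp
        then have "real l \<le> c4 * real l ^ 2" by (simp add: power2_eq_square mult_ac)
        also have "\<dots> = 2 * \<kappa>\<^sup>2 * real l ^ 22 / (64 * ?d\<^sup>2 * (real C ^ 4 * real l ^ 20))"
          using ll(3) C0 unfolding l20 c4_def by (simp add: field_simps)
        also have "\<dots> \<le> 2 * \<kappa>\<^sup>2 * real n / (real q * real M)\<^sup>2"
        proof (rule frac_le)
          have "real (l ^ 22) \<le> real n" using n22(1) by (simp only: of_nat_le_iff)
          then show "2 * \<kappa>\<^sup>2 * real l ^ 22 \<le> 2 * \<kappa>\<^sup>2 * real n" by (intro mult_left_mono) auto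
          show "0 < (real q * real M)\<^sup>2" using q0 M(2) by simp
        qed (use qb in auto)
        also have "\<dots> = 2 * \<kappa>\<^sup>2 * real n ^ 2 / (real n * (real q * real M)\<^sup>2)"
          using n0 by (simp add: power2_eq_square)
        also have "\<dots> \<le> 2 * \<kappa>\<^sup>2 * real n ^ 2 / (real m * (real q * real M)\<^sup>2)"
          using m1 mn q0 M(2) by (intro divide_left_mono mult_right_mono mult_pos_pos) auto
        also have "\<dots> = 2 * t\<^sup>2 / (m * (real M)\<^sup>2)"
          using q0 by (simp add: t_def power_mult_distrib power_divide mult_ac)
        finally show ?thesis .
      qed
      have "F.prob ?Conc \<le> q * exp (- 2 * t\<^sup>2 / (m * (real M)\<^sup>2))" by (rule PC)
      also have "\<dots> \<le> (8 * ?d * real M) * exp (- 1 * real l)" using qM e by (intro mult_mono) auto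
      also have "\<dots> = 8 * ?d * C * (real l ^ 5 * exp (- 1 * real l))" by (simp add: M_def)
      also have "\<dots> \<le> 8 * ?d * C * (B3 * exp (- (1 / 2) * real l))" by (intro mult_left_mono B3(2)) auto
      also have "\<dots> \<le> 8 * ?d * C * (B3 * exp (- c * real l))"
      proof -
        have "c * real l \<le> 1 / 2 * real l" using c(4) by (rule mult_right_mono) simp
        then show ?thesis using B3 by (intro mult_left_mono) auto
      qed
      finally show ?thesis by (simp only: mult.assoc)
    qed
    ultimately have "F.prob ?Bad \<le> 2 ^ 22 * A2 * B1 * exp (- c * real l) + A1 * B2 * exp (- c * real l)
        + 8 * ?d * C * B3 * exp (- c * real l)" by linarith
    then show ?thesis by (simp only: B_def distrib_right)
  qed
  then show ?thesis using B c(1) by blast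
qed

section \<open>From the estimate at scale l to the limit superior\<close>

theorem theorem1p2:
  fixes nu :: "nat pmf" and mu :: "real^'d::finite \<Rightarrow> real"
  assumes "CARD('d) \<ge> 2"
    and "pmf nu 0 < 1"
    and "is_norm mu"
    and "AE s in frog_space nu. fst s 0 \<ge> 1 \<longrightarrow>
          ((\<lambda>x. (ereal_of_enat (fpt s 0 x) - ereal (mu (real_vec x)))
                   / ereal (real_of_int (norm1 x))) \<longlongrightarrow> 0) norm1_infty"
  shows "\<exists>\<alpha>::real. 0 < \<alpha> \<and> \<alpha> < 1 \<and>
    (\<forall>\<epsilon>::real. \<epsilon> > 0 \<longrightarrow>
      Limsup norm1_infty (\<lambda>x::int^'d.
        ereal_ln (cond_prob (frog_space nu)
            {s \<in> space (frog_space nu). ereal ((1 + \<epsilon>) * mu (real_vec x)) \<le> ereal_of_enat (fpt s 0 x)}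
            {s \<in> space (frog_space nu). fst s 0 \<ge> 1})
        / ereal (real_of_int (norm1 x) powr \<alpha>)) < 0)"
proof (intro exI[of _ "1 / 22"] conjI allI impI)
  fix \<epsilon> :: real assume eps: "\<epsilon> > 0"
  let ?p = "measure (measure_pmf nu) {1..}"
  have p: "?p > 0" by (rule occupied_positive[OF assms(2)])
  let ?Bad = "\<lambda>x::int^'d. {s. 1 \<le> fst s 0 \<and> ereal ((1 + \<epsilon>) * mu (real_vec x)) \<le> ereal_of_enat (fpt s 0 x)}"
  let ?cp = "\<lambda>x::int^'d. cond_prob (frog_space nu)
            {s \<in> space (frog_space nu). ereal ((1 + \<epsilon>) * mu (real_vec x)) \<le> ereal_of_enat (fpt s 0 x)}
            {s \<in> space (frog_space nu). fst s 0 \<ge> 1}"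
  obtain B c l0 where B: "B > 0" and c: "c > 0"
    and bd: "\<forall>l\<ge>l0. \<forall>x::int^'d. int l ^ 22 \<le> norm1 x \<longrightarrow> norm1 x \<le> (2 * int l) ^ 22 \<longrightarrow>
    measure (frog_space nu) (?Bad x) \<le> B * exp (- c * real l)"
    using deviation_at_scale[OF assms(2,3,4) eps] by blast
  have cpe: "?cp x = measure (frog_space nu) (?Bad x) / ?p" for x
  proof -
    have "{s \<in> space (frog_space nu). ereal ((1 + \<epsilon>) * mu (real_vec x)) \<le> ereal_of_enat (fpt s 0 x)}
       \<inter> {s \<in> space (frog_space nu). fst s 0 \<ge> 1} = ?Bad x" by auto
    moreover have "{s \<in> space (frog_space nu). fst s (0::int^'d) \<ge> 1} = {s. 1 \<le> fst s 0}" by simp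
    ultimately show ?thesis unfolding cond_prob_def by (simp only: prob_occupied)
  qed
  define h where "h = ln (B / ?p)"
  \<comment> \<open>The last entry lets half of the rate absorb the constant B / p and the factor
    exp c lost by rounding r down to l.\<close>
  define N where "N = max 1 (max (real l0 + 1) (2 / c * (h + c)))"
  have main: "ereal_ln (?cp x) / ereal (real_of_int (norm1 x) powr (1 / 22)) \<le> ereal (- (c / 2))"
    if x: "N ^ 22 \<le> real_of_int (norm1 x)" for x :: "int^'d"
  proof -
    define r where "r = real_of_int (norm1 x) powr (1 / 22)"
    have N1: "N \<ge> 1" by (simp add: N_def)
    have n1: "real_of_int (norm1 x) \<ge> 1" using x one_le_power[OF N1, of 22] by linarith
    have r22: "r ^ 22 = real_of_int (norm1 x)"
      unfolding r_def using n1 by (subst powr_power) auto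
    have r0: "r \<ge> 0" by (simp add: r_def)
    have rN: "r \<ge> N"
    proof (rule ccontr)
      assume "\<not> r \<ge> N"
      then have "r ^ 22 < N ^ 22" using r0 by (intro power_strict_mono) auto
      then show False using x r22 by simp
    qed
    \<comment> \<open>Since l >= 1, r < l + 1 <= 2l, so \<open>norm1 x\<close> = r^22 lies in the
      window from l^22 to (2l)^22.\<close>
    define l where "l = nat \<lfloor>r\<rfloor>"
    have l: "real l \<le> r" "r < real l + 1" using r0 unfolding l_def by linarith+
    have ll0: "l \<ge> l0" "l \<ge> 1" using rN l unfolding N_def by linarith+
    have "real l ^ 22 \<le> r ^ 22" using l by (intro power_mono) auto
    then have "real_of_int (int l ^ 22) \<le> real_of_int (norm1 x)" unfolding r22 by simp
    then have a: "int l ^ 22 \<le> norm1 x" by (simp only: of_int_le_iff)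
    have "r ^ 22 \<le> (2 * real l) ^ 22" using l ll0 r0 by (intro power_mono) auto
    then have "real_of_int (norm1 x) \<le> real_of_int ((2 * int l) ^ 22)" unfolding r22 by simp
    then have b: "norm1 x \<le> (2 * int l) ^ 22" by (simp only: of_int_le_iff)
    have "measure (frog_space nu) (?Bad x) \<le> B * exp (- c * real l)"
      using bd[rule_format, OF ll0(1) a b] .
    also have "\<dots> \<le> B * exp (c - c * r)"
    proof -
      have "c * r \<le> c * (real l + 1)" using l c by (intro mult_left_mono) auto
      then show ?thesis using B by (simp add: algebra_simps)
    qed
    finally have "?cp x \<le> B * exp (c - c * r) / ?p" unfolding cpe using p by (intro divide_right_mono) auto
    also have "\<dots> = exp (h + (c - c * r))" using B p by (simp add: h_def exp_add)
    also have "\<dots> \<le> exp (- (c / 2) * r)"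
    proof -
      have "2 / c * (h + c) \<le> r" using rN by (simp add: N_def)
      then have "c / 2 * (2 / c * (h + c)) \<le> c / 2 * r" using c by (intro mult_left_mono) auto
      then have "h + c \<le> c / 2 * r" using c by simp
      then show ?thesis by simp
    qed
    finally have cp: "?cp x \<le> exp (- (c / 2) * r)" .
    have rpos: "r > 0" using rN N1 by linarith
    show ?thesis
    proof (cases "?cp x > 0")
      case True
      then have "ln (?cp x) \<le> ln (exp (- (c / 2) * r))" using cp by (subst ln_le_cancel_iff) auto
      then have "ln (?cp x) / r \<le> - (c / 2)" using rpos by (simp add: field_simps)
      then show ?thesis using True rpos unfolding r_def[symmetric] by (simp add: ereal_ln_def)
    next
      \<comment> \<open>The probability is then 0, and \<open>ereal_ln\<close> assigns it minus
        infinity, which division by the positive \<open>r\<close> preserves.\<close>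
      case False
      then show ?thesis using rpos unfolding r_def[symmetric] by (simp add: ereal_ln_def)
    qed
  qed
  have "\<forall>\<^sub>F x in norm1_infty. ereal_ln (?cp x) / ereal (real_of_int (norm1 x) powr (1 / 22)) \<le> ereal (- (c / 2))"
    unfolding norm1_infty_def eventually_filtercomap eventually_at_top_linorder
    by (intro exI[of _ "\<lambda>y. y \<ge> N ^ 22"]) (use main in auto)
  then have "Limsup norm1_infty (\<lambda>x. ereal_ln (?cp x) / ereal (real_of_int (norm1 x) powr (1 / 22))) \<le> ereal (- (c / 2))"
    by (rule Limsup_bounded)
  also have "\<dots> < 0" using c by simp
  finally show "Limsup norm1_infty (\<lambda>x. ereal_ln (?cp x) / ereal (real_of_int (norm1 x) powr (1 / 22))) < 0" .
qed auto

end
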